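(* Let $n\geq 5$ be an integer with $n\neq 6$. Then $\mathbb{H}/\Gamma_n$ has genus $0$, and it has $\frac{n+1}{2}$ cusps if $n$ is odd and $\frac{n+2}{2}$ cusps if $n$ is even.
   Context: $\mathbb{H}$ is the upper half plane, on which $\mathrm{SL}_2(\mathbb{R})$ acts by Möbius transformations. Put $$R_n = \begin{pmatrix} \cos\frac{\pi}{n} & -\sin\frac{\pi}{n} \\ \sin\frac{\pi}{n} & \cos\frac{\pi}{n} \end{pmatrix}, \quad T_n = \begin{pmatrix} 1 & \lambda_n \\ 0 & 1 \end{pmatrix}, \quad \lambda_n = 2\cot\frac{\pi}{n},$$ and let $I$ be the $2\times 2$ identity matrix. The group $\Gamma_n\subset\mathrm{SL}_2(\mathbb{R})$ is defined as follows (it is a lattice, namely the Veech group of certain translation coverings of the regular double-$n$-gon for odd $n$, respectively of the regular $n$-gon for even $n$). - For odd $n\ge5$: $\Gamma_n$ is generated by $-I$, $T_n$ and the matrices $R_n^{l}\,T_n^2\,R_n^{-l}$ for $1\le l\le\frac{n-1}{2}$. - For even $n\ge 8$: $\Gamma_n$ is generated by $-I$, $T_n$, the matrices $R_n^{2l}\,T_n^2\,R_n^{-2l}$ for $1\le l\le\frac{n-2}{2}$, and the matrices $R_n^{2l}\,(T_n^{-1}R_n^2)^2\,R_n^{-2l}$ for $0\le l\le\frac{n-2}{2}$. The cusps of $\mathbb{H}/\Gamma_n$ are the $\Gamma_n$-orbits of points of $\mathbb{R}\cup\{\infty\}$ fixed by a parabolic element of $\Gamma_n$; the genus of $\mathbb{H}/\Gamma_n$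 is the genus of the compact surface obtained by adding the cusps. *)

theory Defs
  imports "HOL-Analysis.Analysis" "HOL-Homology.Homology" "HOL-Algebra.Generated_Groups" "HOL-Algebra.Group_Action"
begin

section \<open>The groups\<close>

definition mat2 :: "real \<Rightarrow> real \<Rightarrow> real \<Rightarrow> real \<Rightarrow> real^2^2" where
  "mat2 a b c d = vector [vector [a, b], vector [c, d]]"

definition SL2R :: "(real^2^2) monoid" where
  "SL2R = \<lparr>carrier = {A. det A = 1}, monoid.mult = (**), one = mat 1\<rparr>"

definition lam :: "nat \<Rightarrow> real" where
  "lam n = 2 * cot (pi / real n)"

definition R_mat :: "nat \<Rightarrow> real^2^2" where
  "R_mat n = mat2 (cos (pi / real n)) (- sin (pi / real n)) (sin (pi / real n)) (cos (pi / real n))"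

definition T_mat :: "nat \<Rightarrow> real^2^2" where
  "T_mat n = mat2 1 (lam n) 0 1"

definition conj_R :: "nat \<Rightarrow> nat \<Rightarrow> real^2^2 \<Rightarrow> real^2^2" where
  "conj_R n k A = R_mat n [^]\<^bsub>SL2R\<^esub> int k \<otimes>\<^bsub>SL2R\<^esub> A \<otimes>\<^bsub>SL2R\<^esub> R_mat n [^]\<^bsub>SL2R\<^esub> (- int k)"

definition Gamma_generators :: "nat \<Rightarrow> (real^2^2) set" where
  "Gamma_generators n =
    (if odd n then
       {- mat 1, T_mat n}
       \<union> {conj_R n l (T_mat n [^]\<^bsub>SL2R\<^esub> (2::nat)) | l. 1 \<le> l \<and> l \<le> (n - 1) div 2}
     else
       {- mat 1, T_mat n}
       \<union> {conj_R n (2 * l) (T_mat n [^]\<^bsub>SL2R\<^esub> (2::nat)) | l. 1 \<le> l \<and> l \<le> (n - 2) div 2}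
       \<union> {conj_R n (2 * l) ((inv\<^bsub>SL2R\<^esub> T_mat n \<otimes>\<^bsub>SL2R\<^esub> R_mat n [^]\<^bsub>SL2R\<^esub> (2::nat)) [^]\<^bsub>SL2R\<^esub> (2::nat))
           | l. l \<le> (n - 2) div 2})"

definition Gamma_group :: "nat \<Rightarrow> (real^2^2) monoid" where
  "Gamma_group n = SL2R\<lparr>carrier := generate SL2R (Gamma_generators n)\<rparr>"

lemma mat2_nth [simp]:
  "mat2 a b c d $ 1 $ 1 = a" "mat2 a b c d $ 1 $ 2 = b"
  "mat2 a b c d $ 2 $ 1 = c" "mat2 a b c d $ 2 $ 2 = d"
  by (simp_all add: mat2_def vector_2)

lemma det_mat2 [simp]: "det (mat2 a b c d) = a * d - b * c"
  by (simp add: det_2)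

lemma group_SL2R: "group SL2R"
proof (rule groupI)
  fix A assume A: "A \<in> carrier SL2R"
  then obtain B where B: "B ** A = mat 1"
    using invertible_det_nz [of A] by (auto simp: SL2R_def invertible_def)
  then have "det B * det A = 1"
    by (metis det_I det_mul)
  with A B show "\<exists>B\<in>carrier SL2R. B \<otimes>\<^bsub>SL2R\<^esub> A = \<one>\<^bsub>SL2R\<^esub>"
    by (auto simp: SL2R_def)
qed (auto simp: SL2R_def det_mul matrix_mul_assoc)

lemma R_in_SL2R: "R_mat n \<in> carrier SL2R"
  by (simp add: SL2R_def R_mat_def power2_eq_square [symmetric])

lemma T_in_SL2R: "T_mat n \<in> carrier SL2R"
  by (simp add: SL2R_def T_mat_def)

lemma neg_one_in_SL2R: "- mat 1 \<in> carrier SL2R"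
  by (simp add: SL2R_def det_2 mat_def)

lemma conj_R_in_SL2R: "A \<in> carrier SL2R \<Longrightarrow> conj_R n k A \<in> carrier SL2R"
  unfolding conj_R_def
  by (intro monoid.m_closed group.is_monoid group.int_pow_closed group_SL2R R_in_SL2R)

lemma Gamma_generators_subset: "Gamma_generators n \<subseteq> carrier SL2R"
  using group_SL2R
  by (auto simp: Gamma_generators_def
      intro!: conj_R_in_SL2R R_in_SL2R T_in_SL2R neg_one_in_SL2R monoid.m_closed
        monoid.nat_pow_closed group.inv_closed group.is_monoid)

lemma group_Gamma_group: "group (Gamma_group n)"
  unfolding Gamma_group_def
  by (rule subgroup.subgroup_is_group
      [OF group.generate_is_subgroup [OF group_SL2R Gamma_generators_subset] group_SL2R])


section \<open>Moebius action, parabolic elements and cusps\<close>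

text \<open>The Riemann sphere is \<^typ>\<open>complex option\<close>, with \<^const>\<open>None\<close> as the point at infinity.\<close>

definition moebius :: "real^2^2 \<Rightarrow> complex option \<Rightarrow> complex option" where
  "moebius A p = (case p of
      None \<Rightarrow> if A$2$1 = 0 then None else Some (of_real (A$1$1) / of_real (A$2$1))
    | Some z \<Rightarrow>
        if of_real (A$2$1) * z + of_real (A$2$2) = 0 then None
        else Some ((of_real (A$1$1) * z + of_real (A$1$2))
                   / (of_real (A$2$1) * z + of_real (A$2$2))))"

definition upper_half_plane :: "complex set" where
  "upper_half_plane = {z. Im z > 0}"

definition extended_real_line :: "complex option set" where
  "extended_real_line = insert None (range (\<lambda>x::real. Some (of_real x)))"

definition parabolic :: "real^2^2 \<Rightarrow> bool" where
  "parabolic A \<longleftrightarrow> det A = 1 \<and> A \<noteq> mat 1 \<and> A \<noteq> - mat 1 \<and> \<bar>trace A\<bar> = 2"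

definition cusp_points :: "(real^2^2) monoid \<Rightarrow> complex option set" where
  "cusp_points G = {p \<in> extended_real_line. \<exists>A\<in>carrier G. parabolic A \<and> moebius A p = p}"

definition cusps :: "(real^2^2) monoid \<Rightarrow> complex option set set" where
  "cusps G = orbits G (cusp_points G) moebius"


section \<open>The quotient of the upper half plane with the cusps added\<close>

definition horoball :: "complex option \<Rightarrow> real \<Rightarrow> complex set" where
  "horoball p r = (case p of
      None \<Rightarrow> {z. Im z > r}
    | Some x \<Rightarrow> ball (x + \<i> * of_real r) r)"

text \<open>The usual horoball topology on the union of the upper half plane and the cusp points
  of \<open>G\<close>: a neighbourhood base at a cusp point consists of the horoballs
  based at it, together with the point itself.\<close>

definition extended_half_plane :: "(real^2^2) monoid \<Rightarrow> complex option topology" where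
  "extended_half_plane G = topology_generated_by
     ({Some ` U | U. open U \<and> U \<subseteq> upper_half_plane}
      \<union> {insert p (Some ` horoball p r) | p r. p \<in> cusp_points G \<and> r > 0})"

definition quotient_topology :: "'a topology \<Rightarrow> ('a \<Rightarrow> 'b) \<Rightarrow> 'b topology" where
  "quotient_topology X f =
     topology (\<lambda>U. U \<subseteq> f ` topspace X \<and> openin X {x \<in> topspace X. f x \<in> U})"

lemma openin_quotient_topology:
  "openin (quotient_topology X f) U \<longleftrightarrow>
     U \<subseteq> f ` topspace X \<and> openin X {x \<in> topspace X. f x \<in> U}"
proof -
  have "istopology (\<lambda>U. U \<subseteq> f ` topspace X \<and> openin X {x \<in> topspace X. f x \<in> U})"
    unfolding istopology_def
  proof (intro conjI allI impI)
    fix S V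
    assume S: "S \<subseteq> f ` topspace X \<and> openin X {x \<in> topspace X. f x \<in> S}"
      and V: "V \<subseteq> f ` topspace X \<and> openin X {x \<in> topspace X. f x \<in> V}"
    then show "S \<inter> V \<subseteq> f ` topspace X" by blast
    have "{x \<in> topspace X. f x \<in> S \<inter> V}
        = {x \<in> topspace X. f x \<in> S} \<inter> {x \<in> topspace X. f x \<in> V}" by blast
    with S V show "openin X {x \<in> topspace X. f x \<in> S \<inter> V}" by auto
  next
    fix \<K>
    assume K: "\<forall>K\<in>\<K>. K \<subseteq> f ` topspace X \<and> openin X {x \<in> topspace X. f x \<in> K}"
    then show "\<Union>\<K> \<subseteq> f ` topspace X" by blast
    have "{x \<in> topspace X. f x \<in> \<Union>\<K>} = (\<Union>K\<in>\<K>. {x \<in> topspace X. f x \<in> K})" by blast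
    with K show "openin X {x \<in> topspace X. f x \<in> \<Union>\<K>}" by auto
  qed
  then show ?thesis by (simp add: quotient_topology_def)
qed

lemma topspace_quotient_topology [simp]:
  "topspace (quotient_topology X f) = f ` topspace X"
proof
  show "topspace (quotient_topology X f) \<subseteq> f ` topspace X"
    by (metis openin_quotient_topology openin_topspace)
  have "{x \<in> topspace X. f x \<in> f ` topspace X} = topspace X" by blast
  then have "openin (quotient_topology X f) (f ` topspace X)"
    by (simp add: openin_quotient_topology)
  then show "f ` topspace X \<subseteq> topspace (quotient_topology X f)"
    by (rule openin_subset)
qed

lemma quotient_map_quotient_topology: "quotient_map X (quotient_topology X f) f"
  by (auto simp: quotient_map_def openin_quotient_topology)

definition completed_quotient :: "(real^2^2) monoid \<Rightarrow> complex option set topology" where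
  "completed_quotient G = quotient_topology (extended_half_plane G) (orbit G moebius)"

lemma topspace_extended_half_plane:
  "topspace (extended_half_plane G) = Some ` upper_half_plane \<union> cusp_points G"
proof -
  have sub: "Some ` horoball p r \<subseteq> Some ` upper_half_plane"
    if p: "p \<in> cusp_points G" and r: "r > 0" for p r
  proof (cases p)
    case None
    then show ?thesis using r by (auto simp: horoball_def upper_half_plane_def)
  next
    case (Some x)
    with p have x: "Im x = 0" by (auto simp: cusp_points_def extended_real_line_def)
    have "Im z > 0" if "z \<in> ball (x + \<i> * of_real r) r" for z
      using abs_Im_le_cmod [of "x + \<i> * of_real r - z"] that x
      by (auto simp: dist_norm)
    then show ?thesis using Some by (auto simp: horoball_def upper_half_plane_def)
  qed
  have "open upper_half_plane"
    unfolding upper_half_plane_def by (rule open_halfspace_Im_gt)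
  then have 1: "Some ` upper_half_plane \<subseteq> topspace (extended_half_plane G)"
    unfolding extended_half_plane_def topology_generated_by_topspace by blast
  have 2: "cusp_points G \<subseteq> topspace (extended_half_plane G)"
    unfolding extended_half_plane_def topology_generated_by_topspace
    using zero_less_one by blast
  have 3: "topspace (extended_half_plane G) \<subseteq> Some ` upper_half_plane \<union> cusp_points G"
    unfolding extended_half_plane_def topology_generated_by_topspace
    using sub by blast
  show ?thesis using 1 2 3 by blast
qed


section \<open>Genus\<close>

definition closed_surface :: "'a topology \<Rightarrow> bool" where
  "closed_surface X \<longleftrightarrow>
     compact_space X \<and> connected_space X \<and> Hausdorff_space X \<and> topspace X \<noteq> {} \<and>
     (\<forall>x\<in>topspace X. \<exists>U. openin X U \<and> x \<in> U \<and>
        subtopology X U homeomorphic_space (euclidean :: complex topology))"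

text \<open>The genus of a compact connected orientable surface is half the rank of its first integral
  homology group. Orientability need not be required separately: the first homology group of a
  non-orientable closed surface has 2-torsion, so it is not free.\<close>

definition closed_surface_of_genus :: "'a topology \<Rightarrow> nat \<Rightarrow> bool" where
  "closed_surface_of_genus X g \<longleftrightarrow>
     closed_surface X \<and> homology_group 1 X \<cong> free_Abelian_group {..<2 * g}"

text \<open>For \<open>G\<close> a lattice, this says that \<open>H / G\<close>, completed by its cusps, has genus \<open>g\<close>.\<close>

definition quotient_has_genus :: "(real^2^2) monoid \<Rightarrow> nat \<Rightarrow> bool" where
  "quotient_has_genus G g \<longleftrightarrow> closed_surface_of_genus (completed_quotient G) g"

end

(* Put R = R_n, T = T_n. The ideal n-gon P with vertices R^l(oo) is bounded by the images R^l(e_0) of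
the vertical line e_0 through cot(pi/n), and g_l = R^l T R^l maps the side e_{-1-l} to e_l. Since
R^l T^2 R^-l = g_l g_{-l} and g_l g_{-1-l} = -I, the group Gamma_n is generated by -I and the g_l, for
odd as well as for even n. By ping-pong on the half-planes cut off by the sides, P is a fundamental
polygon. The identification of its boundary is z ~ -cnj z; in the Klein disc, where P is a Euclidean
regular n-gon with a vertex at 1, this is complex conjugation. Identifying conjugate boundary points of
a disc gives a sphere (the Joukowski map w + 1/w does so explicitly), and the n vertices fall into
n div 2 + 1 classes. That all cusps are vertices follows from ping-pong for cyclically reduced
words: the fixed point of a parabolic element is the limit of both its positive and its negative
iterates, hence lies on two sides of P. *)

theory Submission
  imports Defs
begin


subsection \<open>The sphere\<close>

text \<open>Discreteness of the group and local finiteness of the tessellation are never established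
  as separate facts. The homeomorphism comes from a map on the whole extended half-plane: carry a
  point into P by any group element, then fold P along complex conjugation. Ping-pong makes the
  result independent of the element: if a reduced word carries a point of P into P, then stripping
  off its letters one at a time merely conjugates the image point, which stays on the boundary of P
  until no letter is left. Covering by translates of P is a minimisation over an orbit; as the
  infimum might not be attained, the argument takes place at a limit point. The quotient is the
  image of P with its vertices, a compact set, so a continuous bijection onto the sphere is a
  homeomorphism. The delicate point is the cusps. Horoball neighbourhoods differ from Euclidean
  neighbourhoods in the disc, and infinitely many translates of P accumulate at a cusp. Both
  difficulties are resolved in the strip that P becomes when the vertex is moved to
  infinity.\<close>

abbreviation two_sphere :: "(complex \<times> real) set" where
  "two_sphere \<equiv> sphere 0 1"

text \<open>The homology of \<open>nsphere 2\<close> is known; its points are functions on the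
  naturals supported on 0, 1, 2. The model in complex times real suits the Joukowski
  formulas.\<close>

lemma two_sphere_homeomorphic_nsphere:
  "top_of_set two_sphere homeomorphic_space nsphere 2"
proof -
  define e :: "complex \<times> real \<Rightarrow> nat \<Rightarrow> real" where
    "e = (\<lambda>p i. if i = 0 then Re (fst p) else if i = 1 then Im (fst p) else if i = 2 then snd p else 0)"
  have norm_one: "norm p = 1 \<longleftrightarrow> (Re (fst p))\<^sup>2 + (Im (fst p))\<^sup>2 + (snd p)\<^sup>2 = 1" for p :: "complex \<times> real"
    by (simp add: norm_prod_def cmod_def real_sqrt_eq_1_iff)
  have sum3: "(\<Sum>i\<le>2. f i) = f 0 + f 1 + f 2" for f :: "nat \<Rightarrow> real"
    by (simp add: numeral_2_eq_2)
  have "homeomorphic_map (top_of_set two_sphere) (nsphere 2) e"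
  proof (rule continuous_imp_homeomorphic_map)
    have "continuous_map (top_of_set two_sphere) (powertop_real UNIV) e"
      unfolding continuous_map_componentwise_UNIV e_def
      by (auto simp: if_distrib intro!: continuous_intros)
    moreover have "e ` two_sphere \<subseteq> {x. (\<Sum>i\<le>2. x i ^ 2) = 1 \<and> (\<forall>i>2. x i = 0)}"
      by (auto simp: norm_one sum3) (auto simp: e_def)
    ultimately show "continuous_map (top_of_set two_sphere) (nsphere 2) e"
      by (auto simp: nsphere continuous_map_in_subtopology)
    show "compact_space (top_of_set two_sphere)"
      by (simp add: compact_space_subtopology)
    show "Hausdorff_space (nsphere 2)"
      unfolding nsphere
      by (intro Hausdorff_space_subtopology) (simp add: Hausdorff_space_product_topology)
    show "inj_on e (topspace (top_of_set two_sphere))"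
    proof (rule inj_onI)
      fix p q assume "e p = e q"
      then have "e p 0 = e q 0" "e p 1 = e q 1" "e p 2 = e q 2" by simp_all
      then show "p = q" by (auto simp: e_def prod_eq_iff complex_eq_iff)
    qed
    show "e ` topspace (top_of_set two_sphere) = topspace (nsphere 2)"
    proof
      show "e ` topspace (top_of_set two_sphere) \<subseteq> topspace (nsphere 2)"
        by (auto simp: nsphere norm_one sum3) (auto simp: e_def)
      show "topspace (nsphere 2) \<subseteq> e ` topspace (top_of_set two_sphere)"
      proof
        fix x assume "x \<in> topspace (nsphere 2)"
        then have x: "(x 0)\<^sup>2 + (x 1)\<^sup>2 + (x 2)\<^sup>2 = 1" "\<And>i. i > 2 \<Longrightarrow> x i = 0"
          by (auto simp: nsphere sum3)
        have "x = e (Complex (x 0) (x 1), x 2)"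
        proof
          fix i show "x i = e (Complex (x 0) (x 1), x 2) i"
            using x(2) [of i] by (auto simp: e_def)
        qed
        moreover have "(Complex (x 0) (x 1), x 2) \<in> two_sphere"
          using x(1) by (simp add: norm_one)
        ultimately show "x \<in> e ` topspace (top_of_set two_sphere)" by auto
      qed
    qed
  qed
  then show ?thesis by (rule homeomorphic_map_imp_homeomorphic_space)
qed

section \<open>Surfaces homeomorphic to the sphere have genus 0\<close>

lemma trivial_groups_isomorphic:
  assumes "trivial_group G" "trivial_group H"
  shows "G \<cong> H"
proof -
  have "(\<lambda>_. \<one>\<^bsub>H\<^esub>) \<in> iso G H"
    using assms by (auto simp: trivial_group_def iso_def hom_def bij_betw_def group.is_monoid)
  then show ?thesis by (auto simp: is_iso_def)
qed

lemma closed_surface_of_genus_0_if_sphere: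
  assumes X: "X homeomorphic_space top_of_set two_sphere"
  shows "closed_surface_of_genus X 0"
proof -
  obtain f g where fg: "homeomorphic_maps X (top_of_set two_sphere) f g"
    using X by (auto simp: homeomorphic_space_def)
  then have f: "homeomorphic_map X (top_of_set two_sphere) f"
    by (rule homeomorphic_maps_map [THEN iffD1, THEN conjunct1])
  have "two_sphere \<noteq> {}" by simp
  then have ne: "topspace X \<noteq> {}"
    using homeomorphic_imp_surjective_map [OF f] by (metis image_empty topspace_euclidean_subtopology)
  have "connected two_sphere" by (rule connected_sphere) simp
  then have conn: "connected_space X"
    using homeomorphic_connected_space [OF X] by (simp add: connected_space_subtopology)
  have comp: "compact_space X"
    using homeomorphic_compact_space [OF X] by (simp add: compact_space_subtopology)
  have haus: "Hausdorff_space X"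
    using homeomorphic_Hausdorff_space [OF X] by (simp add: Hausdorff_space_subtopology)
  have loc: "\<exists>U. openin X U \<and> x \<in> U \<and>
        subtopology X U homeomorphic_space (euclidean :: complex topology)"
    if x: "x \<in> topspace X" for x
  proof -
    \<comment> \<open>Removing the antipode of \<open>f x\<close> leaves a plane containing
      \<open>f x\<close>, which serves as a chart.\<close>
    define b where "b = - f x"
    have fx: "f x \<in> two_sphere"
      using homeomorphic_imp_surjective_map [OF f] x by auto
    then have b: "b \<in> two_sphere" and bx: "f x \<noteq> b"
      by (auto simp: b_def prod_eq_iff complex_eq_iff norm_prod_def cmod_def)
    define U where "U = {y \<in> topspace X. f y \<in> two_sphere - {b}}"
    have "openin (top_of_set two_sphere) (two_sphere - {b})"
      by (simp add: openin_delete)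
    then have "openin X U"
      unfolding U_def
      by (rule openin_continuous_map_preimage [OF homeomorphic_imp_continuous_map [OF f]])
    moreover have "x \<in> U" using x fx bx by (simp add: U_def)
    moreover have "f ` topspace X = two_sphere"
      using homeomorphic_imp_surjective_map [OF f] by simp
    then have "f ` U = two_sphere - {b}"
      unfolding U_def by blast
    then have "homeomorphic_map (subtopology X U) (subtopology (top_of_set two_sphere) (two_sphere - {b})) f"
      using homeomorphic_imp_surjective_map [OF f]
      by (intro homeomorphic_map_subtopologies f) (auto simp: U_def)
    then have "subtopology X U homeomorphic_space top_of_set (two_sphere - {b})"
      using homeomorphic_map_imp_homeomorphic_space
      by (fastforce simp: subtopology_subtopology Int_absorb1)
    moreover have "(two_sphere - {b}) homeomorphic (UNIV :: complex set)"
      using b by (intro homeomorphic_punctured_sphere_affine) auto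
    then obtain g h where "homeomorphism (two_sphere - {b}) (UNIV :: complex set) g h"
      unfolding homeomorphic_def by blast
    then have "homeomorphic_maps (top_of_set (two_sphere - {b})) (euclidean :: complex topology) g h"
      unfolding homeomorphism_def homeomorphic_maps_def
      by (auto simp: continuous_map_in_subtopology)
    then have "top_of_set (two_sphere - {b}) homeomorphic_space (euclidean :: complex topology)"
      unfolding homeomorphic_space_def by blast
    ultimately show ?thesis using homeomorphic_space_trans by blast
  qed
  have "X homeomorphic_space nsphere 2"
    using X two_sphere_homeomorphic_nsphere homeomorphic_space_trans by blast
  then have 1: "homology_group 1 X \<cong> homology_group 1 (nsphere 2)"
    by (rule homeomorphic_space_imp_isomorphic_homology_groups)
  \<comment> \<open>In degree 1, away from degree 0, reduced and unreduced homology agree.\<close>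
  have "trivial_group (reduced_homology_group 1 (nsphere 2))"
    by (simp add: trivial_reduced_homology_group_nsphere)
  then have "trivial_group (homology_group 1 (nsphere 2))"
    by (simp add: un_reduced_homology_group)
  then have "trivial_group (homology_group 1 X)"
    using 1 isomorphic_group_triviality by (metis group_relative_homology_group)
  moreover have "trivial_group (free_Abelian_group {..<2 * (0::nat)})"
    unfolding trivial_group_def by (intro conjI group_free_Abelian_group) auto
  ultimately have "homology_group 1 X \<cong> free_Abelian_group {..<2 * (0::nat)}"
    by (rule trivial_groups_isomorphic)
  then show ?thesis
    using conn comp haus ne loc by (simp add: closed_surface_of_genus_def closed_surface_def)
qed

subsection \<open>The regular polygon\<close>

lemma cos_ge_imp_near_period:
  assumes "0 < \<phi>" "\<phi> < pi" "cos \<phi> \<le> cos \<beta>"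
  shows "\<exists>t::int. \<bar>\<beta> - 2 * pi * t\<bar> \<le> \<phi>"
proof -
  \<comment> \<open>The integer nearest to \<open>\<beta> / (2 * pi)\<close>. It moves \<beta> into
    [-pi, pi], where the cosine decreases with the absolute value.\<close>
  define t where "t = \<lfloor>\<beta> / (2 * pi) + 1/2\<rfloor>"
  define \<gamma> where "\<gamma> = \<beta> - 2 * pi * t"
  have "of_int t \<le> \<beta> / (2 * pi) + 1/2" "\<beta> / (2 * pi) + 1/2 < of_int t + 1"
    unfolding t_def by linarith+
  then have "\<bar>\<gamma>\<bar> \<le> pi"
    by (auto simp: \<gamma>_def abs_le_iff field_simps)
  moreover have "cos \<bar>\<gamma>\<bar> = cos \<beta>"
    using cos_int_2pin sin_int_2pin by (simp add: \<gamma>_def cos_diff)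
  ultimately have "\<bar>\<gamma>\<bar> \<le> \<phi>"
    using cos_mono_le_eq [of "\<phi>" "\<bar>\<gamma>\<bar>"] assms by auto
  then show ?thesis by (auto simp: \<gamma>_def)
qed

locale ideal_polygon =
  fixes n :: nat
  assumes n_ge_3: "n \<ge> 3"
begin

text \<open>Half the angle between adjacent vertices: the matrix R_n acts on the Klein disc as the
  rotation by 2 \<phi>.\<close>

definition \<phi> :: real where "\<phi> = pi / real n"

text \<open>The \<open>l\<close>-th side of the polygon, normalised so that the polygon lies in the half-plane
  \<open>side l k \<le> 1\<close>; its endpoints are \<open>cis (2 l \<phi>)\<close> and \<open>cis (2 (l + 1) \<phi>)\<close>.\<close>

definition side :: "int \<Rightarrow> complex \<Rightarrow> real" where
  "side l k = Re (cis (- (2 * of_int l + 1) * \<phi>) * k) / cos \<phi>"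

text \<open>All integers serve as labels although only residues mod n matter
  (\<open>side_mod\<close>). Rotations and conjugation then act on labels by plain
  arithmetic.\<close>

definition polygon :: "complex set" where
  "polygon = {k. \<forall>l. side l k \<le> 1}"

text \<open>The Minkowski functional of the polygon, taken over one period of labels so that the
  maximum is over a finite set.\<close>

definition gauge :: "complex \<Rightarrow> real" where
  "gauge k = Max ((\<lambda>l. side l k) ` {0..<int n})"

definition vertex :: "int \<Rightarrow> complex" where
  "vertex j = cis (2 * of_int j * \<phi>)"

lemma n_phi: "real n * \<phi> = pi"
  using n_ge_3 by (simp add: \<phi>_def)

lemma phi_pos: "0 < \<phi>" and phi_lt: "\<phi> < pi / 2"
proof -
  show "0 < \<phi>" using n_ge_3 by (simp add: \<phi>_def)
  have "\<phi> \<le> pi / 3" unfolding \<phi>_def using n_ge_3 by (intro divide_left_mono) auto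
  then show "\<phi> < pi / 2" using pi_gt_zero by linarith
qed

lemma cos_phi_pos: "0 < cos \<phi>" and sin_phi_pos: "0 < sin \<phi>"
  using phi_pos phi_lt by (auto intro: cos_gt_zero_pi sin_gt_zero)

lemma side_mod: "side (l mod int n) k = side l k"
proof -
  have *: "real_of_int l = of_int (l mod int n) + real n * of_int (l div int n)"
    by (metis mod_mult_div_eq of_int_add of_int_mult of_int_of_nat_eq)
  have "- (2 * of_int l + 1) * \<phi> = - (2 * of_int (l mod int n) + 1) * \<phi> + 2 * pi * of_int (- (l div int n))"
    unfolding * n_phi [symmetric] by (simp add: algebra_simps)
  then have "cis (- (2 * of_int l + 1) * \<phi>) = cis (- (2 * of_int (l mod int n) + 1) * \<phi>)"
    by (metis cis_mult cis_multiple_2pi Ints_of_int mult.right_neutral)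
  then show ?thesis by (simp add: side_def)
qed

lemma vertex_mod: "vertex (j mod int n) = vertex j"
proof -
  have *: "real_of_int j = of_int (j mod int n) + real n * of_int (j div int n)"
    by (metis mod_mult_div_eq of_int_add of_int_mult of_int_of_nat_eq)
  have "2 * of_int j * \<phi> = 2 * of_int (j mod int n) * \<phi> + 2 * pi * of_int (j div int n)"
    unfolding * n_phi [symmetric] by (simp add: algebra_simps)
  then show ?thesis
    unfolding vertex_def by (metis cis_mult cis_multiple_2pi Ints_of_int mult.right_neutral)
qed

text \<open>The midpoint of side l has angle (2 l + 1) \<phi>, and - (2 l + 1) = 2 (- 1 - l) + 1.
  The same involution of labels describes the side pairing.\<close>

lemma side_cnj: "side l (cnj k) = side (- 1 - l) k"
proof -
  have "Re (cis (- (2 * of_int l + 1) * \<phi>) * cnj k) = Re (cnj (cis (- (2 * of_int l + 1) * \<phi>)) * k)"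
    by simp
  also have "cnj (cis (- (2 * of_int l + 1) * \<phi>)) = cis (- (2 * of_int (- 1 - l) + 1) * \<phi>)"
    by (simp add: cis_cnj algebra_simps)
  finally show ?thesis by (simp add: side_def)
qed

lemma side_vertex_mult: "side l (vertex m * k) = side (l - m) k"
proof -
  have "cis (- (2 * of_int l + 1) * \<phi>) * (vertex m * k)
      = cis (- (2 * of_int l + 1) * \<phi> + 2 * of_int m * \<phi>) * k"
    by (simp add: vertex_def cis_mult mult.assoc [symmetric])
  also have "- (2 * of_int l + 1) * \<phi> + 2 * of_int m * \<phi> = - (2 * of_int (l - m) + 1) * \<phi>"
    by (simp add: algebra_simps)
  finally show ?thesis unfolding side_def by (simp only:)
qed

lemma side_scaleR: "side l (t *\<^sub>R k) = t * side l k"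
  by (simp add: side_def algebra_simps)

lemma side_rcis: "side l (rcis r \<alpha>) = r * cos (\<alpha> - (2 * of_int l + 1) * \<phi>) / cos \<phi>"
proof -
  have "cis (- (2 * of_int l + 1) * \<phi>) * rcis r \<alpha> = rcis r (\<alpha> - (2 * of_int l + 1) * \<phi>)"
    unfolding cis_rcis_eq rcis_mult by (simp add: algebra_simps)
  then show ?thesis unfolding side_def by (simp only: Re_rcis)
qed

lemma continuous_on_side [continuous_intros]:
  "continuous_on S f \<Longrightarrow> continuous_on S (\<lambda>x. side l (f x))"
  unfolding side_def using cos_phi_pos by (intro continuous_intros) auto

text \<open>As r <= 1, the angle to the midpoint of side l has cosine at least cos \<phi>. So it is
  at most \<phi> up to full turns, and m is l corrected by these turns.\<close>

lemma side_ge_1_arc: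
  assumes r: "0 \<le> r" "r \<le> 1" and side: "side l (rcis r \<alpha>) \<ge> 1"
  shows "\<exists>m. m mod int n = l mod int n \<and> 2 * of_int m * \<phi> \<le> \<alpha> \<and> \<alpha> \<le> 2 * (of_int m + 1) * \<phi>"
proof -
  define C where "C = cos (\<alpha> - (2 * of_int l + 1) * \<phi>)"
  have *: "cos \<phi> \<le> r * C"
    using side cos_phi_pos by (simp add: side_rcis C_def field_simps)
  then have "0 < C" using r cos_phi_pos
    by (smt (verit) mult_nonneg_nonpos)
  then have "r * C \<le> C" using r by (simp add: mult_left_le_one_le)
  with * have "cos \<phi> \<le> C" by simp
  then obtain t :: int where t: "\<bar>\<alpha> - (2 * of_int l + 1) * \<phi> - 2 * pi * t\<bar> \<le> \<phi>"
    using cos_ge_imp_near_period [of \<phi>] phi_pos phi_lt unfolding C_def by force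
  have eq: "2 * of_int (l + int n * t) * \<phi> = 2 * of_int l * \<phi> + 2 * pi * t"
    by (simp add: n_phi [symmetric] algebra_simps)
  have "2 * (of_int (l + int n * t) + 1) * \<phi> = 2 * of_int (l + int n * t) * \<phi> + 2 * \<phi>"
    by (simp only: algebra_simps)
  then have eq': "2 * (of_int (l + int n * t) + 1) * \<phi> = 2 * of_int l * \<phi> + 2 * pi * t + 2 * \<phi>"
    unfolding eq by simp
  have "2 * of_int (l + int n * t) * \<phi> \<le> \<alpha> \<and> \<alpha> \<le> 2 * (of_int (l + int n * t) + 1) * \<phi>"
    unfolding eq eq' using t by (auto simp: abs_le_iff algebra_simps)
  then show ?thesis by (intro exI [of _ "l + int n * t"]) auto
qed

text \<open>The caps cut off by different sides have angular ranges that share at most an endpoint.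
  At an endpoint the side function equals the norm, which must therefore be 1. Ping-pong rests on
  this disjointness.\<close>

lemma two_sides_imp_vertex:
  assumes k: "norm k \<le> 1" and l: "side l k \<ge> 1" and m: "side m k \<ge> 1"
    and lm: "l mod int n \<noteq> m mod int n"
  shows "\<exists>j. k = vertex j"
proof -
  define r \<alpha> where "r = norm k" "\<alpha> = Arg k"
  have k_eq: "k = rcis r \<alpha>" by (simp add: r_\<alpha>_def rcis_cmod_Arg)
  have r: "0 \<le> r" "r \<le> 1" using k by (simp_all add: r_\<alpha>_def)
  obtain l' where l': "l' mod int n = l mod int n" "2 * of_int l' * \<phi> \<le> \<alpha>" "\<alpha> \<le> 2 * (of_int l' + 1) * \<phi>"
    using side_ge_1_arc [OF r, of l \<alpha>] l by (auto simp: k_eq)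
  obtain m' where m': "m' mod int n = m mod int n" "2 * of_int m' * \<phi> \<le> \<alpha>" "\<alpha> \<le> 2 * (of_int m' + 1) * \<phi>"
    using side_ge_1_arc [OF r, of m \<alpha>] m by (auto simp: k_eq)
  have aux: "\<exists>j. k = vertex j"
    if s1: "side s k \<ge> 1" and s': "s' mod int n = s mod int n" "2 * of_int s' * \<phi> \<le> \<alpha>"
      and t': "\<alpha> \<le> 2 * (of_int t' + 1) * \<phi>" and lt: "t' < s'" for s s' t'
  proof -
    have "of_int t' + 1 \<le> real_of_int s'" using lt by linarith
    then have "2 * (of_int t' + 1) * \<phi> \<le> 2 * of_int s' * \<phi>"
      using phi_pos by (intro mult_right_mono mult_left_mono) auto
    then have \<alpha>: "\<alpha> = 2 * of_int s' * \<phi>" using s' t' by linarith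
    have "side s k = side s' k" using s'(1) by (metis side_mod)
    also have "\<dots> = r * cos (- \<phi>) / cos \<phi>"
      unfolding k_eq side_rcis \<alpha> by (simp add: algebra_simps)
    also have "\<dots> = r" using cos_phi_pos by simp
    finally have "r = 1" using s1 r by simp
    then show ?thesis by (auto simp: k_eq \<alpha> vertex_def rcis_def)
  qed
  have "l' \<noteq> m'" using l' m' lm by auto
  then consider "m' < l'" | "l' < m'" by linarith
  then show ?thesis
  proof cases
    case 1
    then show ?thesis using aux [OF l l'(1,2) m'(3)] by blast
  next
    case 2
    then show ?thesis using aux [OF m m'(1,2) l'(3)] by blast
  qed
qed

lemma norm_vertex [simp]: "norm (vertex j) = 1"
  by (simp add: vertex_def)

text \<open>Choose the side in whose sector k lies. Its midpoint is at angular distance \<beta> <=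
  \<phi>, so the side function is norm k times cos \<beta> / cos \<phi> >= 1, with strict inequality
  off the rays through the vertices.\<close>

lemma exists_side_ge_norm: "\<exists>l. norm k \<le> side l k"
  and norm_1_imp_vertex_or_side_gt: "norm k = 1 \<Longrightarrow> (\<exists>j. k = vertex j) \<or> (\<exists>l. side l k > 1)"
proof -
  define r \<alpha> where "r = norm k" "\<alpha> = Arg k"
  have k_eq: "k = rcis r \<alpha>" by (simp add: r_\<alpha>_def rcis_cmod_Arg)
  have r: "0 \<le> r" by (simp_all add: r_\<alpha>_def)
  define l where "l = \<lfloor>\<alpha> / (2 * \<phi>)\<rfloor>"
  define \<beta> where "\<beta> = \<bar>\<alpha> - (2 * of_int l + 1) * \<phi>\<bar>"
  have "of_int l \<le> \<alpha> / (2 * \<phi>)" "\<alpha> / (2 * \<phi>) < of_int l + 1"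
    unfolding l_def by linarith+
  then have l: "2 * of_int l * \<phi> \<le> \<alpha>" "\<alpha> < 2 * (of_int l + 1) * \<phi>"
    using phi_pos by (simp_all add: field_simps)
  then have \<beta>: "\<beta> \<le> \<phi>" "\<beta> \<ge> 0" by (auto simp: \<beta>_def abs_le_iff algebra_simps)
  have side: "side l k = r * (cos \<beta> / cos \<phi>)"
    by (simp add: k_eq side_rcis \<beta>_def)
  have "cos \<phi> \<le> cos \<beta>" using \<beta> phi_lt by (intro cos_monotone_0_pi_le) auto
  then have "1 \<le> cos \<beta> / cos \<phi>" using cos_phi_pos by simp
  then have "r * 1 \<le> side l k" unfolding side using r by (intro mult_left_mono)
  then show "\<exists>l. norm k \<le> side l k" by (auto simp: r_\<alpha>_def)
  show "(\<exists>j. k = vertex j) \<or> (\<exists>l. side l k > 1)" if "norm k = 1"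
  proof (cases "\<alpha> = 2 * of_int l * \<phi>")
    case True
    moreover have "r = 1" using that by (simp add: r_\<alpha>_def)
    ultimately have "k = vertex l" by (simp add: k_eq vertex_def rcis_def)
    then show ?thesis by blast
  next
    case False
    then have "\<beta> < \<phi>" using l by (auto simp: \<beta>_def abs_less_iff algebra_simps)
    then have "cos \<phi> < cos \<beta>" using \<beta> phi_lt by (intro cos_monotone_0_pi) auto
    then have "side l k > 1"
      using cos_phi_pos that by (simp add: side r_\<alpha>_def)
    then show ?thesis by auto
  qed
qed

lemma norm_polygon_le: "k \<in> polygon \<Longrightarrow> norm k \<le> 1"
  using exists_side_ge_norm [of k] unfolding polygon_def by (metis mem_Collect_eq order_trans)

lemma polygon_norm_1: "k \<in> polygon \<Longrightarrow> norm k = 1 \<Longrightarrow> \<exists>j. k = vertex j"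
  using norm_1_imp_vertex_or_side_gt [of k] unfolding polygon_def by (metis mem_Collect_eq not_le)

lemma vertex_in_polygon: "vertex j \<in> polygon"
proof -
  have "side l (vertex j) \<le> 1" for l
  proof (rule ccontr)
    assume "\<not> side l (vertex j) \<le> 1"
    then have c: "cos ((2 * of_int j - (2 * of_int l + 1)) * \<phi>) > cos \<phi>"
    proof -
      have "vertex j = rcis 1 (2 * of_int j * \<phi>)" by (simp add: vertex_def rcis_def)
      then show ?thesis
        using \<open>\<not> side l (vertex j) \<le> 1\<close> cos_phi_pos by (simp add: side_rcis left_diff_distrib)
    qed
    then obtain t :: int where t: "\<bar>(2 * of_int j - (2 * of_int l + 1)) * \<phi> - 2 * pi * t\<bar> \<le> \<phi>"
      using cos_ge_imp_near_period [OF phi_pos _ less_imp_le [OF c]] phi_lt pi_gt_zero by auto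
    \<comment> \<open>Measured in units of \<phi>, a vertex and the midpoint of a side differ by an
      odd number. Oddness excludes u = 0, and u = 1 or -1 gives exactly cos \<phi>.\<close>
    define u where "u = 2 * j - (2 * l + 1) - 2 * int n * t"
    have u: "(2 * of_int j - (2 * of_int l + 1)) * \<phi> = of_int u * \<phi> + 2 * pi * of_int t"
      by (simp add: u_def n_phi [symmetric] algebra_simps)
    then have "\<bar>of_int u * \<phi>\<bar> \<le> \<phi>" using t by simp
    then have "\<bar>real_of_int u\<bar> \<le> 1" using phi_pos by (simp add: abs_mult)
    then have "\<bar>u\<bar> \<le> 1" by linarith
    moreover have "odd u" by (simp add: u_def)
    ultimately have "u = 1 \<or> u = - 1" by (smt (verit) even_zero)
    moreover have "cos (of_int u * \<phi> + 2 * pi * of_int t) = cos (of_int u * \<phi>)"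
      using cos_int_2pin sin_int_2pin by (simp add: cos_add)
    ultimately have "cos (of_int u * \<phi> + 2 * pi * of_int t) = cos \<phi>" by auto
    then show False using c u by simp
  qed
  then show ?thesis by (simp add: polygon_def)
qed

lemma vertex_mult_in_polygon_iff: "vertex j * k \<in> polygon \<longleftrightarrow> k \<in> polygon"
  unfolding polygon_def mem_Collect_eq side_vertex_mult by (metis add_diff_cancel)

lemma cnj_in_polygon_iff: "cnj k \<in> polygon \<longleftrightarrow> k \<in> polygon"
  unfolding polygon_def mem_Collect_eq side_cnj by (metis diff_diff_eq2 add_diff_cancel_left')

lemma zero_in_polygon: "0 \<in> polygon"
  by (simp add: polygon_def side_def)

lemma mod_in_range: "l mod int n \<in> {0..<int n}"
  using n_ge_3 by simp

lemma closed_polygon: "closed polygon"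
proof -
  have "polygon = (\<Inter>l. {k. side l k \<le> 1})" by (auto simp: polygon_def)
  moreover have "closed {k. side l k \<le> 1}" for l
    by (intro closed_Collect_le continuous_intros)
  ultimately show ?thesis by auto
qed

lemma compact_polygon: "compact polygon"
  using closed_polygon norm_polygon_le by (auto simp: compact_eq_bounded_closed bounded_iff)

section \<open>The Minkowski functional of the polygon\<close>

lemma gauge_ge: "side l k \<le> gauge k"
  unfolding gauge_def using side_mod [of l k] mod_in_range [of l]
  by (intro Max_ge) (auto simp: image_iff intro!: bexI [of _ "l mod int n"])

lemma gauge_attained: "\<exists>l. gauge k = side l k"
proof -
  have "gauge k \<in> (\<lambda>l. side l k) ` {0..<int n}"
    unfolding gauge_def using n_ge_3 by (intro Max_in) auto
  then show ?thesis by auto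
qed

lemma gauge_ge_norm: "norm k \<le> gauge k"
  using exists_side_ge_norm [of k] gauge_ge order_trans by blast

lemma gauge_nonneg: "0 \<le> gauge k"
  using gauge_ge_norm [of k] norm_ge_zero order_trans by blast

lemma gauge_le_1_iff: "gauge k \<le> 1 \<longleftrightarrow> k \<in> polygon"
proof -
  obtain l where "gauge k = side l k" using gauge_attained by blast
  then show ?thesis
    using gauge_ge [of _ k] by (auto simp: polygon_def intro: order_trans)
qed

lemma gauge_eq_1_iff: "gauge k = 1 \<longleftrightarrow> k \<in> polygon \<and> (\<exists>l. side l k = 1)"
  using gauge_le_1_iff gauge_attained gauge_ge by (metis order.eq_iff)

lemma gauge_scaleR: "t \<ge> 0 \<Longrightarrow> gauge (t *\<^sub>R k) = t * gauge k"
proof (rule antisym)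
  assume t: "t \<ge> 0"
  obtain l where "gauge (t *\<^sub>R k) = side l (t *\<^sub>R k)" using gauge_attained by blast
  then show "gauge (t *\<^sub>R k) \<le> t * gauge k"
    using t gauge_ge by (simp add: side_scaleR mult_left_mono)
  obtain m where "gauge k = side m k" using gauge_attained by blast
  then show "t * gauge k \<le> gauge (t *\<^sub>R k)"
    using gauge_ge [of m "t *\<^sub>R k"] by (simp add: side_scaleR)
qed

lemma gauge_cnj: "gauge (cnj k) = gauge k"
proof -
  have le: "gauge (cnj k) \<le> gauge k" for k
  proof -
    obtain l where "gauge (cnj k) = side l (cnj k)" using gauge_attained by blast
    then show ?thesis using gauge_ge [of "- 1 - l" k] by (simp add: side_cnj)
  qed
  show ?thesis using le [of k] le [of "cnj k"] by simp
qed

lemma gauge_le: "gauge k \<le> norm k / cos \<phi>"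
proof -
  obtain l where "gauge k = side l k" using gauge_attained by blast
  moreover have "Re (cis (- (2 * of_int l + 1) * \<phi>) * k) \<le> norm (cis (- (2 * of_int l + 1) * \<phi>) * k)"
    by (rule complex_Re_le_cmod)
  ultimately show ?thesis
    using cos_phi_pos by (auto simp: side_def norm_mult intro!: divide_right_mono)
qed

lemma gauge_zero [simp]: "gauge 0 = 0"
  using gauge_scaleR [of 0 0] by simp

lemma continuous_on_gauge: "continuous_on S gauge"
proof -
  have *: "continuous_on S (\<lambda>k. Max ((\<lambda>l. side l k) ` A))" if "finite A" "A \<noteq> {}" for A
    using that
    by (induction rule: finite_ne_induct) (auto intro!: continuous_intros)
  show ?thesis unfolding gauge_def [abs_def] using n_ge_3 by (intro *) auto
qed

subsection \<open>Folding the polygon into the sphere\<close>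

text \<open>Radial rescaling that turns level sets of \<open>gauge\<close> into circles, hence the
  polygon into the unit disc. At the origin 0 / 0 = 0 gives the right value, and
  \<open>gauge_le\<close> yields continuity there.\<close>

definition to_disc :: "complex \<Rightarrow> complex" where
  "to_disc k = (gauge k / norm k) *\<^sub>R k"

lemma norm_to_disc: "norm (to_disc k) = gauge k"
  using gauge_nonneg [of k] by (cases "k = 0") (auto simp: to_disc_def)

lemma to_disc_cnj: "to_disc (cnj k) = cnj (to_disc k)"
  by (simp add: to_disc_def gauge_cnj scaleR_conv_of_real)

lemma continuous_on_to_disc: "continuous_on UNIV to_disc"
proof -
  have "isCont to_disc k" for k
  proof (cases "k = 0")
    case False
    have "continuous_on (- {0}) to_disc"
      unfolding to_disc_def [abs_def]
      by (intro continuous_intros continuous_on_gauge) auto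
    then show ?thesis using False by (simp add: continuous_on_eq_continuous_at open_Compl)
  next
    case True
    have "((\<lambda>k. to_disc k) \<longlongrightarrow> 0) (at 0)"
    proof (rule Lim_null_comparison)
      show "\<forall>\<^sub>F k in at 0. norm (to_disc k) \<le> norm k / cos \<phi>"
        by (simp add: norm_to_disc gauge_le)
      have "((\<lambda>k::complex. norm k / cos \<phi>) \<longlongrightarrow> norm (0::complex) / cos \<phi>) (at 0)"
        using cos_phi_pos by (intro tendsto_intros) auto
      then show "((\<lambda>k::complex. norm k / cos \<phi>) \<longlongrightarrow> 0) (at 0)" by simp
    qed
    moreover have "to_disc 0 = 0" by (simp add: to_disc_def)
    ultimately show ?thesis unfolding isCont_def True by simp
  qed
  then show ?thesis by (simp add: continuous_at_imp_continuous_on)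
qed

text \<open>Equal images have the same direction and the same gauge, so one point is t times the
  other with t >= 0, and homogeneity of the gauge gives t = 1.\<close>

lemma to_disc_inject:
  assumes "to_disc k = to_disc k'"
  shows "k = k'"
proof (cases "k = 0 \<or> k' = 0")
  case True
  then show ?thesis
    using assms norm_to_disc [of k] norm_to_disc [of k'] gauge_ge_norm [of k] gauge_ge_norm [of k']
    by auto
next
  case False
  have g: "gauge k = gauge k'" using assms norm_to_disc by metis
  have pos: "gauge k > 0" using False gauge_ge_norm [of k] by (smt (verit) zero_less_norm_iff)
  define t where "t = norm k' / norm k"
  have "k' = (norm k' / gauge k) *\<^sub>R to_disc k'"
    using False g pos by (simp add: to_disc_def)
  also have "\<dots> = t *\<^sub>R k"
    using False pos by (simp add: assms [symmetric]) (simp add: to_disc_def t_def)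
  finally have k': "k' = t *\<^sub>R k" .
  moreover have "t \<ge> 0" by (simp add: t_def)
  ultimately have "gauge k = t * gauge k" using g gauge_scaleR by simp
  then have "t = 1" using pos by simp
  then show ?thesis using k' by simp
qed

end

text \<open>The Joukowski map \<open>w \<mapsto> w + 1/w\<close> from the closed unit disc to the Riemann sphere, composed
  with stereographic projection. It identifies precisely the conjugate points of the circle.\<close>

definition joukowski_sphere :: "complex \<Rightarrow> complex \<times> real" where
  "joukowski_sphere w =
     (2 * (w\<^sup>2 + 1) * cnj w / of_real ((cmod (w\<^sup>2 + 1))\<^sup>2 + (cmod w)\<^sup>2),
      ((cmod (w\<^sup>2 + 1))\<^sup>2 - (cmod w)\<^sup>2) / ((cmod (w\<^sup>2 + 1))\<^sup>2 + (cmod w)\<^sup>2))"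

section \<open>Fibres and image of the Joukowski map\<close>

lemma joukowski_denominator_pos: "(cmod (w\<^sup>2 + 1))\<^sup>2 + (cmod w)\<^sup>2 > 0"
proof (cases "w = 0")
  case False
  then show ?thesis by (simp add: add_nonneg_pos)
qed simp

lemma continuous_on_joukowski_sphere: "continuous_on UNIV joukowski_sphere"
  unfolding joukowski_sphere_def [abs_def]
  using joukowski_denominator_pos
  by (intro continuous_intros) (auto simp del: of_real_add of_real_power simp: less_imp_neq [symmetric] intro: less_imp_neq [symmetric])

text \<open>The formula is stereographic projection of the point with homogeneous coordinates (w^2 +
  1, w), and (2ab)^2 + (a^2 - b^2)^2 = (a^2 + b^2)^2 for their moduli a, b.\<close>

lemma joukowski_sphere_in_sphere: "joukowski_sphere w \<in> two_sphere"
proof -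
  define p a b where "p = w\<^sup>2 + 1" "a = cmod p" "b = cmod w"
  have D: "a\<^sup>2 + b\<^sup>2 > 0" using joukowski_denominator_pos [of w] by (simp add: p_a_b_def)
  have eq: "joukowski_sphere w = (2 * p * cnj w / of_real (a\<^sup>2 + b\<^sup>2), (a\<^sup>2 - b\<^sup>2) / (a\<^sup>2 + b\<^sup>2))"
    by (simp add: joukowski_sphere_def p_a_b_def)
  have "norm (fst (joukowski_sphere w)) = 2 * a * b / (a\<^sup>2 + b\<^sup>2)"
    unfolding eq fst_conv norm_divide norm_mult norm_of_real using D by (simp add: p_a_b_def)
  then have "(norm (fst (joukowski_sphere w)))\<^sup>2 + (norm (snd (joukowski_sphere w)))\<^sup>2
      = ((2 * a * b)\<^sup>2 + (a\<^sup>2 - b\<^sup>2)\<^sup>2) / (a\<^sup>2 + b\<^sup>2)\<^sup>2"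
    by (simp add: eq power_divide add_divide_distrib)
  also have "(2 * a * b)\<^sup>2 + (a\<^sup>2 - b\<^sup>2)\<^sup>2 = (a\<^sup>2 + b\<^sup>2)\<^sup>2"
    by (simp add: power2_eq_square algebra_simps)
  also have "\<dots> / (a\<^sup>2 + b\<^sup>2)\<^sup>2 = 1"
    using D by (intro divide_self power_not_zero) linarith
  finally show ?thesis by (simp add: norm_prod_def)
qed

lemma joukowski_sphere_cnj:
  assumes "norm w = 1"
  shows "joukowski_sphere (cnj w) = joukowski_sphere w"
proof -
  have ww: "w * cnj w = 1" using assms by (simp add: complex_norm_square [symmetric])
  have 1: "cmod ((cnj w)\<^sup>2 + 1) = cmod (w\<^sup>2 + 1)"
    by (metis complex_cnj_add complex_cnj_one complex_cnj_power complex_mod_cnj)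
  have "((cnj w)\<^sup>2 + 1) * w = cnj w * (w * cnj w) + w"
    by (simp add: algebra_simps power2_eq_square)
  moreover have "(w\<^sup>2 + 1) * cnj w = w * (w * cnj w) + cnj w"
    by (simp add: algebra_simps power2_eq_square)
  ultimately have 2: "((cnj w)\<^sup>2 + 1) * w = (w\<^sup>2 + 1) * cnj w" by (simp add: ww)
  show ?thesis
    unfolding joukowski_sphere_def 1 complex_cnj_cnj complex_mod_cnj mult.assoc [of 2] 2 by (rule refl)
qed

text \<open>The height determines b / D, and dividing the first coordinate by 2 b / D recovers w +
  1/w. Equal values of w + 1/w mean (w - w') (w w' - 1) = 0. The case w = 0, mapped to the pole, is
  the one with b = 0.\<close>

lemma joukowski_sphere_eq:
  assumes eq: "joukowski_sphere w = joukowski_sphere w'"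
  shows "w = w' \<or> w * w' = 1"
proof -
  define a b D where "a = (cmod (w\<^sup>2 + 1))\<^sup>2" "b = (cmod w)\<^sup>2" "D = a + b"
  define a' b' D' where "a' = (cmod (w'\<^sup>2 + 1))\<^sup>2" "b' = (cmod w')\<^sup>2" "D' = a' + b'"
  have D: "D > 0" "D' > 0"
    using joukowski_denominator_pos by (simp_all add: a_b_D_def a'_b'_D'_def)
  have 1: "2 * (w\<^sup>2 + 1) * cnj w / of_real D = 2 * (w'\<^sup>2 + 1) * cnj w' / of_real D'"
    and 2: "(a - b) / D = (a' - b') / D'"
    using eq by (simp_all add: joukowski_sphere_def a_b_D_def a'_b'_D'_def)
  have "(a - b) / D = 1 - 2 * (b / D)" "(a' - b') / D' = 1 - 2 * (b' / D')"
    using D by (simp_all add: a_b_D_def(3) a'_b'_D'_def(3) field_simps)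
  then have 3: "b / D = b' / D'" using 2 by simp
  show ?thesis
  proof (cases "w = 0")
    case True
    then have "b = 0" by (simp add: a_b_D_def)
    then have "b' = 0" using 3 D by simp
    then show ?thesis using True by (simp add: a'_b'_D'_def)
  next
    case False
    then have b: "b > 0" by (simp add: a_b_D_def)
    then have "b' > 0" using 3 D by (metis divide_pos_pos zero_less_divide_iff less_asym)
    then have w': "w' \<noteq> 0" by (auto simp: a'_b'_D'_def)
    have J: "(w\<^sup>2 + 1) / w = (2 * (w\<^sup>2 + 1) * cnj w / of_real D) / (2 * of_real (b / D))"
    proof -
      have "of_real b = w * cnj w" by (simp add: a_b_D_def complex_norm_square [symmetric])
      then show ?thesis using False D b by (simp add: field_simps)
    qed
    have J': "(w'\<^sup>2 + 1) / w' = (2 * (w'\<^sup>2 + 1) * cnj w' / of_real D') / (2 * of_real (b' / D'))"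
    proof -
      have "of_real b' = w' * cnj w'" by (simp add: a'_b'_D'_def complex_norm_square [symmetric])
      then show ?thesis using w' D \<open>b' > 0\<close> by (simp add: field_simps)
    qed
    have "(w\<^sup>2 + 1) / w = (w'\<^sup>2 + 1) / w'" unfolding J J' 1 3 by (rule refl)
    then have "(w\<^sup>2 + 1) * w' = (w'\<^sup>2 + 1) * w" using False w' by (simp add: field_simps)
    then have "(w - w') * (w * w' - 1) = 0"
      by (simp add: power2_eq_square algebra_simps)
    then show ?thesis by simp
  qed
qed

text \<open>Away from the pole, \<open>J\<close> is the stereographic image of the point and w
  solves w^2 - J w + 1 = 0. The two roots have product 1, so one of them lies in the closed
  disc.\<close>

lemma joukowski_sphere_surj:
  assumes "p \<in> two_sphere"
  shows "\<exists>w. norm w \<le> 1 \<and> joukowski_sphere w = p"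
proof -
  obtain \<zeta> t where p: "p = (\<zeta>, t)" by (cases p)
  have nt: "(cmod \<zeta>)\<^sup>2 + t\<^sup>2 = 1" using assms by (simp add: p norm_prod_def)
  show ?thesis
  proof (cases "t = 1")
    case True
    then show ?thesis using nt by (intro exI [of _ 0]) (simp add: joukowski_sphere_def p)
  next
    case False
    have "t\<^sup>2 \<le> 1" using nt by (smt (verit) zero_le_power2)
    then have t: "t < 1" using False by (simp add: abs_square_le_1 abs_le_iff)
    define J where "J = \<zeta> / of_real (1 - t)"
    define s where "s = csqrt (J\<^sup>2 - 4)"
    define w1 w2 where "w1 = (J + s) / 2" "w2 = (J - s) / 2"
    have s: "s\<^sup>2 = J\<^sup>2 - 4" by (simp add: s_def)
    have "w1 * w2 = (J\<^sup>2 - s\<^sup>2) / 4" by (simp add: w1_w2_def power2_eq_square algebra_simps)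
    then have "w1 * w2 = 1" by (simp add: s)
    then have "norm w1 * norm w2 = 1" by (metis norm_mult norm_one)
    then have "norm w1 \<le> 1 \<or> norm w2 \<le> 1"
      by (smt (verit) mult_less_cancel_right1 norm_ge_zero)
    moreover have "w1\<^sup>2 + 1 = J * w1"
    proof -
      have "w1\<^sup>2 + 1 - J * w1 = (s\<^sup>2 - J\<^sup>2 + 4) / 4"
        by (simp add: w1_w2_def power2_eq_square field_simps)
      then show ?thesis by (simp add: s)
    qed
    moreover have "w2\<^sup>2 + 1 = J * w2"
    proof -
      have "w2\<^sup>2 + 1 - J * w2 = (s\<^sup>2 - J\<^sup>2 + 4) / 4"
        by (simp add: w1_w2_def power2_eq_square field_simps)
      then show ?thesis by (simp add: s)
    qed
    ultimately obtain w where w: "norm w \<le> 1" "w\<^sup>2 + 1 = J * w" by blast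
    then have w0: "w \<noteq> 0" by auto
    have "(cmod J)\<^sup>2 = (1 - t\<^sup>2) / (1 - t)\<^sup>2"
      using nt t by (simp add: J_def norm_divide power_divide del: of_real_diff)
    also have "\<dots> = (1 + t) / (1 - t)"
      using t by (simp add: divide_simps) (simp add: power2_eq_square algebra_simps)
    finally have J2: "(cmod J)\<^sup>2 = (1 + t) / (1 - t)" .
    have JD: "(cmod J)\<^sup>2 + 1 = 2 / (1 - t)" unfolding J2 using t by (simp add: divide_simps)
    have JN: "(cmod J)\<^sup>2 - 1 = 2 * t / (1 - t)" unfolding J2 using t by (simp add: divide_simps)
    \<comment> \<open>Because w^2 + 1 = J w, sums and differences of the squared moduli are |w|^2
      times functions of |J|^2, and |w|^2 cancels in the sphere coordinates.\<close>
    have D: "(cmod (w\<^sup>2 + 1))\<^sup>2 + (cmod w)\<^sup>2 = (cmod w)\<^sup>2 * (2 / (1 - t))"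
      unfolding w(2) JD [symmetric] by (simp add: norm_mult power_mult_distrib algebra_simps)
    have N: "(cmod (w\<^sup>2 + 1))\<^sup>2 - (cmod w)\<^sup>2 = (cmod w)\<^sup>2 * (2 * t / (1 - t))"
      unfolding w(2) JN [symmetric] by (simp add: norm_mult power_mult_distrib algebra_simps)
    define c where "c = (cmod w)\<^sup>2"
    have c: "c > 0" using w0 by (simp add: c_def)
    have E: "2 * (w\<^sup>2 + 1) * cnj w = 2 * J * of_real c"
      unfolding w(2) c_def complex_norm_square by (simp add: algebra_simps)
    have "2 * J * of_real c / of_real (c * (2 / (1 - t))) = J * of_real (1 - t)"
      using c t by (simp add: divide_simps del: of_real_diff)
    also have "\<dots> = \<zeta>" using t by (simp add: J_def del: of_real_diff)
    finally have 1: "2 * J * of_real c / of_real (c * (2 / (1 - t))) = \<zeta>" .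
    have 2: "c * (2 * t / (1 - t)) / (c * (2 / (1 - t))) = t"
      using c t by simp
    have "joukowski_sphere w
        = (2 * J * of_real c / of_real (c * (2 / (1 - t))), c * (2 * t / (1 - t)) / (c * (2 / (1 - t))))"
      unfolding joukowski_sphere_def D N E c_def by (rule refl)
    then have "joukowski_sphere w = (\<zeta>, t)" unfolding 1 2 .
    then show ?thesis using w p by auto
  qed
qed

context ideal_polygon
begin

definition fold_map :: "complex \<Rightarrow> complex \<times> real" where
  "fold_map k = joukowski_sphere (to_disc k)"

lemma continuous_on_fold_map: "continuous_on S fold_map"
proof -
  have "continuous_on UNIV (joukowski_sphere \<circ> to_disc)"
    using continuous_on_to_disc continuous_on_joukowski_sphere
    by (intro continuous_on_compose) (auto intro: continuous_on_subset)
  then show ?thesis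
    unfolding fold_map_def [abs_def] comp_def by (rule continuous_on_subset) simp
qed

lemma fold_map_cnj: "gauge k = 1 \<Longrightarrow> fold_map (cnj k) = fold_map k"
  by (simp add: fold_map_def to_disc_cnj joukowski_sphere_cnj norm_to_disc)

text \<open>Within the closed disc w w' = 1 forces both moduli to be 1, so w' is the conjugate of w;
  the radial rescaling commutes with conjugation.\<close>

lemma fold_map_eq:
  assumes k: "k \<in> polygon" and k': "k' \<in> polygon" and eq: "fold_map k = fold_map k'"
  shows "k = k' \<or> gauge k = 1 \<and> k' = cnj k"
proof -
  define w w' where "w = to_disc k" "w' = to_disc k'"
  have "w = w' \<or> w * w' = 1"
    using joukowski_sphere_eq eq by (simp add: fold_map_def w_w'_def)
  then show ?thesis
  proof
    assume "w = w'"
    then show ?thesis using to_disc_inject by (simp add: w_w'_def)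
  next
    assume ww: "w * w' = 1"
    have le: "norm w \<le> 1" "norm w' \<le> 1"
      using k k' by (simp_all add: w_w'_def norm_to_disc gauge_le_1_iff)
    have "norm w * norm w' = 1" using ww by (metis norm_mult norm_one)
    then have nw: "norm w = 1"
      using le by (smt (verit) mult_left_le norm_ge_zero)
    then have "w * cnj w = 1" by (simp add: complex_norm_square [symmetric])
    then have "w' = cnj w" using ww nw by (metis mult_left_cancel mult_zero_left zero_neq_one)
    then have "to_disc k' = to_disc (cnj k)" by (simp add: to_disc_cnj w_w'_def)
    then show ?thesis
      using to_disc_inject nw by (simp add: norm_to_disc w_w'_def)
  qed
qed

lemma fold_map_polygon: "fold_map ` polygon = two_sphere"
proof
  show "fold_map ` polygon \<subseteq> two_sphere"
    using joukowski_sphere_in_sphere by (auto simp: fold_map_def)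
  show "two_sphere \<subseteq> fold_map ` polygon"
  proof
    fix p :: "complex \<times> real" assume "p \<in> two_sphere"
    then obtain w where w: "norm w \<le> 1" "joukowski_sphere w = p"
      using joukowski_sphere_surj by blast
    \<comment> \<open>The preimage of w under \<open>to_disc\<close>: the multiple of w whose gauge
      is \<open>norm w\<close>. For w = 0 it is 0.\<close>
    define k where "k = (norm w / gauge w) *\<^sub>R w"
    have g: "gauge w \<ge> norm w" by (rule gauge_ge_norm)
    have "gauge w \<ge> 0" using g norm_ge_zero order_trans by blast
    then have "gauge k = norm w / gauge w * gauge w"
      unfolding k_def by (intro gauge_scaleR) simp
    then have gk: "gauge k = norm w"
      using g by (cases "w = 0") auto
    have "to_disc k = w"
    proof (cases "w = 0")
      case False
      then have "gauge w > 0" using g by (smt (verit) zero_less_norm_iff)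
      then show ?thesis using False unfolding to_disc_def gk by (simp add: k_def)
    qed (simp add: k_def to_disc_def)
    then have "fold_map k = p" using w by (simp add: fold_map_def)
    moreover have "k \<in> polygon" using gk w gauge_le_1_iff [of k] by simp
    ultimately show "p \<in> fold_map ` polygon" by blast
  qed
qed

end

subsection \<open>Moebius transformations in homogeneous coordinates\<close>

lemma mat2_eq_iff: "A = (B :: real^2^2) \<longleftrightarrow> A$1$1 = B$1$1 \<and> A$1$2 = B$1$2 \<and> A$2$1 = B$2$1 \<and> A$2$2 = B$2$2"
  by (auto simp: vec_eq_iff forall_2)

lemma mat2_mult_nth: "((A :: real^2^2) ** B)$i$j = A$i$1 * B$1$j + A$i$2 * B$2$j"
  by (simp add: matrix_matrix_mult_def sum_2)

lemma mat2_one_nth [simp]: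
  "(mat 1 :: real^2^2)$1$1 = 1" "(mat 1 :: real^2^2)$1$2 = 0"
  "(mat 1 :: real^2^2)$2$1 = 0" "(mat 1 :: real^2^2)$2$2 = 1"
  by (simp_all add: mat_def)

lemma mat2_mult: "mat2 a b c d ** mat2 a' b' c' d'
    = mat2 (a * a' + b * c') (a * b' + b * d') (c * a' + d * c') (c * b' + d * d')"
  by (simp add: mat2_eq_iff mat2_mult_nth)

lemma minus_mat2_mult_left: "(- A) ** B = - (A ** B)" for A B :: "real^2^2"
  by (simp add: mat2_eq_iff mat2_mult_nth)

lemma minus_mat2_mult_right: "A ** (- B) = - (A ** B)" for A B :: "real^2^2"
  by (simp add: mat2_eq_iff mat2_mult_nth)

lemma det_minus_mat2: "det (- A) = det A" for A :: "real^2^2"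
  by (simp add: det_2)

text \<open>Written as a ratio, a point of the sphere is transformed linearly, which removes the
  case distinctions at infinity from \<open>moebius\<close>.\<close>

definition homogeneous :: "complex option \<Rightarrow> complex \<times> complex" where
  "homogeneous p = (case p of None \<Rightarrow> (1, 0) | Some z \<Rightarrow> (z, 1))"

definition of_homogeneous :: "complex \<Rightarrow> complex \<Rightarrow> complex option" where
  "of_homogeneous a b = (if b = 0 then None else Some (a / b))"

definition row_apply :: "real^2^2 \<Rightarrow> 2 \<Rightarrow> complex \<times> complex \<Rightarrow> complex" where
  "row_apply A i v = of_real (A$i$1) * fst v + of_real (A$i$2) * snd v"

lemma homogeneous_nonzero: "fst (homogeneous p) \<noteq> 0 \<or> snd (homogeneous p) \<noteq> 0"
  by (simp add: homogeneous_def split: option.split)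

lemma of_homogeneous_scale: "s \<noteq> 0 \<Longrightarrow> of_homogeneous (s * a) (s * b) = of_homogeneous a b"
  by (simp add: of_homogeneous_def)

lemma homogeneous_of_homogeneous:
  assumes "a \<noteq> 0 \<or> b \<noteq> 0"
  obtains s where "s \<noteq> 0" "a = s * fst (homogeneous (of_homogeneous a b))"
    "b = s * snd (homogeneous (of_homogeneous a b))"
proof (cases "b = 0")
  case True
  then show ?thesis using assms by (intro that [of a]) (auto simp: homogeneous_def of_homogeneous_def)
next
  case False
  then show ?thesis by (intro that [of b]) (auto simp: homogeneous_def of_homogeneous_def)
qed

lemma moebius_homogeneous:
  "moebius A p = of_homogeneous (row_apply A 1 (homogeneous p)) (row_apply A 2 (homogeneous p))"
  by (simp add: moebius_def homogeneous_def of_homogeneous_def row_apply_def split: option.split)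

lemma row_apply_mult:
  "row_apply (A ** B) i v = row_apply A i (row_apply B 1 v, row_apply B 2 v)"
  by (simp add: row_apply_def mat2_mult_nth algebra_simps)

lemma row_apply_scale: "row_apply A i (s * a, s * b) = s * row_apply A i (a, b)"
  by (simp add: row_apply_def algebra_simps)

lemma complex_det_one:
  fixes A :: "real^2^2"
  assumes "det A = 1"
  shows "of_real (A$1$1) * of_real (A$2$2) - of_real (A$1$2) * of_real (A$2$1) = (1::complex)"
proof -
  have "of_real (A$1$1 * A$2$2 - A$1$2 * A$2$1) = (1::complex)"
    using assms by (simp add: det_2)
  then show ?thesis by simp
qed

text \<open>The adjugate of A recovers v from the two rows.\<close>

lemma row_apply_nonzero:
  assumes "det A = 1" "fst v \<noteq> 0 \<or> snd v \<noteq> 0"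
  shows "row_apply A 1 v \<noteq> 0 \<or> row_apply A 2 v \<noteq> 0"
proof -
  note d = complex_det_one [OF assms(1)]
  have "of_real (A$2$2) * row_apply A 1 v - of_real (A$1$2) * row_apply A 2 v = 1 * fst v"
    unfolding d [symmetric] by (simp add: row_apply_def algebra_simps)
  moreover have "of_real (A$1$1) * row_apply A 2 v - of_real (A$2$1) * row_apply A 1 v = 1 * snd v"
    unfolding d [symmetric] by (simp add: row_apply_def algebra_simps)
  ultimately show ?thesis using assms(2) by auto
qed

text \<open>Since B sends no nonzero pair to (0, 0), normalising the image pair only divides it by
  some s that is not 0, and ratios ignore s.\<close>

lemma moebius_mult:
  assumes "det B = 1"
  shows "moebius A (moebius B p) = moebius (A ** B) p"
proof -
  define a b where "a = row_apply B 1 (homogeneous p)" "b = row_apply B 2 (homogeneous p)"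
  have "a \<noteq> 0 \<or> b \<noteq> 0"
    unfolding a_b_def by (intro row_apply_nonzero assms homogeneous_nonzero)
  then obtain s where s: "s \<noteq> 0" "a = s * fst (homogeneous (of_homogeneous a b))"
    "b = s * snd (homogeneous (of_homogeneous a b))"
    using homogeneous_of_homogeneous by blast
  have p: "moebius B p = of_homogeneous a b" by (simp add: moebius_homogeneous a_b_def)
  have row: "row_apply (A ** B) i (homogeneous p) = s * row_apply A i (homogeneous (of_homogeneous a b))" for i
  proof -
    have "row_apply (A ** B) i (homogeneous p) = row_apply A i (a, b)"
      by (simp add: row_apply_mult a_b_def)
    also have "\<dots> = s * row_apply A i (fst (homogeneous (of_homogeneous a b)), snd (homogeneous (of_homogeneous a b)))"
      using s(2,3) row_apply_scale by metis
    finally show ?thesis by simp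
  qed
  show ?thesis
    unfolding p by (simp add: moebius_homogeneous row of_homogeneous_scale s(1))
qed

lemma moebius_one: "moebius (mat 1) p = p"
  by (simp add: moebius_def split: option.split)

lemma moebius_minus: "moebius (- A) p = moebius A p"
proof -
  have "row_apply (- A) i v = - 1 * row_apply A i v" for i v
    by (simp add: row_apply_def algebra_simps)
  then show ?thesis
    unfolding moebius_homogeneous by (simp only: of_homogeneous_scale [of "- 1"]) (simp add: of_homogeneous_def)
qed

section \<open>The action on the upper half plane and on the real line\<close>

definition moebius_plane :: "real^2^2 \<Rightarrow> complex \<Rightarrow> complex" where
  "moebius_plane A z = (of_real (A$1$1) * z + of_real (A$1$2)) / (of_real (A$2$1) * z + of_real (A$2$2))"

lemma moebius_denominator_nonzero:
  fixes A :: "real^2^2"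
  assumes "det A = 1" "Im z > 0"
  shows "of_real (A$2$1) * z + of_real (A$2$2) \<noteq> 0"
proof
  assume eq: "of_real (A$2$1) * z + of_real (A$2$2) = 0"
  then have "Im (of_real (A$2$1) * z + of_real (A$2$2)) = 0" by simp
  then have "A$2$1 * Im z = 0" by simp
  then have c: "A$2$1 = 0" using assms by simp
  then have "A$2$2 = 0" using eq by simp
  then show False using assms c by (simp add: det_2)
qed

lemma moebius_Some: 
  assumes "det A = 1" "Im z > 0"
  shows "moebius A (Some z) = Some (moebius_plane A z)"
  using moebius_denominator_nonzero [OF assms] by (simp add: moebius_def moebius_plane_def)

lemma Im_moebius_plane:
  assumes "det A = 1"
  shows "Im (moebius_plane A z) = Im z / (cmod (of_real (A$2$1) * z + of_real (A$2$2)))\<^sup>2"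
proof -
  have "Im ((of_real (A$1$1) * z + of_real (A$1$2)) * cnj (of_real (A$2$1) * z + of_real (A$2$2)))
     = det A * Im z"
    by (simp add: det_2 algebra_simps)
  then show ?thesis
    using assms unfolding moebius_plane_def by (simp add: Im_complex_div_eq_0 complex_div_cnj [of _ "_ + _"] Im_divide cmod_power2 power2_eq_square)
qed

lemma Im_moebius_plane_pos: "det A = 1 \<Longrightarrow> Im z > 0 \<Longrightarrow> Im (moebius_plane A z) > 0"
  using moebius_denominator_nonzero [of A z] by (simp add: Im_moebius_plane)

lemma moebius_half_plane:
  "det A = 1 \<Longrightarrow> p \<in> Some ` upper_half_plane \<Longrightarrow> moebius A p \<in> Some ` upper_half_plane"
  by (auto simp: upper_half_plane_def moebius_Some Im_moebius_plane_pos)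

lemma isCont_moebius_plane: "det A = 1 \<Longrightarrow> Im z > 0 \<Longrightarrow> isCont (moebius_plane A) z"
  unfolding moebius_plane_def [abs_def] using moebius_denominator_nonzero [of A z]
  by (intro continuous_intros) auto

lemma moebius_extended_real:
  assumes "p \<in> extended_real_line"
  shows "moebius A p \<in> extended_real_line"
proof -
  obtain x y :: real where h: "homogeneous p = (of_real x, of_real y)"
  proof (cases p)
    case None
    then show ?thesis using that [of 1 0] by (simp add: homogeneous_def)
  next
    case (Some z)
    then obtain x :: real where "z = of_real x" using assms by (auto simp: extended_real_line_def)
    then show ?thesis using Some that [of x 1] by (simp add: homogeneous_def)
  qed
  have r: "row_apply A i (homogeneous p) = of_real (A$i$1 * x + A$i$2 * y)" for i
    by (simp add: row_apply_def h)
  show ?thesis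
    unfolding moebius_homogeneous r of_homogeneous_def extended_real_line_def
    by (auto simp: of_real_divide [symmetric] simp del: of_real_divide of_real_add)
qed

lemma row_apply_mat2:
  "row_apply (mat2 a b c d) 1 v = of_real a * fst v + of_real b * snd v"
  "row_apply (mat2 a b c d) 2 v = of_real c * fst v + of_real d * snd v"
  by (simp_all add: row_apply_def)

subsection \<open>The Klein disc\<close>

text \<open>The Klein (projective) model of the hyperbolic plane in homogeneous coordinates; hyperbolic
  rotations about \<open>\<i>\<close> become Euclidean rotations and geodesics become chords.\<close>

definition klein_pair :: "complex \<Rightarrow> complex \<Rightarrow> complex" where
  "klein_pair a b = Complex ((cmod a)\<^sup>2 - (cmod b)\<^sup>2) (2 * Re (a * cnj b)) / of_real ((cmod a)\<^sup>2 + (cmod b)\<^sup>2)"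

definition klein :: "complex option \<Rightarrow> complex" where
  "klein p = klein_pair (fst (homogeneous p)) (snd (homogeneous p))"

lemma klein_pair_scale:
  assumes "s \<noteq> 0"
  shows "klein_pair (s * a) (s * b) = klein_pair a b"
proof -
  have "Re (s * a * cnj (s * b)) = (cmod s)\<^sup>2 * Re (a * cnj b)"
    unfolding cmod_power2 by (simp add: power2_eq_square algebra_simps)
  then have "Complex ((cmod (s * a))\<^sup>2 - (cmod (s * b))\<^sup>2) (2 * Re (s * a * cnj (s * b)))
     = of_real ((cmod s)\<^sup>2) * Complex ((cmod a)\<^sup>2 - (cmod b)\<^sup>2) (2 * Re (a * cnj b))"
    by (simp add: complex_eq_iff norm_mult power_mult_distrib algebra_simps)
  moreover have "of_real ((cmod (s * a))\<^sup>2 + (cmod (s * b))\<^sup>2)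
     = (of_real ((cmod s)\<^sup>2) * of_real ((cmod a)\<^sup>2 + (cmod b)\<^sup>2) :: complex)"
    by (simp add: norm_mult power_mult_distrib algebra_simps)
  ultimately show ?thesis
    unfolding klein_pair_def using assms by simp
qed

lemma klein_of_homogeneous: "a \<noteq> 0 \<or> b \<noteq> 0 \<Longrightarrow> klein (of_homogeneous a b) = klein_pair a b"
  using homogeneous_of_homogeneous klein_pair_scale unfolding klein_def by metis

lemma klein_moebius:
  assumes "det A = 1"
  shows "klein (moebius A p) = klein_pair (row_apply A 1 (homogeneous p)) (row_apply A 2 (homogeneous p))"
  unfolding moebius_homogeneous
  by (intro klein_of_homogeneous row_apply_nonzero assms homogeneous_nonzero)

definition rot :: "real \<Rightarrow> real^2^2" where
  "rot \<theta> = mat2 (cos \<theta>) (- sin \<theta>) (sin \<theta>) (cos \<theta>)"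

lemma det_rot [simp]: "det (rot \<theta>) = 1"
  by (simp add: rot_def power2_eq_square [symmetric])

lemma rot_mult: "rot \<alpha> ** rot \<beta> = rot (\<alpha> + \<beta>)"
  by (simp add: rot_def mat2_mult cos_add sin_add algebra_simps)

lemma rot_0: "rot 0 = mat 1"
  by (simp add: rot_def mat2_eq_iff)

text \<open>The two numerators are quadratic in (a, b), so a rotation of (a, b) acts on them with
  the doubled angle; the denominator is invariant.\<close>

lemma klein_rot: "klein (moebius (rot \<theta>) p) = cis (2 * \<theta>) * klein p"
proof -
  define a b where "a = fst (homogeneous p)" "b = snd (homogeneous p)"
  define a' b' where "a' = of_real (cos \<theta>) * a - of_real (sin \<theta>) * b"
    "b' = of_real (sin \<theta>) * a + of_real (cos \<theta>) * b"
  define X Y D where "X = (cmod a)\<^sup>2 - (cmod b)\<^sup>2" "Y = 2 * Re (a * cnj b)" "D = (cmod a)\<^sup>2 + (cmod b)\<^sup>2"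
  have sc: "(sin \<theta>)\<^sup>2 = 1 - (cos \<theta>)\<^sup>2" by (simp add: sin_squared_eq)
  have 1: "(cmod a')\<^sup>2 - (cmod b')\<^sup>2 = cos (2 * \<theta>) * X - sin (2 * \<theta>) * Y"
    unfolding cos_double sin_double X_Y_D_def a'_b'_def cmod_power2
    by (simp add: power2_eq_square algebra_simps)
  have 2: "2 * Re (a' * cnj b') = sin (2 * \<theta>) * X + cos (2 * \<theta>) * Y"
    unfolding cos_double sin_double X_Y_D_def a'_b'_def cmod_power2
    by (simp add: power2_eq_square algebra_simps)
  have "(cmod a')\<^sup>2 + (cmod b')\<^sup>2 = ((cos \<theta>)\<^sup>2 + (sin \<theta>)\<^sup>2) * D"
    unfolding X_Y_D_def a'_b'_def cmod_power2
    by (simp add: power2_eq_square algebra_simps del: sin_cos_squared_add2 sin_cos_squared_add3)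
  then have 3: "(cmod a')\<^sup>2 + (cmod b')\<^sup>2 = D" by simp
  have "klein (moebius (rot \<theta>) p) = klein_pair a' b'"
    by (simp add: klein_moebius row_apply_mat2 rot_def [of \<theta>] a_b_def a'_b'_def power2_eq_square [symmetric])
  also have "\<dots> = cis (2 * \<theta>) * (Complex X Y / of_real D)"
    unfolding klein_pair_def 1 2 3 by (simp add: complex_eq_iff diff_divide_distrib add_divide_distrib)
  also have "\<dots> = cis (2 * \<theta>) * klein p"
    by (simp add: klein_def klein_pair_def a_b_def X_Y_D_def)
  finally show ?thesis .
qed

section \<open>The inverse of the Klein map\<close>

definition extended_half :: "complex option set" where
  "extended_half = insert None (Some ` {z. Im z \<ge> 0})"

lemma klein_None [simp]: "klein None = 1"
  by (simp add: klein_def klein_pair_def homogeneous_def complex_eq_iff)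

lemma klein_Some: "klein (Some z) = Complex (((cmod z)\<^sup>2 - 1) / ((cmod z)\<^sup>2 + 1)) (2 * Re z / ((cmod z)\<^sup>2 + 1))"
  by (simp add: klein_def klein_pair_def homogeneous_def complex_eq_iff)

lemma isCont_klein_Some: "isCont (\<lambda>z. klein (Some z)) z"
proof -
  have "(cmod z)\<^sup>2 + 1 \<noteq> 0" by (smt (verit) zero_le_power2)
  then show ?thesis
    unfolding klein_Some Complex_eq by (intro continuous_intros) auto
qed

lemma norm_klein_Some: "(norm (klein (Some z)))\<^sup>2 = 1 - 4 * (Im z)\<^sup>2 / ((cmod z)\<^sup>2 + 1)\<^sup>2"
proof -
  define D where "D = (cmod z)\<^sup>2 + 1"
  have D: "D > 0" by (simp add: D_def add_nonneg_pos)
  have zz: "(cmod z)\<^sup>2 = D - 1" by (simp add: D_def)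
  have im: "(Im z)\<^sup>2 = D - 1 - (Re z)\<^sup>2" using zz cmod_power2 [of z] by simp
  have "(norm (klein (Some z)))\<^sup>2 = ((D - 2) / D)\<^sup>2 + (2 * Re z / D)\<^sup>2"
    unfolding klein_Some zz cmod_power2 [of "Complex u v" for u v] by simp
  also have "\<dots> = 1 - 4 * (Im z)\<^sup>2 / D\<^sup>2"
    unfolding im using D by (simp add: field_simps power2_eq_square)
  finally show ?thesis by (simp add: D_def)
qed

lemma norm_klein_le: "norm (klein p) \<le> 1"
proof (cases p)
  case (Some z)
  have "(norm (klein p))\<^sup>2 \<le> 1" unfolding Some norm_klein_Some by simp
  then show ?thesis by (simp add: abs_square_le_1)
qed simp

lemma norm_klein_lt_iff: "norm (klein (Some z)) < 1 \<longleftrightarrow> Im z \<noteq> 0"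
proof -
  have "norm (klein (Some z)) < 1 \<longleftrightarrow> (norm (klein (Some z)))\<^sup>2 < 1"
    by (simp add: abs_square_less_1)
  also have "\<dots> \<longleftrightarrow> 4 * (Im z)\<^sup>2 / ((cmod z)\<^sup>2 + 1)\<^sup>2 > 0"
    unfolding norm_klein_Some by simp
  also have "\<dots> \<longleftrightarrow> Im z \<noteq> 0"
  proof -
    have "(cmod z)\<^sup>2 + 1 > 0" by (simp add: add_nonneg_pos)
    then show ?thesis by (simp add: zero_less_divide_iff)
  qed
  finally show ?thesis .
qed

text \<open>Put D = |z|^2 + 1 and let k be the Klein image of z with Im z >= 0. Then 1 - Re k = 2 /
  D, Im k = 2 Re z / D and sqrt (1 - |k|^2) = 2 Im z / D; the formula solves these for z.\<close>

definition klein_inv :: "complex \<Rightarrow> complex option" where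
  "klein_inv k = (if k = 1 then None
     else Some (Complex (Im k / (1 - Re k)) (sqrt (1 - (norm k)\<^sup>2) / (1 - Re k))))"

lemma klein_inv_klein:
  assumes "p \<in> extended_half"
  shows "klein_inv (klein p) = p"
proof (cases p)
  case None
  then show ?thesis by (simp add: klein_inv_def)
next
  case (Some z)
  then have z: "Im z \<ge> 0" using assms by (auto simp: extended_half_def)
  define D where "D = (cmod z)\<^sup>2 + 1"
  have D: "D > 0" by (simp add: D_def add_nonneg_pos)
  have R: "1 - Re (klein p) = 2 / D" and I: "Im (klein p) = 2 * Re z / D"
    using D by (simp_all add: Some klein_Some D_def field_simps)
  have "1 - (norm (klein p))\<^sup>2 = (2 * Im z / D)\<^sup>2"
    by (simp add: Some norm_klein_Some D_def power_divide power_mult_distrib)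
  then have S: "sqrt (1 - (norm (klein p))\<^sup>2) = 2 * Im z / D"
    using D z by simp
  have "klein p \<noteq> 1" using R D by auto
  then show ?thesis
    unfolding klein_inv_def R I S using D by (simp add: Some complex_eq_iff)
qed

text \<open>The restriction to \<open>extended_half\<close> matters: z and its conjugate have the
  same Klein image.\<close>

lemma klein_inject: "p \<in> extended_half \<Longrightarrow> q \<in> extended_half \<Longrightarrow> klein p = klein q \<Longrightarrow> p = q"
  by (metis klein_inv_klein)

lemma Re_lt_1:
  assumes "norm k \<le> 1" "k \<noteq> 1"
  shows "Re k < 1"
proof (rule ccontr)
  assume "\<not> Re k < 1"
  then have "Re k = 1" using assms complex_Re_le_cmod [of k] by simp
  moreover have "(Re k)\<^sup>2 + (Im k)\<^sup>2 \<le> 1" using assms by (metis cmod_power2 norm_ge_zero power_le_one)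
  ultimately have "k = 1" by (simp add: complex_eq_iff)
  then show False using assms by simp
qed

lemma klein_inv_in_extended_half: "norm k \<le> 1 \<Longrightarrow> klein_inv k \<in> extended_half"
  using Re_lt_1 [of k] by (auto simp: klein_inv_def extended_half_def abs_square_le_1)

lemma klein_klein_inv:
  assumes k: "norm k \<le> 1"
  shows "klein (klein_inv k) = k"
proof (cases "k = 1")
  case False
  define X Y where "X = Re k" "Y = Im k"
  have X: "X < 1" using Re_lt_1 k False by (simp add: X_Y_def)
  have n: "(norm k)\<^sup>2 = X\<^sup>2 + Y\<^sup>2" by (simp add: cmod_power2 X_Y_def)
  have n1: "(norm k)\<^sup>2 \<le> 1" using k by (simp add: abs_square_le_1)
  define z where "z = Complex (Y / (1 - X)) (sqrt (1 - (norm k)\<^sup>2) / (1 - X))"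
  have "(cmod z)\<^sup>2 = (Y\<^sup>2 + (1 - (norm k)\<^sup>2)) / (1 - X)\<^sup>2"
    using n1 by (simp add: cmod_power2 z_def power_divide add_divide_distrib)
  also have "\<dots> = (1 - X\<^sup>2) / (1 - X)\<^sup>2" by (simp add: n)
  also have "\<dots> = (1 + X) / (1 - X)"
    using X by (simp add: divide_simps) (simp add: power2_eq_square algebra_simps)
  finally have zz: "(cmod z)\<^sup>2 = (1 + X) / (1 - X)" .
  have D: "(cmod z)\<^sup>2 + 1 = 2 / (1 - X)" unfolding zz using X by (simp add: divide_simps)
  have N: "(cmod z)\<^sup>2 - 1 = 2 * X / (1 - X)" unfolding zz using X by (simp add: divide_simps)
  have "klein (Some z) = Complex X Y"
    unfolding klein_Some D N using X by (simp add: z_def)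
  then show ?thesis using False by (simp add: klein_inv_def z_def X_Y_def)
qed (simp add: klein_inv_def)

lemma klein_inv_half_plane:
  assumes "norm k < 1"
  shows "klein_inv k \<in> Some ` upper_half_plane"
proof -
  have "k \<noteq> 1" using assms by auto
  moreover have "Re k < 1" using Re_lt_1 assms \<open>k \<noteq> 1\<close> by simp
  ultimately show ?thesis
    using assms by (auto simp: klein_inv_def upper_half_plane_def abs_square_less_1)
qed

lemma klein_inv_tendsto:
  assumes "norm k < 1"
  shows "((\<lambda>k. the (klein_inv k)) \<longlongrightarrow> the (klein_inv k)) (at k)"
proof -
  have "k \<noteq> 1" using assms by auto
  then have 1: "Re k < 1" using Re_lt_1 assms by simp
  have "((\<lambda>k. Complex (Im k / (1 - Re k)) (sqrt (1 - (norm k)\<^sup>2) / (1 - Re k))) \<longlongrightarrow>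
      Complex (Im k / (1 - Re k)) (sqrt (1 - (norm k)\<^sup>2) / (1 - Re k))) (at k)"
    using 1 by (intro tendsto_intros) auto
  moreover have "\<forall>\<^sub>F j in at k. Complex (Im j / (1 - Re j)) (sqrt (1 - (norm j)\<^sup>2) / (1 - Re j)) = the (klein_inv j)"
  proof -
    have "\<forall>\<^sub>F j in at k. j \<in> - {1}"
      using \<open>k \<noteq> 1\<close> by (intro eventually_at_in_open') auto
    then show ?thesis by eventually_elim (simp add: klein_inv_def)
  qed
  ultimately show ?thesis
    using \<open>k \<noteq> 1\<close> by (simp add: klein_inv_def tendsto_cong)
qed

subsection \<open>Horoballs\<close>

text \<open>Its sublevel sets are the horoballs at p: the formula gives 1 / Im z at infinity and |z
  - x|^2 / Im z at a real point x. Under a determinant 1 matrix it changes only by a constant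
  factor.\<close>

definition horo_height :: "complex option \<Rightarrow> complex \<Rightarrow> real" where
  "horo_height p z = (cmod (snd (homogeneous p) * z - fst (homogeneous p)))\<^sup>2 / Im z"

text \<open>The level belonging to the parameter r, which is a height at infinity but a Euclidean
  radius at a real point, whence the reciprocal in one case only.\<close>

definition horo_bound :: "complex option \<Rightarrow> real \<Rightarrow> real" where
  "horo_bound p r = (if p = None then 1 / r else 2 * r)"

lemma horoball_iff:
  assumes p: "p \<in> extended_real_line" and r: "r > 0"
  shows "z \<in> horoball p r \<longleftrightarrow> Im z > 0 \<and> horo_height p z < horo_bound p r"
proof (cases p)
  case None
  then show ?thesis
    using r by (auto simp: horoball_def horo_height_def horo_bound_def homogeneous_def field_simps)
next
  case (Some w)
  then obtain x :: real where x: "w = of_real x" using p by (auto simp: extended_real_line_def)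
  have eq: "(dist (w + \<i> * of_real r) z)\<^sup>2 = (cmod (z - w))\<^sup>2 - 2 * r * Im z + r\<^sup>2"
    unfolding dist_norm cmod_power2 by (simp add: x power2_eq_square algebra_simps)
  have "dist (w + \<i> * of_real r) z < r \<longleftrightarrow> (dist (w + \<i> * of_real r) z)\<^sup>2 < r\<^sup>2"
    using r by (meson power2_less_imp_less power_strict_mono zero_le_dist less_imp_le pos2)
  then have "z \<in> horoball p r \<longleftrightarrow> (dist (w + \<i> * of_real r) z)\<^sup>2 < r\<^sup>2"
    by (simp add: horoball_def Some)
  also have "\<dots> \<longleftrightarrow> (cmod (z - w))\<^sup>2 < 2 * r * Im z" by (simp add: eq)
  also have "\<dots> \<longleftrightarrow> Im z > 0 \<and> (cmod (z - w))\<^sup>2 < 2 * r * Im z"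
    using r by (smt (verit) zero_le_power2 mult_pos_pos zero_less_mult_pos)
  also have "\<dots> \<longleftrightarrow> Im z > 0 \<and> horo_height p z < horo_bound p r"
    by (auto simp: Some horo_height_def horo_bound_def homogeneous_def field_simps)
  finally show ?thesis .
qed

lemma horoball_subset_half_plane:
  "p \<in> extended_real_line \<Longrightarrow> r > 0 \<Longrightarrow> horoball p r \<subseteq> upper_half_plane"
  by (auto simp: horoball_iff upper_half_plane_def)

lemma horoball_moebius:
  assumes A: "det A = 1" and p: "p \<in> extended_real_line" and r: "r > 0"
  shows "\<exists>r'>0. \<forall>z\<in>horoball p r'. moebius_plane A z \<in> horoball (moebius A p) r"
proof -
  define a b where "a = row_apply A 1 (homogeneous p)" "b = row_apply A 2 (homogeneous p)"
  have "a \<noteq> 0 \<or> b \<noteq> 0"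
    unfolding a_b_def by (intro row_apply_nonzero A homogeneous_nonzero)
  then obtain s where s: "s \<noteq> 0" "a = s * fst (homogeneous (of_homogeneous a b))"
    "b = s * snd (homogeneous (of_homogeneous a b))"
    using homogeneous_of_homogeneous by blast
  have q: "moebius A p = of_homogeneous a b" by (simp add: moebius_homogeneous a_b_def)
  have height: "horo_height p z = (cmod s)\<^sup>2 * horo_height (moebius A p) (moebius_plane A z)" if z: "Im z > 0" for z
  proof -
    define d where "d = of_real (A$2$1) * z + of_real (A$2$2)"
    have d: "d \<noteq> 0" using moebius_denominator_nonzero [OF A z] by (simp add: d_def)
    note det = complex_det_one [OF A]
    have "moebius_plane A z * d = of_real (A$1$1) * z + of_real (A$1$2)"
      using d unfolding moebius_plane_def d_def [symmetric] by simp
    then have "(b * moebius_plane A z - a) * d = b * (of_real (A$1$1) * z + of_real (A$1$2)) - a * d"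
      by (simp add: left_diff_distrib mult.assoc)
    also have "\<dots> = 1 * (snd (homogeneous p) * z - fst (homogeneous p))"
      unfolding det [symmetric] by (simp add: a_b_def d_def row_apply_def algebra_simps)
    finally have "snd (homogeneous p) * z - fst (homogeneous p) = (b * moebius_plane A z - a) * d" by simp
    also have "b * moebius_plane A z - a
        = s * (snd (homogeneous (of_homogeneous a b)) * moebius_plane A z - fst (homogeneous (of_homogeneous a b)))"
      using s by (metis mult.assoc right_diff_distrib)
    finally have "(cmod (snd (homogeneous p) * z - fst (homogeneous p)))\<^sup>2
      = (cmod s)\<^sup>2 * (cmod (snd (homogeneous (of_homogeneous a b)) * moebius_plane A z
           - fst (homogeneous (of_homogeneous a b))))\<^sup>2 * (cmod d)\<^sup>2"
      by (simp add: norm_mult power_mult_distrib)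
    then show ?thesis
      unfolding horo_height_def q Im_moebius_plane [OF A] d_def [symmetric] using d by simp
  qed
  have s2: "(cmod s)\<^sup>2 > 0" using s by simp
  define m where "m = (cmod s)\<^sup>2 * horo_bound (moebius A p) r"
  have m: "m > 0" using s2 r by (simp add: m_def horo_bound_def)
  \<comment> \<open>m is the target level times the scaling factor, and \<open>r'\<close> is the
    parameter whose horoball at p has level m.\<close>
  define r' where "r' = (if p = None then 1 / m else m / 2)"
  have r': "r' > 0" "horo_bound p r' = m" using m by (auto simp: r'_def horo_bound_def)
  have "moebius_plane A z \<in> horoball (moebius A p) r" if "z \<in> horoball p r'" for z
  proof -
    have z: "Im z > 0" "horo_height p z < m" using that r' horoball_iff [OF p r'(1)] by auto
    then have "(cmod s)\<^sup>2 * horo_height (moebius A p) (moebius_plane A z) < (cmod s)\<^sup>2 * horo_bound (moebius A p) r"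
      using height by (simp add: m_def)
    then show ?thesis
      using s2 z Im_moebius_plane_pos [OF A] by (simp add: horoball_iff moebius_extended_real p r)
  qed
  then show ?thesis using r' by blast
qed

subsection \<open>The topology of the extended half plane\<close>

lemma horoball_Int:
  assumes "r > 0" "s > 0"
  obtains t where "t > 0" "p \<in> extended_real_line \<Longrightarrow> horoball p t \<subseteq> horoball p r \<inter> horoball p s"
proof (cases p)
  case None
  then show ?thesis using assms by (intro that [of "max r s"]) (auto simp: horoball_def)
next
  case (Some x)
  have "p \<in> extended_real_line \<Longrightarrow> horoball p (min r s) \<subseteq> horoball p r \<inter> horoball p s"
    using assms Some by (auto simp: horoball_iff horo_bound_def)
  then show ?thesis using assms by (intro that [of "min r s"]) auto
qed

text \<open>Two horoballs at one cusp contain a third, and a basic set at one cusp contains no other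
  cusp. So membership in the generated topology can be tested pointwise, which is the form used for
  continuity.\<close>

lemma openin_extended_half_plane_iff:
  "openin (extended_half_plane G) S \<longleftrightarrow>
     S \<subseteq> Some ` upper_half_plane \<union> cusp_points G \<and>
     open {z \<in> upper_half_plane. Some z \<in> S} \<and>
     (\<forall>p\<in>S \<inter> cusp_points G. \<exists>r>0. Some ` horoball p r \<subseteq> S)"
  (is "_ = (?A S \<and> ?B S \<and> ?C S)")
proof
  have cusp_real: "cusp_points G \<subseteq> extended_real_line" by (auto simp: cusp_points_def)
  have cusp_not_plane: "Some z \<notin> cusp_points G" if "z \<in> upper_half_plane" for z
    using that cusp_real by (auto simp: extended_real_line_def upper_half_plane_def)
  have op: "open upper_half_plane"
    unfolding upper_half_plane_def by (rule open_halfspace_Im_gt)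
  let ?B1 = "{Some ` U | U. open U \<and> U \<subseteq> upper_half_plane}"
  let ?B2 = "{insert p (Some ` horoball p r) | p r. p \<in> cusp_points G \<and> r > 0}"
  assume S: "openin (extended_half_plane G) S"
  then have "generate_topology_on (?B1 \<union> ?B2) S"
    unfolding extended_half_plane_def by (rule openin_topology_generated_by)
  then have "?B S \<and> ?C S"
  proof induction
    case Empty
    then show ?case by simp
  next
    case (Int a b)
    have "{z \<in> upper_half_plane. Some z \<in> a \<inter> b}
        = {z \<in> upper_half_plane. Some z \<in> a} \<inter> {z \<in> upper_half_plane. Some z \<in> b}" by auto
    moreover have "\<exists>r>0. Some ` horoball p r \<subseteq> a \<inter> b" if p: "p \<in> (a \<inter> b) \<inter> cusp_points G" for p
    proof -
      obtain r s where rs: "r > 0" "s > 0" "Some ` horoball p r \<subseteq> a" "Some ` horoball p s \<subseteq> b"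
        using p Int.IH by blast
      obtain t where t: "t > 0" "p \<in> extended_real_line \<Longrightarrow> horoball p t \<subseteq> horoball p r \<inter> horoball p s"
        using horoball_Int rs by blast
      then have "Some ` horoball p t \<subseteq> a \<inter> b" using p rs cusp_real by blast
      then show ?thesis using t by blast
    qed
    ultimately show ?case using Int.IH by (simp add: open_Int)
  next
    case (UN K)
    have "{z \<in> upper_half_plane. Some z \<in> \<Union> K} = (\<Union>k\<in>K. {z \<in> upper_half_plane. Some z \<in> k})" by auto
    then have "?B (\<Union> K)" using UN.IH by auto
    moreover have "\<exists>r>0. Some ` horoball p r \<subseteq> \<Union> K" if p: "p \<in> \<Union> K \<inter> cusp_points G" for p
    proof -
      obtain k where "k \<in> K" "p \<in> k \<inter> cusp_points G" using p by blast
      then show ?thesis using UN.IH by (meson Sup_upper order_trans)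
    qed
    ultimately show ?case by blast
  next
    case (Basis s)
    then consider U where "s = Some ` U" "open U" "U \<subseteq> upper_half_plane"
      | p r where "s = insert p (Some ` horoball p r)" "p \<in> cusp_points G" "r > 0" by blast
    then show ?case
    proof cases
      case 1
      then have "{z \<in> upper_half_plane. Some z \<in> s} = U" by auto
      moreover have "s \<inter> cusp_points G = {}" using 1 cusp_not_plane by auto
      ultimately show ?thesis using 1 by auto
    next
      case 2
      then have sub: "horoball p r \<subseteq> upper_half_plane"
        using horoball_subset_half_plane cusp_real by blast
      then have "{z \<in> upper_half_plane. Some z \<in> s} = horoball p r" using 2 cusp_not_plane by auto
      moreover have "open (horoball p r)"
        by (cases p) (auto simp: horoball_def open_halfspace_Im_gt)
      moreover have "\<exists>r>0. Some ` horoball q r \<subseteq> s" if "q \<in> s \<inter> cusp_points G" for q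
      proof -
        have "q = p" using that sub 2 cusp_not_plane by auto
        then show ?thesis using 2 by blast
      qed
      ultimately show ?thesis by simp
    qed
  qed
  moreover have "?A S"
    using openin_subset [OF S] by (simp add: topspace_extended_half_plane)
  ultimately show "?A S \<and> ?B S \<and> ?C S" by blast
next
  assume S: "?A S \<and> ?B S \<and> ?C S"
  show "openin (extended_half_plane G) S"
  proof (subst openin_subopen, intro ballI)
    fix x assume x: "x \<in> S"
    show "\<exists>T. openin (extended_half_plane G) T \<and> x \<in> T \<and> T \<subseteq> S"
    proof (cases "x \<in> cusp_points G")
      case True
      then obtain r where r: "r > 0" "Some ` horoball x r \<subseteq> S" using S x by blast
      then have "openin (extended_half_plane G) (insert x (Some ` horoball x r))"
        unfolding extended_half_plane_def using True by (intro topology_generated_by_Basis) blast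
      then show ?thesis using r x by blast
    next
      case False
      let ?U = "{z \<in> upper_half_plane. Some z \<in> S}"
      have "openin (extended_half_plane G) (Some ` ?U)"
        unfolding extended_half_plane_def using S by (intro topology_generated_by_Basis) blast
      moreover have "x \<in> Some ` ?U" using False x S by auto
      ultimately show ?thesis by blast
    qed
  qed
qed

subsection \<open>The side pairings and the group they generate\<close>

lemma rot_add_int_pi: "rot (\<theta> + pi * of_int t) = rot \<theta> \<or> rot (\<theta> + pi * of_int t) = - rot \<theta>"
  by (auto simp: rot_def mat2_eq_iff cos_add sin_add cos_npi_int sin_npi_int)

context ideal_polygon
begin

text \<open>\<open>pairing l\<close> is the reflection \<open>z \<mapsto> - cnj z\<close> followed by the reflection in side \<open>l\<close>; it maps
  side \<open>- 1 - l\<close> to side \<open>l\<close> and the polygon to its neighbour across side \<open>l\<close>.\<close>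

definition pairing :: "int \<Rightarrow> real^2^2" where
  "pairing l = rot (of_int l * \<phi>) ** T_mat n ** rot (of_int l * \<phi>)"

lemma lam_eq: "lam n = 2 * cos \<phi> / sin \<phi>"
  by (simp add: lam_def cot_def \<phi>_def)

lemma lam_sin: "lam n * sin \<phi> = 2 * cos \<phi>"
  using sin_phi_pos by (simp add: lam_eq)

lemma det_T_mat [simp]: "det (T_mat n) = 1"
  by (simp add: T_mat_def)

lemma det_pairing [simp]: "det (pairing l) = 1"
  by (simp add: pairing_def det_mul)

text \<open>The value of lambda_n is what makes R^-1 T have trace 0, hence square -I. This is that
  relation, written as R^-1 T R^-1 = -T^-1.\<close>

lemma rot_T_rot: "rot (- \<phi>) ** T_mat n ** rot (- \<phi>) = - mat2 1 (- lam n) 0 1"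
proof -
  have 1: "sin \<phi> * sin \<phi> = 1 - cos \<phi> * cos \<phi>"
    using sin_squared_eq [of \<phi>] by (simp add: power2_eq_square)
  have s: "sin \<phi> \<noteq> 0" using sin_phi_pos by simp
  show ?thesis
    using s by (simp add: rot_def T_mat_def mat2_mult mat2_eq_iff lam_eq field_simps)
      (simp add: 1 algebra_simps)
qed

text \<open>Split R^(-1-l) into R^-l R^-1 and apply the relation to the inner part: g_(-1-l) is
  -R^-l T^-1 R^-l, which is -g_l^-1.\<close>

lemma pairing_minus:
  "pairing (- 1 - l) = - (rot (- of_int l * \<phi>) ** mat2 1 (- lam n) 0 1 ** rot (- of_int l * \<phi>))"
proof -
  have eq: "rot (- of_int l * \<phi>) ** rot (- \<phi>) = rot (of_int (- 1 - l) * \<phi>)"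
    "rot (- \<phi>) ** rot (- of_int l * \<phi>) = rot (of_int (- 1 - l) * \<phi>)"
    unfolding rot_mult by (simp_all add: algebra_simps)
  have "pairing (- 1 - l)
      = (rot (- of_int l * \<phi>) ** rot (- \<phi>)) ** T_mat n ** (rot (- \<phi>) ** rot (- of_int l * \<phi>))"
    unfolding eq pairing_def by (rule refl)
  also have "\<dots> = rot (- of_int l * \<phi>) ** (rot (- \<phi>) ** T_mat n ** rot (- \<phi>)) ** rot (- of_int l * \<phi>)"
    by (simp only: matrix_mul_assoc)
  finally show ?thesis
    unfolding rot_T_rot by (simp only: minus_mat2_mult_left minus_mat2_mult_right)
qed

lemma pairing_inverse: "pairing l ** pairing (- 1 - l) = - mat 1"
proof -
  have "pairing l ** (rot (- of_int l * \<phi>) ** mat2 1 (- lam n) 0 1 ** rot (- of_int l * \<phi>))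
     = rot (of_int l * \<phi>) ** (T_mat n ** (rot (of_int l * \<phi>) ** rot (- of_int l * \<phi>)) ** mat2 1 (- lam n) 0 1)
        ** rot (- of_int l * \<phi>)"
    unfolding pairing_def by (simp only: matrix_mul_assoc)
  also have "\<dots> = rot (of_int l * \<phi>) ** (T_mat n ** mat2 1 (- lam n) 0 1) ** rot (- of_int l * \<phi>)"
    by (simp add: rot_mult rot_0)
  also have "T_mat n ** mat2 1 (- lam n) 0 1 = mat 1"
    by (simp add: T_mat_def mat2_mult mat2_eq_iff)
  also have "rot (of_int l * \<phi>) ** mat 1 ** rot (- of_int l * \<phi>) = mat 1"
    by (simp add: rot_mult rot_0)
  finally show ?thesis
    unfolding pairing_minus minus_mat2_mult_right by simp
qed

lemma pairing_inverse': "pairing (- 1 - l) ** pairing l = - mat 1"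
  using pairing_inverse [of "- 1 - l"] by simp

text \<open>Changing l by a multiple of n can change the sign of the rotation, but the rotation
  occurs twice in \<open>pairing\<close>.\<close>

lemma pairing_mod: "pairing (l mod int n) = pairing l"
proof -
  have *: "real_of_int l = of_int (l mod int n) + real n * of_int (l div int n)"
    by (metis mod_mult_div_eq of_int_add of_int_mult of_int_of_nat_eq)
  have "of_int l * \<phi> = of_int (l mod int n) * \<phi> + pi * of_int (l div int n)"
    unfolding * n_phi [symmetric] by (simp add: algebra_simps)
  then have "rot (of_int l * \<phi>) = rot (of_int (l mod int n) * \<phi>) \<or>
      rot (of_int l * \<phi>) = - rot (of_int (l mod int n) * \<phi>)"
    using rot_add_int_pi by metis
  then show ?thesis
    unfolding pairing_def by (auto simp: minus_mat2_mult_left minus_mat2_mult_right)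
qed

lemma pairing_0: "pairing 0 = T_mat n"
  by (simp add: pairing_def rot_0)

lemma mod_eq_of_dvd: "int n dvd l + m + 1 \<Longrightarrow> m mod int n = (- 1 - l) mod int n"
  by (simp add: mod_eq_dvd_iff algebra_simps)

definition parabolic_gen :: "int \<Rightarrow> real^2^2" where
  "parabolic_gen k = pairing k ** pairing (- k)"

lemma parabolic_gen_eq:
  "parabolic_gen k = rot (of_int k * \<phi>) ** (T_mat n ** T_mat n) ** rot (- of_int k * \<phi>)"
proof -
  have "parabolic_gen k = rot (of_int k * \<phi>) ** T_mat n ** (rot (of_int k * \<phi>) ** rot (of_int (- k) * \<phi>))
      ** T_mat n ** rot (of_int (- k) * \<phi>)"
    unfolding parabolic_gen_def pairing_def by (simp only: matrix_mul_assoc)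
  then show ?thesis by (simp add: rot_mult rot_0 matrix_mul_assoc)
qed

text \<open>Since l - 1 = - 1 - (- l), the product g_(-l) g_(l-1) is -I. This produces each pairing
  from its predecessor and a parabolic generator.\<close>

lemma pairing_step: "pairing l = - (parabolic_gen l ** pairing (l - 1))"
proof -
  have "parabolic_gen l ** pairing (l - 1) = pairing l ** (pairing (- l) ** pairing (- 1 - - l))"
    by (simp add: parabolic_gen_def matrix_mul_assoc)
  then show ?thesis unfolding pairing_inverse by (simp add: minus_mat2_mult_right)
qed

lemma SL2R_simps [simp]:
  "carrier SL2R = {A. det A = 1}" "A \<otimes>\<^bsub>SL2R\<^esub> B = A ** B" "\<one>\<^bsub>SL2R\<^esub> = mat 1"
  by (simp_all add: SL2R_def)

lemma inv_SL2R: "det A = 1 \<Longrightarrow> det B = 1 \<Longrightarrow> B ** A = mat 1 \<Longrightarrow> inv\<^bsub>SL2R\<^esub> A = B"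
  using group.inv_equality [OF group_SL2R, of B A] by simp

lemma R_mat_eq: "R_mat n = rot \<phi>"
  by (simp add: R_mat_def rot_def \<phi>_def)

lemma R_mat_pow: "R_mat n [^]\<^bsub>SL2R\<^esub> (k::nat) = rot (of_nat k * \<phi>)"
proof (induction k)
  case 0
  then show ?case by (simp add: rot_0)
next
  case (Suc k)
  then show ?case by (simp add: R_mat_eq rot_mult algebra_simps)
qed

lemma R_mat_int_pow: "R_mat n [^]\<^bsub>SL2R\<^esub> int k = rot (of_nat k * \<phi>)"
    "R_mat n [^]\<^bsub>SL2R\<^esub> (- int k) = rot (- of_nat k * \<phi>)"
proof -
  show 1: "R_mat n [^]\<^bsub>SL2R\<^esub> int k = rot (of_nat k * \<phi>)"
    by (simp add: int_pow_int R_mat_pow)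
  have "R_mat n [^]\<^bsub>SL2R\<^esub> (- int k) = inv\<^bsub>SL2R\<^esub> (R_mat n [^]\<^bsub>SL2R\<^esub> int k)"
    using group.int_pow_neg [OF group_SL2R R_in_SL2R] by simp
  also have "\<dots> = rot (- of_nat k * \<phi>)"
    unfolding 1 by (intro inv_SL2R) (simp_all add: rot_mult rot_0)
  finally show "R_mat n [^]\<^bsub>SL2R\<^esub> (- int k) = rot (- of_nat k * \<phi>)" .
qed

lemma SL2R_square: "A [^]\<^bsub>SL2R\<^esub> (2::nat) = A ** A"
  by (simp add: numeral_2_eq_2)

lemma conj_R_eq: "conj_R n k A = rot (of_nat k * \<phi>) ** A ** rot (- of_nat k * \<phi>)"
  unfolding conj_R_def R_mat_int_pow by simp

lemma conj_R_T_square: "conj_R n k (T_mat n [^]\<^bsub>SL2R\<^esub> (2::nat)) = parabolic_gen (int k)"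
  unfolding conj_R_eq SL2R_square parabolic_gen_eq by simp

text \<open>From T^-1 = -R^-1 T R^-1 it follows that T^-1 R^2 = -R^-1 T R, whose square is R^-1 T^2
  R. So the second family for even n supplies the conjugates of T^2 with odd exponent.\<close>

lemma conj_R_mixed_square:
  "conj_R n (2 * l) ((inv\<^bsub>SL2R\<^esub> T_mat n \<otimes>\<^bsub>SL2R\<^esub> R_mat n [^]\<^bsub>SL2R\<^esub> (2::nat)) [^]\<^bsub>SL2R\<^esub> (2::nat))
    = parabolic_gen (2 * int l - 1)"
proof -
  have "inv\<^bsub>SL2R\<^esub> T_mat n = mat2 1 (- lam n) 0 1"
    by (intro inv_SL2R) (simp_all add: T_mat_def mat2_mult mat2_eq_iff)
  also have "\<dots> = - (rot (- \<phi>) ** T_mat n ** rot (- \<phi>))"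
    by (simp add: rot_T_rot)
  finally have inv: "inv\<^bsub>SL2R\<^esub> T_mat n = - (rot (- \<phi>) ** T_mat n ** rot (- \<phi>))" .
  have "inv\<^bsub>SL2R\<^esub> T_mat n ** rot (2 * \<phi>) = - (rot (- \<phi>) ** T_mat n ** (rot (- \<phi>) ** rot (2 * \<phi>)))"
    unfolding inv minus_mat2_mult_left by (simp only: matrix_mul_assoc)
  then have X: "inv\<^bsub>SL2R\<^esub> T_mat n ** rot (2 * \<phi>) = - (rot (- \<phi>) ** T_mat n ** rot \<phi>)"
    by (simp add: rot_mult)
  have XX: "(rot (- \<phi>) ** T_mat n ** rot \<phi>) ** (rot (- \<phi>) ** T_mat n ** rot \<phi>)
      = rot (- \<phi>) ** (T_mat n ** (rot \<phi> ** rot (- \<phi>)) ** T_mat n) ** rot \<phi>"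
    by (simp only: matrix_mul_assoc)
  have "conj_R n (2 * l) ((inv\<^bsub>SL2R\<^esub> T_mat n \<otimes>\<^bsub>SL2R\<^esub> R_mat n [^]\<^bsub>SL2R\<^esub> (2::nat)) [^]\<^bsub>SL2R\<^esub> (2::nat))
     = rot (of_nat (2 * l) * \<phi>) ** (rot (- \<phi>) ** (T_mat n ** T_mat n) ** rot \<phi>) ** rot (- of_nat (2 * l) * \<phi>)"
    unfolding conj_R_eq SL2R_square R_mat_eq [symmetric] SL2R_simps
    unfolding R_mat_eq rot_mult using X XX
    by (simp add: rot_mult rot_0 minus_mat2_mult_left minus_mat2_mult_right)
  also have "\<dots> = (rot (of_nat (2 * l) * \<phi>) ** rot (- \<phi>)) ** (T_mat n ** T_mat n) ** (rot \<phi> ** rot (- of_nat (2 * l) * \<phi>))"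
    by (simp only: matrix_mul_assoc)
  also have "\<dots> = parabolic_gen (2 * int l - 1)"
    unfolding parabolic_gen_eq rot_mult by (simp add: algebra_simps)
  finally show ?thesis .
qed

section \<open>The group in terms of the side pairings\<close>

abbreviation \<Gamma> :: "(real^2^2) set" where
  "\<Gamma> \<equiv> carrier (Gamma_group n)"

lemma Gamma_eq: "\<Gamma> = generate SL2R (Gamma_generators n)"
  by (simp add: Gamma_group_def)

lemma subgroup_Gamma: "subgroup \<Gamma> SL2R"
  unfolding Gamma_eq by (rule group.generate_is_subgroup [OF group_SL2R Gamma_generators_subset])

lemma Gamma_mult: "A \<in> \<Gamma> \<Longrightarrow> B \<in> \<Gamma> \<Longrightarrow> A ** B \<in> \<Gamma>"
  using subgroup.m_closed [OF subgroup_Gamma] by simp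

lemma Gamma_one: "mat 1 \<in> \<Gamma>"
  using subgroup.one_closed [OF subgroup_Gamma] by simp

lemma Gamma_det: "A \<in> \<Gamma> \<Longrightarrow> det A = 1"
  using subgroup.subset [OF subgroup_Gamma] by auto

lemma Gamma_generator: "A \<in> Gamma_generators n \<Longrightarrow> A \<in> \<Gamma>"
  unfolding Gamma_eq by (rule generate.incl)

lemma Gamma_uminus: "A \<in> \<Gamma> \<Longrightarrow> - A \<in> \<Gamma>"
proof -
  assume A: "A \<in> \<Gamma>"
  have "- mat 1 \<in> \<Gamma>" by (rule Gamma_generator) (simp add: Gamma_generators_def)
  then have "- mat 1 ** A \<in> \<Gamma>" using A by (rule Gamma_mult)
  then show ?thesis by (simp add: minus_mat2_mult_left)
qed

lemma Gamma_inverse: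
  assumes "A \<in> \<Gamma>"
  obtains B where "B \<in> \<Gamma>" "B ** A = mat 1" "A ** B = mat 1"
proof -
  have "A \<in> carrier SL2R" using Gamma_det assms by simp
  then show ?thesis
    using that [of "inv\<^bsub>SL2R\<^esub> A"] subgroup.m_inv_closed [OF subgroup_Gamma assms]
      group.l_inv [OF group_SL2R] group.r_inv [OF group_SL2R] by simp
qed

text \<open>For even n, an even m = 2 k belongs to the first family of generators and an odd m = 2 k
  - 1 to the second.\<close>

lemma parabolic_gen_in_Gamma:
  assumes "1 \<le> m" "m \<le> n div 2"
  shows "parabolic_gen (int m) \<in> \<Gamma>"
proof (rule Gamma_generator, cases "odd n")
  case True
  then have "m \<le> (n - 1) div 2" using assms by presburger
  then show "parabolic_gen (int m) \<in> Gamma_generators n"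
    using True assms unfolding Gamma_generators_def conj_R_T_square by auto
next
  case False
  show "parabolic_gen (int m) \<in> Gamma_generators n"
  proof (cases "even m")
    case True
    define k where "k = m div 2"
    have "1 \<le> k" "k \<le> (n - 2) div 2" "m = 2 * k"
      using assms False True n_ge_3 by (auto simp: k_def)
    then show ?thesis
      using False unfolding Gamma_generators_def conj_R_T_square by auto
  next
    case odd: False
    define k where "k = (m + 1) div 2"
    have "k \<le> (n - 2) div 2" "m + 1 = 2 * k"
      using assms False odd n_ge_3 by (presburger | auto simp: k_def)+
    moreover from this have "int m = 2 * int k - 1" by linarith
    ultimately show ?thesis
      using False unfolding Gamma_generators_def conj_R_mixed_square by auto
  qed
qed

text \<open>Labels up to n div 2 are reached from T by \<open>pairing_step\<close>. A larger residue
  r is the partner of n - 1 - r, which is at most n div 2, and partners are inverse to each other up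
  to sign.\<close>

lemma pairing_in_Gamma: "pairing l \<in> \<Gamma>"
proof -
  have half: "pairing (int m) \<in> \<Gamma>" if "m \<le> n div 2" for m
    using that
  proof (induction m)
    case 0
    have "T_mat n \<in> \<Gamma>" by (rule Gamma_generator) (simp add: Gamma_generators_def)
    then show ?case by (simp add: pairing_0)
  next
    case (Suc m)
    then have "pairing (int m) \<in> \<Gamma>" by simp
    moreover have "parabolic_gen (int (Suc m)) \<in> \<Gamma>"
      using Suc.prems by (intro parabolic_gen_in_Gamma) auto
    ultimately show ?case
      using pairing_step [of "int (Suc m)"] Gamma_mult Gamma_uminus by simp
  qed
  define r where "r = nat (l mod int n)"
  have r: "int r = l mod int n" "r < n" using n_ge_3 by (auto simp: r_def nat_less_iff)
  have "pairing (int r) \<in> \<Gamma>"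
  proof (cases "r \<le> n div 2")
    case False
    then have *: "n - 1 - r \<le> n div 2" using r by linarith
    have "int (n - 1 - r) mod int n = (- 1 - int r) mod int n"
      using r by (simp add: mod_eq_dvd_iff of_nat_diff)
    then have "pairing (- 1 - int r) = pairing (int (n - 1 - r))"
      by (metis pairing_mod)
    then have "pairing (- 1 - int r) \<in> \<Gamma>" using half * by simp
    then obtain B where B: "B \<in> \<Gamma>" "pairing (- 1 - int r) ** B = mat 1"
      using Gamma_inverse by blast
    have "- B = pairing (int r) ** pairing (- 1 - int r) ** B"
      by (simp add: pairing_inverse minus_mat2_mult_left)
    also have "\<dots> = pairing (int r)"
      by (simp add: matrix_mul_assoc [symmetric] B)
    finally show ?thesis using Gamma_uminus B by metis
  qed (rule half)
  then show ?thesis using pairing_mod r by simp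
qed

section \<open>Words in the side pairings\<close>

definition word :: "int list \<Rightarrow> real^2^2" where
  "word ls = foldr (\<lambda>l A. pairing l ** A) ls (mat 1)"

lemma word_simps [simp]: "word [] = mat 1" "word (l # ls) = pairing l ** word ls"
  by (simp_all add: word_def)

lemma word_append: "word (ls @ ms) = word ls ** word ms"
  by (induction ls) (simp_all add: matrix_mul_assoc)

lemma det_word [simp]: "det (word ls) = 1"
  by (induction ls) (simp_all add: det_mul)

lemma word_rev:
  "word (rev (map (\<lambda>l. - 1 - l) ls)) ** word ls = mat 1 \<or> word (rev (map (\<lambda>l. - 1 - l) ls)) ** word ls = - mat 1"
proof (induction ls)
  case (Cons l ls)
  have "word (rev (map (\<lambda>l. - 1 - l) (l # ls))) ** word (l # ls)
      = word (rev (map (\<lambda>l. - 1 - l) ls)) ** (pairing (- 1 - l) ** pairing l) ** word ls"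
    by (simp add: word_append matrix_mul_assoc)
  then show ?case
    using Cons.IH by (auto simp: pairing_inverse' minus_mat2_mult_left minus_mat2_mult_right)
qed simp

text \<open>Words are closed under inversion only up to sign, because paired letters multiply to -I.
  Together with their negatives they form a subgroup containing the generators.\<close>

lemma Gamma_word:
  assumes "A \<in> \<Gamma>"
  shows "\<exists>ls. A = word ls \<or> A = - word ls"
proof -
  define W where "W = {A. \<exists>ls. A = word ls \<or> A = - word ls}"
  have W_word: "word ls \<in> W" "- word ls \<in> W" for ls by (auto simp: W_def)
  have W_parabolic: "parabolic_gen k \<in> W" for k
    using W_word(1) [of "[k, - k]"] by (simp add: parabolic_gen_def)
  have W_mult: "A ** B \<in> W" if "A \<in> W" "B \<in> W" for A B
  proof -
    obtain ls where "A = word ls \<or> A = - word ls" using \<open>A \<in> W\<close> unfolding W_def by blast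
    moreover obtain ms where "B = word ms \<or> B = - word ms" using \<open>B \<in> W\<close> unfolding W_def by blast
    ultimately have "A ** B = word (ls @ ms) \<or> A ** B = - word (ls @ ms)"
      by (auto simp: word_append minus_mat2_mult_left minus_mat2_mult_right)
    then show ?thesis by (auto simp: W_def)
  qed
  have W_det: "det A = 1" if "A \<in> W" for A
    using that by (auto simp: W_def det_minus_mat2)
  have W_inv: "inv\<^bsub>SL2R\<^esub> A \<in> W" if "A \<in> W" for A
  proof -
    obtain ls where ls: "A = word ls \<or> A = - word ls" using \<open>A \<in> W\<close> unfolding W_def by blast
    define B where "B = word (rev (map (\<lambda>l. - 1 - l) ls))"
    have "B ** A = mat 1 \<or> - B ** A = mat 1"
      using ls word_rev [of ls] by (auto simp: B_def minus_mat2_mult_left minus_mat2_mult_right)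
    then have "inv\<^bsub>SL2R\<^esub> A = B \<or> inv\<^bsub>SL2R\<^esub> A = - B"
      using inv_SL2R [of A B] inv_SL2R [of A "- B"] W_det [OF that] by (auto simp: B_def det_minus_mat2)
    then show ?thesis using W_word by (auto simp: B_def)
  qed
  have "subgroup W SL2R"
    using W_det W_mult W_inv W_word(1) [of "[]"] by (intro subgroup.intro) auto
  moreover have "Gamma_generators n \<subseteq> W"
  proof -
    have "- mat 1 \<in> W" "T_mat n \<in> W"
      using W_word(2) [of "[]"] W_word(1) [of "[0]"] by (simp_all add: pairing_0)
    then show ?thesis
      unfolding Gamma_generators_def conj_R_T_square conj_R_mixed_square using W_parabolic by auto
  qed
  ultimately have "\<Gamma> \<subseteq> W"
    unfolding Gamma_eq by (intro group.generate_subgroup_incl [OF group_SL2R])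
  then show ?thesis using assms by (auto simp: W_def)
qed

text \<open>If n divides l + m + 1, then g_m is g_(-1-l), so the letters l and m cancel up to
  sign.\<close>

fun reduced :: "int list \<Rightarrow> bool" where
  "reduced (l # m # ls) \<longleftrightarrow> \<not> int n dvd l + m + 1 \<and> reduced (m # ls)"
| "reduced ls \<longleftrightarrow> True"

lemma reduced_Cons: "reduced (l # ls) \<Longrightarrow> reduced ls"
  by (cases ls) auto

lemma word_reduce: "\<exists>ms. reduced ms \<and> (word ls = word ms \<or> word ls = - word ms)"
proof (induction ls)
  case Nil
  show ?case by (intro exI [of _ "[]"]) simp
next
  case (Cons l ls)
  then obtain ms where ms: "reduced ms" "word ls = word ms \<or> word ls = - word ms" by blast
  show ?case
  proof (cases ms)
    case Nil
    then show ?thesis using ms by (intro exI [of _ "[l]"]) (auto simp: minus_mat2_mult_right)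
  next
    case (Cons m ms')
    show ?thesis
    proof (cases "int n dvd l + m + 1")
      case True
      then have "pairing m = pairing (- 1 - l)" by (metis mod_eq_of_dvd pairing_mod)
      then have "pairing l ** word ms = - word ms'"
        by (simp add: Cons matrix_mul_assoc pairing_inverse minus_mat2_mult_left)
      then have "word (l # ls) = word ms' \<or> word (l # ls) = - word ms'"
        using ms by (auto simp: minus_mat2_mult_right)
      then show ?thesis using ms Cons reduced_Cons by blast
    next
      case False
      then show ?thesis
        using ms Cons by (intro exI [of _ "l # ms"]) (auto simp: minus_mat2_mult_right)
    qed
  qed
qed

lemma Gamma_reduced_word:
  assumes "A \<in> \<Gamma>"
  obtains ls where "reduced ls" "A = word ls \<or> A = - word ls"
  using Gamma_word [OF assms] word_reduce by (metis minus_minus)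

subsection \<open>Ping-pong\<close>

text \<open>In the half plane, sides 0 and -1 are the vertical lines with real part cot \<phi> and
  -cot \<phi>.\<close>

lemma side_klein_Some:
  "side 0 (klein (Some z)) = 1 + 2 * (Re z * sin \<phi> / cos \<phi> - 1) / ((cmod z)\<^sup>2 + 1)"
  "side (- 1) (klein (Some z)) = 1 + 2 * (- Re z * sin \<phi> / cos \<phi> - 1) / ((cmod z)\<^sup>2 + 1)"
proof -
  have D: "(cmod z)\<^sup>2 + 1 > 0" by (simp add: add_nonneg_pos)
  show "side 0 (klein (Some z)) = 1 + 2 * (Re z * sin \<phi> / cos \<phi> - 1) / ((cmod z)\<^sup>2 + 1)"
    "side (- 1) (klein (Some z)) = 1 + 2 * (- Re z * sin \<phi> / cos \<phi> - 1) / ((cmod z)\<^sup>2 + 1)"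
    using D cos_phi_pos by (simp_all add: side_def klein_Some divide_simps) (simp_all add: algebra_simps)
qed

lemma side_0_ge_1_iff: "side 0 (klein (Some z)) \<ge> 1 \<longleftrightarrow> Re z * sin \<phi> \<ge> cos \<phi>"
  and side_0_gt_1_iff: "side 0 (klein (Some z)) > 1 \<longleftrightarrow> Re z * sin \<phi> > cos \<phi>"
  and side_m1_le_1_iff: "side (- 1) (klein (Some z)) \<le> 1 \<longleftrightarrow> Re z * sin \<phi> \<ge> - cos \<phi>"
  and side_m1_eq_1_iff: "side (- 1) (klein (Some z)) = 1 \<longleftrightarrow> Re z * sin \<phi> = - cos \<phi>"
proof -
  have D: "(cmod z)\<^sup>2 + 1 > 0" by (simp add: add_nonneg_pos)
  have key: "1 + 2 * (x - 1) / ((cmod z)\<^sup>2 + 1) \<ge> 1 \<longleftrightarrow> x \<ge> 1"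
    "1 + 2 * (x - 1) / ((cmod z)\<^sup>2 + 1) > 1 \<longleftrightarrow> x > 1"
    "1 + 2 * (x - 1) / ((cmod z)\<^sup>2 + 1) \<le> 1 \<longleftrightarrow> x \<le> 1"
    "1 + 2 * (x - 1) / ((cmod z)\<^sup>2 + 1) = 1 \<longleftrightarrow> x = 1" for x
    using D by (simp_all add: zero_le_divide_iff zero_less_divide_iff divide_le_0_iff)
  show "side 0 (klein (Some z)) \<ge> 1 \<longleftrightarrow> Re z * sin \<phi> \<ge> cos \<phi>"
    "side 0 (klein (Some z)) > 1 \<longleftrightarrow> Re z * sin \<phi> > cos \<phi>"
    unfolding side_klein_Some key using cos_phi_pos by (simp_all add: le_divide_eq less_divide_eq)
  have "side (- 1) (klein (Some z)) \<le> 1 \<longleftrightarrow> - Re z * sin \<phi> \<le> 1 * cos \<phi>"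
    unfolding side_klein_Some key using cos_phi_pos by (simp only: pos_divide_le_eq)
  then show "side (- 1) (klein (Some z)) \<le> 1 \<longleftrightarrow> Re z * sin \<phi> \<ge> - cos \<phi>"
    by auto
  have "side (- 1) (klein (Some z)) = 1 \<longleftrightarrow> - Re z * sin \<phi> = 1 * cos \<phi>"
    unfolding side_klein_Some key using cos_phi_pos by (simp only: nonzero_divide_eq_eq less_imp_neq [symmetric] simp_thms)
  then show "side (- 1) (klein (Some z)) = 1 \<longleftrightarrow> Re z * sin \<phi> = - cos \<phi>"
    by auto
qed

lemma moebius_T_None: "moebius (T_mat n) None = None"
  and moebius_T_Some: "moebius (T_mat n) (Some z) = Some (z + of_real (lam n))"
  by (simp_all add: moebius_def T_mat_def)

text \<open>T translates by 2 cot \<phi>, so it moves the line of side -1 to that of side 0. At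
  infinity, common to both sides, both inequalities are equalities.\<close>

lemma T_side_iff: "side 0 (klein (moebius (T_mat n) p)) \<ge> 1 \<longleftrightarrow> side (- 1) (klein p) \<le> 1"
proof (cases p)
  case None
  have "side 0 1 = 1" "side (- 1) 1 = 1"
    using cos_phi_pos by (simp_all add: side_def)
  then show ?thesis by (simp add: None moebius_T_None)
next
  case (Some z)
  have "Re (z + of_real (lam n)) * sin \<phi> = Re z * sin \<phi> + 2 * cos \<phi>"
    using lam_sin by (simp add: algebra_simps)
  then show ?thesis
    unfolding Some moebius_T_Some side_0_ge_1_iff side_m1_le_1_iff by linarith
qed

text \<open>On the line with real part -cot \<phi>, translation by 2 cot \<phi> coincides with z ->
  - cnj z, which is conjugation in the disc.\<close>

lemma T_klein_cnj:
  assumes "side (- 1) (klein p) = 1"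
  shows "klein (moebius (T_mat n) p) = cnj (klein p)"
proof (cases p)
  case None
  then show ?thesis by (simp add: moebius_T_None)
next
  case (Some z)
  have "Re z * sin \<phi> = - cos \<phi>" using assms by (simp add: Some side_m1_eq_1_iff)
  then have "(lam n + 2 * Re z) * sin \<phi> = 0" using lam_sin by (simp add: algebra_simps)
  then have "lam n = - 2 * Re z" using sin_phi_pos by simp
  then have r: "Re (z + of_real (lam n)) = - Re z" and "z + of_real (lam n) = - cnj z"
    by (simp_all add: complex_eq_iff)
  then have n: "cmod (z + of_real (lam n)) = cmod z"
    by (metis complex_mod_cnj norm_minus_cancel)
  show ?thesis unfolding Some moebius_T_Some klein_Some n r by (simp add: complex_eq_iff)
qed

lemma klein_rot_vertex: "klein (moebius (rot (of_int l * \<phi>)) p) = vertex l * klein p"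
  by (simp add: klein_rot vertex_def mult.assoc)

lemma moebius_pairing:
  "moebius (pairing l) p = moebius (rot (of_int l * \<phi>)) (moebius (T_mat n) (moebius (rot (of_int l * \<phi>)) p))"
  unfolding pairing_def by (simp add: moebius_mult det_mul matrix_mul_assoc)

lemma pairing_side_iff:
  "side l (klein (moebius (pairing l) p)) \<ge> 1 \<longleftrightarrow> side (- 1 - l) (klein p) \<le> 1"
  unfolding moebius_pairing by (simp add: klein_rot_vertex side_vertex_mult T_side_iff)

lemma vertex_cnj: "cnj (vertex j) = vertex (- j)"
  by (simp add: vertex_def cis_cnj)

lemma vertex_mult: "vertex i * vertex j = vertex (i + j)"
  by (simp add: vertex_def cis_mult algebra_simps)

lemma vertex_0 [simp]: "vertex 0 = 1"
  by (simp add: vertex_def)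

text \<open>Both rotations in g_l have the same sense, and the conjugation between them reverses
  one, so they cancel. Hence one map, independent of l, describes the identification of all
  sides.\<close>

lemma pairing_klein_cnj:
  assumes "side (- 1 - l) (klein p) = 1"
  shows "klein (moebius (pairing l) p) = cnj (klein p)"
proof -
  have "side (- 1) (klein (moebius (rot (of_int l * \<phi>)) p)) = 1"
    unfolding klein_rot_vertex side_vertex_mult using assms by simp
  then have "klein (moebius (pairing l) p) = vertex l * cnj (vertex l * klein p)"
    unfolding moebius_pairing by (simp add: klein_rot_vertex T_klein_cnj)
  also have "\<dots> = (vertex l * vertex (- l)) * cnj (klein p)"
    by (simp add: vertex_cnj)
  finally show ?thesis by (simp add: vertex_mult)
qed

lemma pairing_klein_cnj':
  assumes "side l (klein p) = 1"
  shows "klein (moebius (pairing (- 1 - l)) p) = cnj (klein p)"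
  using pairing_klein_cnj [of "- 1 - l" p] assms by simp

lemma moebius_word_Cons: "moebius (word (l # ls)) p = moebius (pairing l) (moebius (word ls) p)"
  by (simp add: moebius_mult)

lemma ping_pong:
  assumes p: "klein p \<in> polygon" and "reduced (l # ls)"
  shows "side l (klein (moebius (word (l # ls)) p)) \<ge> 1"
  using assms(2)
proof (induction ls arbitrary: l)
  case Nil
  have "side (- 1 - l) (klein p) \<le> 1" using p by (simp add: polygon_def)
  then show ?case by (simp add: pairing_side_iff)
next
  case (Cons m ls)
  define q where "q = moebius (word (m # ls)) p"
  have m: "side m (klein q) \<ge> 1" using Cons unfolding q_def by simp
  have "side (- 1 - l) (klein q) \<le> 1"
  proof (rule ccontr)
    assume gt: "\<not> side (- 1 - l) (klein q) \<le> 1"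
    \<comment> \<open>As the word is reduced, m and - 1 - l label different sides. A point beyond
      both would be a vertex, where no side function exceeds 1.\<close>
    have "m mod int n \<noteq> (- 1 - l) mod int n"
      using Cons.prems by (simp add: mod_eq_dvd_iff algebra_simps)
    then obtain j where "klein q = vertex j"
      using two_sides_imp_vertex [of "klein q" m "- 1 - l"] m gt norm_klein_le [of q] by auto
    then show False using gt vertex_in_polygon [of j] by (simp add: polygon_def)
  qed
  then show ?case
    unfolding moebius_word_Cons pairing_side_iff q_def .
qed

text \<open>By ping-pong the image lies on the side named by the leading letter. Undoing this letter
  conjugates the image, so it stays in the polygon with the same folded value, and the rest of the
  word is handled by induction.\<close>

lemma fold_map_reduced:
  assumes "reduced ls" "klein p \<in> polygon" "klein (moebius (word ls) p) \<in> polygon"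
  shows "fold_map (klein (moebius (word ls) p)) = fold_map (klein p)"
  using assms
proof (induction ls)
  case Nil
  then show ?case by (simp add: moebius_one)
next
  case (Cons l ls)
  define q where "q = moebius (word (l # ls)) p"
  have q: "klein q \<in> polygon" using Cons.prems by (simp add: q_def)
  have "side l (klein q) \<ge> 1" using ping_pong Cons.prems q_def by blast
  then have sl: "side l (klein q) = 1" using q by (simp add: polygon_def order_antisym)
  then have gauge: "gauge (klein q) = 1" using q gauge_eq_1_iff by blast
  have "moebius (pairing (- 1 - l)) q = moebius (- word ls) p"
    unfolding q_def by (simp add: moebius_mult det_mul matrix_mul_assoc pairing_inverse' minus_mat2_mult_left)
  then have "klein (moebius (word ls) p) = cnj (klein q)"
    using pairing_klein_cnj' [OF sl] by (simp add: moebius_minus)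
  then have "fold_map (klein (moebius (word ls) p)) = fold_map (klein q)"
    and "klein (moebius (word ls) p) \<in> polygon"
    using fold_map_cnj [OF gauge] q cnj_in_polygon_iff by simp_all
  then show ?case using Cons reduced_Cons q_def by metis
qed

lemma fold_map_Gamma:
  assumes "A \<in> \<Gamma>" "klein p \<in> polygon" "klein (moebius A p) \<in> polygon"
  shows "fold_map (klein (moebius A p)) = fold_map (klein p)"
proof -
  obtain ls where ls: "reduced ls" "A = word ls \<or> A = - word ls"
    using Gamma_reduced_word assms(1) by blast
  then have "moebius A p = moebius (word ls) p" by (auto simp: moebius_minus)
  then show ?thesis using fold_map_reduced ls(1) assms by simp
qed

lemma extended_half_eq: "extended_half = Some ` upper_half_plane \<union> extended_real_line"
proof -
  have "z \<in> range complex_of_real" if "Im z = 0" for z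
    using that by (metis complex_is_Real_iff Reals_def)
  then show ?thesis
    by (force simp: extended_half_def upper_half_plane_def extended_real_line_def order_le_less)
qed

lemma moebius_extended_half: "det A = 1 \<Longrightarrow> p \<in> extended_half \<Longrightarrow> moebius A p \<in> extended_half"
  using moebius_half_plane moebius_extended_real unfolding extended_half_eq by blast

text \<open>Converse to \<open>fold_map_Gamma\<close>: two distinct points with the same fold are
  conjugate boundary points, and a side pairing exchanges these.\<close>

lemma fold_map_eq_imp_Gamma:
  assumes p: "p \<in> extended_half" "klein p \<in> polygon" and q: "q \<in> extended_half" "klein q \<in> polygon"
    and eq: "fold_map (klein p) = fold_map (klein q)"
  shows "\<exists>A\<in>\<Gamma>. moebius A p = q"
proof (cases "klein p = klein q")
  case True
  then have "p = q" using klein_inject p q by blast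
  then show ?thesis using Gamma_one moebius_one by metis
next
  case False
  then have g: "gauge (klein p) = 1" and c: "klein q = cnj (klein p)"
    using fold_map_eq p q eq by metis+
  obtain l where "side l (klein p) = 1" using g gauge_eq_1_iff by blast
  then have "klein (moebius (pairing (- 1 - l)) p) = klein q"
    using c pairing_klein_cnj' by simp
  then have "moebius (pairing (- 1 - l)) p = q"
    using klein_inject moebius_extended_half p q det_pairing by blast
  then show ?thesis using pairing_in_Gamma by blast
qed

text \<open>Rotate so that side l becomes the line with real part \<open>lam n / 2\<close>. The move
  is then translation by \<open>- lam n\<close> of a point to its right, which decreases |w| at
  fixed Im w, and the Klein norm increases with |w| for fixed Im w.\<close>

lemma klein_pairing_decreases:
  assumes z: "Im z > 0" and gt: "side l (klein (Some z)) > 1"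
  shows "norm (klein (moebius (pairing (- 1 - l)) (Some z))) < norm (klein (Some z))"
proof -
  define w where "w = moebius_plane (rot (of_int (- l) * \<phi>)) z"
  have w: "moebius (rot (of_int (- l) * \<phi>)) (Some z) = Some w" "Im w > 0"
    using z by (simp_all add: w_def moebius_Some Im_moebius_plane_pos)
  have kw: "klein (Some w) = vertex (- l) * klein (Some z)"
    using klein_rot_vertex [of "- l" "Some z"] w by simp
  have "side 0 (klein (Some w)) > 1"
    unfolding kw side_vertex_mult using gt by simp
  then have "Re w * sin \<phi> > cos \<phi>" by (simp add: side_0_gt_1_iff)
  then have "lam n * sin \<phi> < 2 * Re w * sin \<phi>" using lam_sin by simp
  then have lw: "lam n < 2 * Re w" using sin_phi_pos by simp
  have lpos: "lam n > 0" using sin_phi_pos cos_phi_pos by (simp add: lam_eq)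
  have "moebius (pairing (- 1 - l)) (Some z)
     = moebius (rot (of_int (- l) * \<phi>)) (moebius (mat2 1 (- lam n) 0 1) (moebius (rot (of_int (- l) * \<phi>)) (Some z)))"
    unfolding pairing_minus moebius_minus by (simp add: moebius_mult det_mul matrix_mul_assoc)
  also have "moebius (mat2 1 (- lam n) 0 1) (moebius (rot (of_int (- l) * \<phi>)) (Some z)) = Some (w - of_real (lam n))"
    unfolding w by (simp add: moebius_def)
  finally have "norm (klein (moebius (pairing (- 1 - l)) (Some z))) = norm (klein (Some (w - of_real (lam n))))"
    by (simp only: klein_rot_vertex norm_mult norm_vertex mult_1)
  moreover have "norm (klein (Some z)) = norm (klein (Some w))"
    by (simp add: kw norm_mult)
  moreover have "norm (klein (Some (w - of_real (lam n)))) < norm (klein (Some w))"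
  proof (rule power2_less_imp_less)
    define D D' where "D = (cmod w)\<^sup>2 + 1" "D' = (cmod (w - of_real (lam n)))\<^sup>2 + 1"
    have D': "D' > 0" by (simp add: D_D'_def add_nonneg_pos)
    have "D' = D - lam n * (2 * Re w - lam n)"
      unfolding D_D'_def cmod_power2 by (simp add: power2_eq_square algebra_simps)
    moreover have "lam n * (2 * Re w - lam n) > 0" using lw lpos by simp
    ultimately have "D' < D" by linarith
    then have "D'\<^sup>2 < D\<^sup>2" using D' by (intro power_strict_mono) auto
    then have "4 * (Im w)\<^sup>2 / D\<^sup>2 < 4 * (Im w)\<^sup>2 / D'\<^sup>2"
      using w D' \<open>D' < D\<close> by (intro divide_strict_left_mono) auto
    then show "(norm (klein (Some (w - of_real (lam n)))))\<^sup>2 < (norm (klein (Some w)))\<^sup>2"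
      unfolding norm_klein_Some D_D'_def by simp
  qed simp
  ultimately show ?thesis by simp
qed

subsection \<open>The translates of the polygon cover the half plane\<close>

lemma isCont_fold_map: "isCont fold_map k"
  using continuous_on_fold_map [of UNIV] by (simp add: continuous_on_eq_continuous_at)

lemma isCont_side: "isCont (side l) k"
  unfolding side_def [abs_def] by (intro continuous_intros) (use cos_phi_pos in auto)

lemma isCont_gauge: "isCont gauge k"
  using continuous_on_gauge [of UNIV] by (simp add: continuous_on_eq_continuous_at)

lemma isCont_klein_moebius_plane:
  assumes "det A = 1" "Im z > 0"
  shows "isCont (\<lambda>z. klein (Some (moebius_plane A z))) z"
  using isCont_o2 [OF isCont_moebius_plane [OF assms] isCont_klein_Some] .

lemma eventually_half_plane: "Im z > 0 \<Longrightarrow> \<forall>\<^sub>F w in nhds z. Im w > 0"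
  using eventually_nhds_in_open [OF open_halfspace_Im_gt [of 0], of z] by simp

lemma eventually_in_open_if_isCont:
  "isCont f x \<Longrightarrow> open U \<Longrightarrow> f x \<in> U \<Longrightarrow> \<forall>\<^sub>F y in nhds x. f y \<in> U"
  unfolding isCont_def tendsto_at_iff_tendsto_nhds by (rule topological_tendstoD)

text \<open>An interior point has a neighbourhood inside the polygon. Near a point on side l, each z
  or its image under g_(-1-l) lies in the polygon, and both images fold close to the same value. The
  condition on U lets the lemma serve for covering (\<open>U = UNIV\<close>) and for
  continuity.\<close>

lemma eventually_near_polygon:
  assumes z0: "Im z0 > 0" and cell: "klein (Some z0) \<in> polygon"
    and U: "open U" "fold_map (klein (Some z0)) \<in> U"
  shows "\<forall>\<^sub>F z in nhds z0. \<exists>A\<in>\<Gamma>. klein (moebius A (Some z)) \<in> polygon \<and>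
           fold_map (klein (moebius A (Some z))) \<in> U"
proof -
  let ?k = "\<lambda>z. klein (Some z)"
  have kcont: "isCont ?k z0" by (rule isCont_klein_Some)
  have evU: "\<forall>\<^sub>F z in nhds z0. fold_map (?k z) \<in> U"
    using U isCont_o2 [OF kcont isCont_fold_map] by (intro eventually_in_open_if_isCont)
  have k1: "norm (?k z0) < 1" using z0 norm_klein_lt_iff by simp
  show ?thesis
  proof (cases "gauge (?k z0) < 1")
    case True
    have "\<forall>\<^sub>F z in nhds z0. gauge (?k z) \<in> {..<1}"
      using True isCont_o2 [OF kcont isCont_gauge] by (intro eventually_in_open_if_isCont) auto
    with evU show ?thesis
    proof eventually_elim
      case (elim z)
      then show ?case
        using gauge_le_1_iff [of "?k z"] by (intro bexI [OF _ Gamma_one]) (auto simp: moebius_one)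
    qed
  next
    case False
    then have g1: "gauge (?k z0) = 1" using gauge_le_1_iff [of "?k z0"] cell by simp
    then obtain l where l: "side l (?k z0) = 1" using gauge_eq_1_iff by blast
    define B where "B = pairing (- 1 - l)"
    have detB: "det B = 1" by (simp add: B_def)
    let ?b = "\<lambda>z. klein (Some (moebius_plane B z))"
    have bcont: "isCont ?b z0" using isCont_klein_moebius_plane detB z0 by blast
    have b0: "?b z0 = cnj (?k z0)"
      using pairing_klein_cnj' [OF l] moebius_Some [OF detB z0] by (simp add: B_def)
    have evbU: "\<forall>\<^sub>F z in nhds z0. fold_map (?b z) \<in> U"
      using U isCont_o2 [OF bcont isCont_fold_map] fold_map_cnj [OF g1] b0
      by (intro eventually_in_open_if_isCont) auto
    \<comment> \<open>In the open disc a point lies on or beyond at most one side, since otherwise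
      it would be a vertex, of norm 1.\<close>
    have other: "side m k < 1" if "norm k < 1" "side j k = 1" "m mod int n \<noteq> j mod int n" for m j k
    proof (rule ccontr)
      assume "\<not> side m k < 1"
      then have "\<exists>i. k = vertex i" using two_sides_imp_vertex [of k m j] that by auto
      then show False using that by auto
    qed
    define M where "M = {0..<int n}"
    have M: "m mod int n \<in> M" for m using mod_in_range by (simp add: M_def)
    have ev: "\<forall>\<^sub>F z in nhds z0. \<forall>m\<in>M - {j mod int n}. side m (h z) < 1"
      if h: "isCont h z0" and k: "norm (h z0) < 1" "side j (h z0) = 1" for h j
    proof (intro eventually_ball_finite ballI)
      show "finite (M - {j mod int n})" by (simp add: M_def)
      fix m assume "m \<in> M - {j mod int n}"
      then have "m mod int n \<noteq> j mod int n" by (auto simp: M_def)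
      then have "side m (h z0) < 1" using other k by blast
      then have "\<forall>\<^sub>F z in nhds z0. side m (h z) \<in> {..<1}"
        using isCont_o2 [OF h isCont_side] by (intro eventually_in_open_if_isCont) auto
      then show "\<forall>\<^sub>F z in nhds z0. side m (h z) < 1" by simp
    qed
    have in_polygon: "k \<in> polygon" if "side j k \<le> 1" "\<forall>m\<in>M - {j mod int n}. side m k < 1" for j k
    proof -
      have "side m k \<le> 1" for m
      proof (cases "m mod int n = j mod int n")
        case True
        then show ?thesis using that side_mod by metis
      next
        case False
        then have "side (m mod int n) k < 1" using that M by blast
        then show ?thesis by (simp add: side_mod)
      qed
      then show ?thesis by (simp add: polygon_def)
    qed
    have ev1: "\<forall>\<^sub>F z in nhds z0. \<forall>m\<in>M - {l mod int n}. side m (?k z) < 1"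
      using ev kcont k1 l by blast
    have ev2: "\<forall>\<^sub>F z in nhds z0. \<forall>m\<in>M - {(- 1 - l) mod int n}. side m (?b z) < 1"
      using ev [OF bcont, of "- 1 - l"] k1 l b0 by (simp add: side_cnj)
    show ?thesis
      using evU evbU ev1 ev2 eventually_half_plane [OF z0]
    proof eventually_elim
      case (elim z)
      show ?case
      proof (cases "side l (?k z) \<le> 1")
        case True
        then have "?k z \<in> polygon" using in_polygon elim by blast
        then show ?thesis
          using elim by (intro bexI [OF _ Gamma_one]) (auto simp: moebius_one)
      next
        case False
        have B: "moebius B (Some z) = Some (moebius_plane B z)"
          using moebius_Some detB elim by blast
        \<comment> \<open>z lies beyond side l and is g_l applied to B z, so
          \<open>pairing_side_iff\<close> places B z on the inner side of - 1 - l.\<close>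
        have "moebius (pairing l) (moebius B (Some z)) = Some z"
          using pairing_inverse [of l] by (simp add: moebius_mult detB B_def moebius_minus moebius_one)
        then have "side (- 1 - l) (?b z) \<le> 1"
          using pairing_side_iff [of l "moebius B (Some z)"] False B by simp
        then have "?b z \<in> polygon" using in_polygon elim by blast
        then show ?thesis
          using elim B pairing_in_Gamma by (intro bexI [of _ B]) (auto simp: B_def)
      qed
    qed
  qed
qed

text \<open>The distance to the centre of the disc along an orbit tends to its infimum at some point of
  the half plane; this point lies in the polygon, and the polygon together with its neighbours
  covers a neighbourhood of it.\<close>

lemma Gamma_polygon_covers:
  assumes z: "Im z > 0"
  shows "\<exists>A\<in>\<Gamma>. klein (moebius A (Some z)) \<in> polygon"
proof -
  define N where "N A = norm (klein (moebius A (Some z)))" for A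
  define m where "m = Inf (N ` \<Gamma>)"
  have bdd: "bdd_below (N ` \<Gamma>)" by (rule bdd_belowI [of _ 0]) (auto simp: N_def)
  have m_le: "m \<le> N A" if "A \<in> \<Gamma>" for A
    unfolding m_def using bdd that by (intro cInf_lower) auto
  have "N (mat 1) < 1" using z by (simp add: N_def moebius_one norm_klein_lt_iff)
  then have m1: "m < 1" using m_le [OF Gamma_one] by simp
  have "\<exists>A\<in>\<Gamma>. N A < m + inverse (real (Suc k))" for k
  proof -
    have "\<exists>x\<in>N ` \<Gamma>. x < m + inverse (real (Suc k))"
      unfolding m_def using Gamma_one by (intro cInf_lessD) (auto simp: inverse_eq_divide)
    then show ?thesis by blast
  qed
  then obtain A where A: "\<And>k. A k \<in> \<Gamma>" "\<And>k. N (A k) < m + inverse (real (Suc k))" by metis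
  define \<kappa> where "\<kappa> k = klein (moebius (A k) (Some z))" for k
  have "\<And>k. \<kappa> k \<in> cball 0 1" by (simp add: \<kappa>_def norm_klein_le)
  then obtain \<kappa>' r where r: "strict_mono r" "(\<kappa> \<circ> r) \<longlonglongrightarrow> \<kappa>'"
    using compact_cball [of "0::complex" 1] unfolding compact_def by meson
  have Nm: "(\<lambda>k. N (A k)) \<longlonglongrightarrow> m"
  proof (rule tendsto_sandwich)
    show "\<forall>\<^sub>F k in sequentially. m \<le> N (A k)" using m_le A by simp
    show "\<forall>\<^sub>F k in sequentially. N (A k) \<le> m + inverse (real (Suc k))"
      using A by (simp add: less_imp_le)
    show "(\<lambda>k. m + inverse (real (Suc k))) \<longlonglongrightarrow> m"
      using tendsto_add [OF tendsto_const LIMSEQ_inverse_real_of_nat, of m] by simp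
  qed simp
  have "(\<lambda>k. norm ((\<kappa> \<circ> r) k)) \<longlonglongrightarrow> norm \<kappa>'" using r by (intro tendsto_norm)
  moreover have "(\<lambda>k. norm ((\<kappa> \<circ> r) k)) \<longlonglongrightarrow> m"
    using LIMSEQ_subseq_LIMSEQ [OF Nm r(1)] by (simp add: comp_def N_def \<kappa>_def)
  ultimately have \<kappa>'m: "norm \<kappa>' = m" using LIMSEQ_unique by blast
  then have \<kappa>'1: "norm \<kappa>' < 1" using m1 by simp
  obtain w' where w': "klein_inv \<kappa>' = Some w'" "Im w' > 0"
    using klein_inv_half_plane [OF \<kappa>'1] by (auto simp: upper_half_plane_def)
  have kw': "klein (Some w') = \<kappa>'" using klein_klein_inv [of \<kappa>'] \<kappa>'1 w' by simp
  define w where "w k = moebius_plane (A (r k)) z" for k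
  have w: "moebius (A (r k)) (Some z) = Some (w k)" "Im (w k) > 0" for k
    using A Gamma_det z by (simp_all add: w_def moebius_Some Im_moebius_plane_pos)
  have "the (klein_inv ((\<kappa> \<circ> r) k)) = w k" for k
    using klein_inv_klein [of "Some (w k)"] w [of k] by (simp add: \<kappa>_def extended_half_def)
  then have "(\<lambda>k. the (klein_inv ((\<kappa> \<circ> r) k))) = w" by blast
  moreover have "(\<lambda>k. the (klein_inv ((\<kappa> \<circ> r) k))) \<longlonglongrightarrow> the (klein_inv \<kappa>')"
  proof -
    have "isCont (\<lambda>k. the (klein_inv k)) \<kappa>'"
      unfolding isCont_def by (rule klein_inv_tendsto [OF \<kappa>'1])
    then show ?thesis using r(2) by (rule isCont_tendsto_compose)
  qed
  ultimately have ww': "w \<longlonglongrightarrow> w'" using w' by simp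
  \<comment> \<open>The limit point need not belong to the orbit of z, but by continuity its own
    orbit also keeps distance at least m from the centre.\<close>
  have min: "m \<le> norm (klein (moebius B (Some w')))" if B: "B \<in> \<Gamma>" for B
  proof -
    have "(\<lambda>k. norm (klein (Some (moebius_plane B (w k))))) \<longlonglongrightarrow> norm (klein (Some (moebius_plane B w')))"
      using ww' isCont_klein_moebius_plane [OF Gamma_det [OF B] w'(2)]
      by (intro tendsto_norm isCont_tendsto_compose [of w' "\<lambda>w. klein (Some (moebius_plane B w))"])
    moreover have "m \<le> norm (klein (Some (moebius_plane B (w k))))" for k
    proof -
      have "Some (moebius_plane B (w k)) = moebius (B ** A (r k)) (Some z)"
        using w [of k] moebius_Some [OF Gamma_det [OF B] w(2)] A Gamma_det by (simp flip: moebius_mult)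
      then show ?thesis using m_le [OF Gamma_mult [OF B A(1)]] by (simp add: N_def)
    qed
    ultimately have "m \<le> norm (klein (Some (moebius_plane B w')))"
      by (intro LIMSEQ_le_const) auto
    then show ?thesis using moebius_Some [OF Gamma_det [OF B] w'(2)] by simp
  qed
  have "klein (Some w') \<in> polygon"
  proof (rule ccontr)
    assume "klein (Some w') \<notin> polygon"
    then obtain l where "side l (klein (Some w')) > 1" by (auto simp: polygon_def not_le)
    then have "norm (klein (moebius (pairing (- 1 - l)) (Some w'))) < m"
      using klein_pairing_decreases [OF w'(2)] kw' \<kappa>'m by simp
    then show False using min [OF pairing_in_Gamma] by (meson not_le)
  qed
  then have "\<forall>\<^sub>F y in nhds w'. \<exists>A\<in>\<Gamma>. klein (moebius A (Some y)) \<in> polygon \<and> fold_map (klein (moebius A (Some y))) \<in> UNIV"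
    using w'(2) by (intro eventually_near_polygon) auto
  then have "\<forall>\<^sub>F k in sequentially. \<exists>A\<in>\<Gamma>. klein (moebius A (Some (w k))) \<in> polygon \<and> fold_map (klein (moebius A (Some (w k)))) \<in> UNIV"
    using ww' by (rule eventually_compose_filterlim)
  then obtain k B where B: "B \<in> \<Gamma>" "klein (moebius B (Some (w k))) \<in> polygon"
    unfolding eventually_sequentially by blast
  then have "klein (moebius (B ** A (r k)) (Some z)) \<in> polygon"
    using w [of k] A Gamma_det by (simp flip: moebius_mult)
  then show ?thesis using Gamma_mult B A by blast
qed

end

subsection \<open>Parabolic elements and cusps\<close>

lemma uminus_eq_mat_1: "- B = mat 1 \<longleftrightarrow> B = - mat 1" "- B = - mat 1 \<longleftrightarrow> B = mat 1"
  for B :: "real^2^2"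
  by (metis minus_minus)+

lemma parabolic_uminus: "parabolic (- B) \<longleftrightarrow> parabolic B"
proof -
  have trace: "\<bar>trace (- B)\<bar> = \<bar>trace B\<bar>" by (simp add: trace_def sum_2)
  show ?thesis unfolding parabolic_def det_minus_mat2 uminus_eq_mat_1 trace by blast
qed

lemma parabolic_conjugate:
  assumes B: "parabolic B" and PQ: "P ** Q = mat 1" "Q ** P = mat 1"
  shows "parabolic (P ** B ** Q)"
proof -
  have "det P * det Q = 1" using PQ(1) by (metis det_I det_mul)
  then have "det (P ** B ** Q) = 1" using B by (simp add: det_mul parabolic_def)
  moreover have "trace (P ** B ** Q) = trace (Q ** (P ** B))"
    by (rule trace_mul_sym)
  then have "trace (P ** B ** Q) = trace B" by (simp add: matrix_mul_assoc PQ)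
  moreover have "B = Q ** (P ** B ** Q) ** P"
  proof -
    have "Q ** (P ** B ** Q) ** P = (Q ** P) ** B ** (Q ** P)" by (simp only: matrix_mul_assoc)
    then show ?thesis by (simp add: PQ)
  qed
  then have "P ** B ** Q \<noteq> mat 1" "P ** B ** Q \<noteq> - mat 1"
    using B by (auto simp: parabolic_def PQ minus_mat2_mult_left minus_mat2_mult_right)
  ultimately show ?thesis using B by (simp add: parabolic_def)
qed

text \<open>The off-diagonal entry times the trace vanishes, so that entry is 0 and a diagonal entry
  would square to -1. This excludes the one-letter words that pair a side with itself.\<close>

lemma not_parabolic_if_square:
  assumes "B ** B = - mat 1" shows "\<not> parabolic B"
proof
  assume p: "parabolic B"
  have eqs: "B$1$1 * B$1$1 + B$1$2 * B$2$1 = - 1" "B$1$1 * B$1$2 + B$1$2 * B$2$2 = 0"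
    using assms by (auto simp: mat2_eq_iff mat2_mult_nth)
  have t: "B$1$1 + B$2$2 = 2 \<or> B$1$1 + B$2$2 = - 2"
    using p by (auto simp: parabolic_def trace_def sum_2)
  have "B$1$2 * (B$1$1 + B$2$2) = 0" using eqs by (simp add: algebra_simps)
  then have "B$1$2 = 0" using t by auto
  then have "(B$1$1)\<^sup>2 = - 1" using eqs by (simp add: power2_eq_square)
  then show False by (smt (verit) zero_le_power2)
qed

text \<open>B - I squares to 0, so powers of B are affine in the exponent.\<close>

lemma unipotent_power:
  fixes B :: "real^2^2"
  assumes "det B = 1" "trace B = 2"
  shows "((**) B ^^ j) (mat 1)
     = mat2 (1 + j * (B$1$1 - 1)) (j * B$1$2) (j * B$2$1) (1 + j * (B$2$2 - 1))"
proof (induction j)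
  case 0
  show ?case by (simp add: mat2_eq_iff)
next
  case (Suc j)
  have d: "B$2$2 = 2 - B$1$1" using assms by (simp add: trace_def sum_2)
  have bc: "B$1$2 * B$2$1 = B$1$1 * (2 - B$1$1) - 1" using assms by (simp add: det_2 d)
  have "B$1$2 * (real j * B$2$1) = real j * (B$1$2 * B$2$1)"
    "B$2$1 * (real j * B$1$2) = real j * (B$1$2 * B$2$1)" by simp_all
  then have "B$1$2 * (real j * B$2$1) = real j * (B$1$1 * (2 - B$1$1) - 1)"
    "B$2$1 * (real j * B$1$2) = real j * (B$1$1 * (2 - B$1$1) - 1)"
    unfolding bc by simp_all
  then show ?case
    by (simp add: Suc mat2_eq_iff mat2_mult_nth d algebra_simps)
qed

text \<open>Convergence is stated for homogeneous coordinates so that a limit at infinity needs no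
  separate treatment.\<close>

lemma tendsto_klein_pair:
  assumes "a \<noteq> 0 \<or> b \<noteq> 0" "(f \<longlongrightarrow> a) F" "(g \<longlongrightarrow> b) F"
  shows "((\<lambda>x. klein_pair (f x) (g x)) \<longlongrightarrow> klein_pair a b) F"
proof -
  have "(cmod a)\<^sup>2 + (cmod b)\<^sup>2 \<noteq> 0" using assms(1) by (simp add: sum_power2_eq_zero_iff)
  then have "complex_of_real ((cmod a)\<^sup>2 + (cmod b)\<^sup>2) \<noteq> 0"
    unfolding of_real_eq_0_iff .
  then show ?thesis
    unfolding klein_pair_def using assms(2,3) by (intro tendsto_intros)
qed

text \<open>After division by j, the homogeneous coordinates of the j-th iterate of the point i tend
  to N (i, 1) with N = B - I. The image of N is the eigenline of B, that is, the fixed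
  point.\<close>

lemma parabolic_iterates_tendsto:
  assumes B: "parabolic B" and p: "p \<in> extended_real_line" "moebius B p = p"
  shows "(\<lambda>j. klein (moebius (((**) B ^^ j) (mat 1)) (Some \<i>))) \<longlonglongrightarrow> klein p"
proof -
  have trace_2: "(\<lambda>j. klein (moebius (((**) B ^^ j) (mat 1)) (Some \<i>))) \<longlonglongrightarrow> klein p"
    if B: "det B = 1" "trace B = 2" "B \<noteq> mat 1" and fixed: "moebius B p = p" for B
  proof -
    define a b c where "a = B$1$1 - 1" "b = B$1$2" "c = B$2$1"
    have d: "B$2$2 = 1 - a" using B(2) by (simp add: trace_def sum_2 a_b_c_def)
    have B11: "B$1$1 = 1 + a" by (simp add: a_b_c_def)
    have bc: "a\<^sup>2 + b * c = 0" using B(1) by (simp add: det_2 d B11 a_b_c_def(2,3) [symmetric] power2_eq_square algebra_simps)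
    have ne: "\<not> (a = 0 \<and> b = 0 \<and> c = 0)"
      using B(3) by (auto simp: mat2_eq_iff d a_b_c_def)
    \<comment> \<open>(u, v) is N (i, 1), where N = B - I has rows (a, b) and (c, -a).\<close>
    define u v where "u = of_real a * \<i> + of_real b" "v = of_real c * \<i> - of_real a"
    have uv: "u \<noteq> 0 \<or> v \<noteq> 0" using ne by (auto simp: u_v_def complex_eq_iff)
    have lim: "(\<lambda>j. inverse (of_nat (Suc j)) * x + y) \<longlonglongrightarrow> y" for x y :: complex
    proof -
      have "(\<lambda>j. complex_of_real (inverse (real (Suc j)))) \<longlonglongrightarrow> of_real 0"
        by (intro tendsto_of_real LIMSEQ_inverse_real_of_nat)
      then have "(\<lambda>j. complex_of_real (inverse (real (Suc j))) * x + y) \<longlonglongrightarrow> of_real 0 * x + y"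
        by (intro tendsto_add tendsto_mult tendsto_const)
      then show ?thesis by simp
    qed
    have eq: "klein (moebius (((**) B ^^ Suc j) (mat 1)) (Some \<i>))
        = klein_pair (inverse (of_nat (Suc j)) * \<i> + u) (inverse (of_nat (Suc j)) * 1 + v)" for j
    proof -
      define s :: complex where "s = of_nat (Suc j)"
      have s: "s \<noteq> 0" unfolding s_def by (metis of_nat_eq_0_iff nat.distinct(1))
      let ?M = "mat2 (1 + Suc j * a) (Suc j * b) (Suc j * c) (1 + Suc j * (- a))"
      have M: "((**) B ^^ Suc j) (mat 1) = ?M"
        unfolding unipotent_power [OF B(1,2)] by (simp add: mat2_eq_iff d B11 a_b_c_def(2,3))
      have "det ?M = 1 - (of_nat (Suc j))\<^sup>2 * (a\<^sup>2 + b * c)"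
        by (simp add: power2_eq_square algebra_simps)
      then have "det ?M = 1" using bc by simp
      then have "klein (moebius ?M (Some \<i>)) = klein_pair (row_apply ?M 1 (\<i>, 1)) (row_apply ?M 2 (\<i>, 1))"
        by (simp add: klein_moebius homogeneous_def)
      also have "row_apply ?M 1 (\<i>, 1) = s * (inverse s * \<i> + u)"
        using s by (simp add: row_apply_mat2 s_def [symmetric] u_v_def algebra_simps del: of_nat_Suc)
      also have "row_apply ?M 2 (\<i>, 1) = s * (inverse s * 1 + v)"
        using s by (simp add: row_apply_mat2 s_def [symmetric] u_v_def algebra_simps del: of_nat_Suc)
      finally show ?thesis
        using M s by (simp add: klein_pair_scale s_def)
    qed
    have "(\<lambda>j. klein_pair (inverse (of_nat (Suc j)) * \<i> + u) (inverse (of_nat (Suc j)) * 1 + v))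
        \<longlonglongrightarrow> klein_pair u v"
      using uv lim by (intro tendsto_klein_pair)
    then have "(\<lambda>j. klein (moebius (((**) B ^^ Suc j) (mat 1)) (Some \<i>))) \<longlonglongrightarrow> klein_pair u v"
      unfolding eq .
    then have "(\<lambda>j. klein (moebius (((**) B ^^ j) (mat 1)) (Some \<i>))) \<longlonglongrightarrow> klein_pair u v"
      by (rule LIMSEQ_imp_Suc)
    moreover have "klein p = klein_pair u v"
    proof -
      have "of_homogeneous u v = p"
      proof (cases p)
        case None
        then have "c = 0" using fixed by (auto simp: moebius_def a_b_c_def split: if_splits)
        moreover from this have "a = 0" using bc by simp
        ultimately show ?thesis by (simp add: None of_homogeneous_def u_v_def)
      next
        case (Some z)
        then obtain x :: real where x: "z = of_real x" using p(1) by (auto simp: extended_real_line_def)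
        have den: "of_real c * z + of_real (1 - a) \<noteq> 0"
          and "(of_real (1 + a) * z + of_real b) / (of_real c * z + of_real (1 - a)) = z"
          using fixed by (auto simp: Some moebius_def d B11 a_b_c_def(2,3) [symmetric] simp del: of_real_add of_real_diff split: if_splits)
        then have "of_real (1 + a) * z + of_real b = z * (of_real c * z + of_real (1 - a))"
          by (simp only: divide_eq_eq) simp
        then have "complex_of_real ((1 + a) * x + b) = of_real (x * (c * x + (1 - a)))"
          by (simp add: x)
        then have fixed_eq: "(1 + a) * x + b = x * (c * x + (1 - a))" by (simp only: of_real_eq_iff)
        \<comment> \<open>The quadratic equation for a finite fixed point x has discriminant zero,
          so it becomes a square and yields a = c x.\<close>
        have "(c * x - a)\<^sup>2 = c * (x * (c * x + (1 - a)) - (1 + a) * x - b) + (a\<^sup>2 + b * c)"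
          by (simp add: power2_eq_square algebra_simps)
        then have "(c * x - a)\<^sup>2 = 0" unfolding bc fixed_eq [symmetric] by simp
        then have a: "a = c * x" by simp
        then have b: "b = - c * x * x" using fixed_eq by (simp add: algebra_simps)
        have c: "c \<noteq> 0" using ne a b by auto
        have "u = of_real c * (\<i> - of_real x) * of_real x" "v = of_real c * (\<i> - of_real x) * 1"
          by (simp_all add: u_v_def a b algebra_simps)
        moreover have "of_real c * (\<i> - of_real x) \<noteq> 0" using c by (simp add: complex_eq_iff)
        ultimately have "of_homogeneous u v = of_homogeneous (of_real x) 1"
          by (simp only: of_homogeneous_scale not_False_eq_True)
        then show ?thesis by (simp add: Some x of_homogeneous_def)
      qed
      then show ?thesis using klein_of_homogeneous [OF uv] by simp
    qed
    ultimately show ?thesis by simp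
  qed
  show ?thesis
  proof (cases "trace B = 2")
    case True
    then show ?thesis using trace_2 B p by (simp add: parabolic_def)
  next
    case False
    \<comment> \<open>Trace -2 is reduced to trace 2 by passing to -B, whose iterates agree with
      those of B up to sign.\<close>
    have pow: "((**) (- B) ^^ j) (mat 1) = ((**) B ^^ j) (mat 1) \<or> ((**) (- B) ^^ j) (mat 1) = - ((**) B ^^ j) (mat 1)" for j
      by (induction j) (auto simp: minus_mat2_mult_left minus_mat2_mult_right)
    have "trace (- B) = 2" using False B by (auto simp: parabolic_def trace_def sum_2)
    then have "(\<lambda>j. klein (moebius (((**) (- B) ^^ j) (mat 1)) (Some \<i>))) \<longlonglongrightarrow> klein p"
      using trace_2 [of "- B"] B p by (simp add: parabolic_def det_minus_mat2 moebius_minus uminus_eq_mat_1)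
    moreover have "moebius (((**) (- B) ^^ j) (mat 1)) q = moebius (((**) B ^^ j) (mat 1)) q" for j q
      using pow [of j] by (auto simp: moebius_minus)
    ultimately show ?thesis by simp
  qed
qed

context ideal_polygon
begin

lemma reduced_append:
  "reduced ls \<Longrightarrow> reduced ms \<Longrightarrow> ls = [] \<or> ms = [] \<or> \<not> int n dvd last ls + hd ms + 1 \<Longrightarrow> reduced (ls @ ms)"
proof (induction ls rule: reduced.induct)
  case (1 l m ls)
  then show ?case by auto
next
  case ("2_2" l)
  then show ?case by (cases ms) auto
qed auto

lemma reduced_appendD1: "reduced (ls @ ms) \<Longrightarrow> reduced ls"
  by (induction ls rule: reduced.induct) auto

lemma reduced_rev: "reduced ls \<Longrightarrow> reduced (rev (map (\<lambda>l. - 1 - l) ls))"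
proof (induction ls rule: reduced.induct)
  case (1 l m ls)
  have *: "- 1 - m + (- 1 - l) + 1 = - (l + m + 1)" by simp
  have "\<not> int n dvd - 1 - m + (- 1 - l) + 1"
    unfolding * dvd_minus_iff using 1 by simp
  then have "reduced (rev (map (\<lambda>l. - 1 - l) (m # ls)) @ [- 1 - l])"
    using 1 by (intro reduced_append) auto
  then show ?case by simp
qed auto

text \<open>For a cyclically reduced word, the ping-pong lemma locates the limit of the iterates.\<close>

lemma parabolic_word_fixed_point_side:
  assumes "reduced ls" "ls \<noteq> []" and cyc: "\<not> int n dvd last ls + hd ls + 1"
    and B: "parabolic (word ls)" and p: "p \<in> extended_real_line" "moebius (word ls) p = p"
  shows "side (hd ls) (klein p) \<ge> 1"
proof -
  have red: "reduced (concat (replicate j ls)) \<and> (j > 0 \<longrightarrow> hd (concat (replicate j ls)) = hd ls)" for j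
  proof (induction j)
    case (Suc j)
    then show ?case using assms(1-3) by (cases j) (auto intro!: reduced_append)
  qed simp
  have pow: "((**) (word ls) ^^ j) (mat 1) = word (concat (replicate j ls))" for j
    by (induction j) (simp_all add: word_append)
  have i: "klein (Some \<i>) \<in> polygon"
    using zero_in_polygon by (simp add: klein_Some zero_complex.code)
  have "side (hd ls) (klein (moebius (((**) (word ls) ^^ Suc j) (mat 1)) (Some \<i>))) \<ge> 1" for j
  proof -
    define ms where "ms = concat (replicate (Suc j) ls)"
    have "ms \<noteq> []" "reduced ms" "hd ms = hd ls" using red [of "Suc j"] assms(2) by (auto simp: ms_def)
    then have "reduced (hd ls # tl ms)" "ms = hd ls # tl ms" by (metis list.collapse)+
    then show ?thesis unfolding pow using ping_pong [OF i] unfolding ms_def by metis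
  qed
  moreover have "(\<lambda>j. side (hd ls) (klein (moebius (((**) (word ls) ^^ Suc j) (mat 1)) (Some \<i>))))
      \<longlonglongrightarrow> side (hd ls) (klein p)"
    using LIMSEQ_Suc [OF parabolic_iterates_tendsto [OF B p]]
    by (intro isCont_tendsto_compose [OF isCont_side])
  ultimately show ?thesis by (intro LIMSEQ_le_const) auto
qed

definition vertex_point :: "int \<Rightarrow> complex option" where
  "vertex_point j = moebius (rot (of_int j * \<phi>)) None"

lemma vertex_point_real: "vertex_point j \<in> extended_real_line"
  unfolding vertex_point_def by (rule moebius_extended_real) (simp add: extended_real_line_def)

lemma klein_vertex_point: "klein (vertex_point j) = vertex j"
  by (simp add: vertex_point_def klein_rot_vertex)

lemma klein_eq_vertex: "p \<in> extended_half \<Longrightarrow> klein p = vertex j \<Longrightarrow> p = vertex_point j"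
  using klein_inject [of p "vertex_point j"] vertex_point_real extended_half_eq klein_vertex_point by auto

text \<open>Induction on the length handles words that are not cyclically reduced: conjugation by
  the first letter removes both ends. In the cyclically reduced case the word and its formal inverse
  are both used, and each puts p beyond one side.\<close>

lemma parabolic_word_fixed_point:
  assumes "reduced ls" "parabolic (word ls)" "p \<in> extended_real_line" "moebius (word ls) p = p"
  shows "\<exists>A\<in>\<Gamma>. \<exists>j. moebius A p = vertex_point j"
  using assms
proof (induction ls arbitrary: p rule: length_induct)
  case (1 ls p)
  note B = 1(2,3) and p = 1(4,5)
  have ne: "ls \<noteq> []" using B by (auto simp: parabolic_def)
  show ?case
  proof (cases "int n dvd last ls + hd ls + 1")
    case False
    define ms where "ms = rev (map (\<lambda>l. - 1 - l) ls)"
    have ms: "reduced ms" "ms \<noteq> []" "hd ms = - 1 - last ls" "last ms = - 1 - hd ls"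
      using B ne reduced_rev by (auto simp: ms_def hd_rev last_rev last_map hd_map)
    have *: "last ms + hd ms + 1 = - (last ls + hd ls + 1)" by (simp add: ms)
    have cyc: "\<not> int n dvd last ms + hd ms + 1"
      unfolding * dvd_minus_iff by (rule False)
    have inv: "word ms ** word ls = mat 1 \<or> word ms ** word ls = - mat 1"
      unfolding ms_def by (rule word_rev)
    have "moebius (word ms ** word ls) p = moebius (word ms) p"
      using p by (simp flip: moebius_mult)
    then have pm: "moebius (word ms) p = p"
      using inv by (auto simp: moebius_one moebius_minus)
    \<comment> \<open>An inverse of determinant 1 is the adjugate and has the same trace; the
      equations below read off its diagonal.\<close>
    have parm: "parabolic (word ms)"
    proof -
      have "parabolic C" if C: "C ** D = mat 1" "parabolic D" "det C = 1" for C D :: "real^2^2"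
      proof -
        have eqs: "C$1$1 * D$1$1 + C$1$2 * D$2$1 = 1" "C$1$1 * D$1$2 + C$1$2 * D$2$2 = 0"
          "C$2$1 * D$1$1 + C$2$2 * D$2$1 = 0" "C$2$1 * D$1$2 + C$2$2 * D$2$2 = 1"
          using C(1) by (auto simp: mat2_eq_iff mat2_mult_nth)
        have dD: "D$1$1 * D$2$2 - D$1$2 * D$2$1 = 1" using C(2) by (simp add: parabolic_def det_2)
        have "C$1$1 = C$1$1 * (D$1$1 * D$2$2 - D$1$2 * D$2$1)" by (simp add: dD)
        also have "\<dots> = D$2$2 * (C$1$1 * D$1$1 + C$1$2 * D$2$1) - D$2$1 * (C$1$1 * D$1$2 + C$1$2 * D$2$2)"
          by (simp add: algebra_simps)
        finally have c1: "C$1$1 = D$2$2" by (simp add: eqs)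
        have "C$2$2 = C$2$2 * (D$1$1 * D$2$2 - D$1$2 * D$2$1)" by (simp add: dD)
        also have "\<dots> = D$1$1 * (C$2$1 * D$1$2 + C$2$2 * D$2$2) - D$1$2 * (C$2$1 * D$1$1 + C$2$2 * D$2$1)"
          by (simp add: algebra_simps)
        finally have c2: "C$2$2 = D$1$1" by (simp add: eqs)
        have "C \<noteq> mat 1" "C \<noteq> - mat 1"
          using C(1,2) by (auto simp: parabolic_def minus_mat2_mult_left uminus_eq_mat_1)
        then show ?thesis using C c1 c2 by (auto simp: parabolic_def trace_def sum_2 add.commute)
      qed
      from this [of "word ms" "word ls"] this [of "- word ms" "word ls"]
      show ?thesis using inv B by (auto simp: minus_mat2_mult_left parabolic_uminus det_minus_mat2)
    qed
    have "side (hd ls) (klein p) \<ge> 1"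
      using parabolic_word_fixed_point_side B ne False p by blast
    moreover have "side (- 1 - last ls) (klein p) \<ge> 1"
      using parabolic_word_fixed_point_side [OF ms(1,2) cyc parm p(1) pm] ms by simp
    \<comment> \<open>That the word is cyclically reduced means precisely that these two sides are
      different.\<close>
    moreover have "hd ls mod int n \<noteq> (- 1 - last ls) mod int n"
      using False by (simp add: mod_eq_dvd_iff algebra_simps)
    ultimately obtain j where "klein p = vertex j"
      using two_sides_imp_vertex norm_klein_le by blast
    then have "p = vertex_point j" using klein_eq_vertex p(1) extended_half_eq by blast
    then show ?thesis using Gamma_one moebius_one by metis
  next
    case True
    define l k where "l = hd ls" "k = last ls"
    have pk: "pairing k = pairing (- 1 - l)"
      using True mod_eq_of_dvd [of l k] pairing_mod by (metis add.commute l_k_def)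
    show ?thesis
    proof (cases "tl ls = []")
      case True
      \<comment> \<open>A single letter that cancels with itself pairs a side with itself; its
        square is -I, so it cannot be parabolic.\<close>
      then have "ls = [l]" "k = l" using ne by (cases ls; simp add: l_k_def)+
      then have "word ls ** word ls = - mat 1" using pk pairing_inverse [of l] by simp
      then show ?thesis using not_parabolic_if_square B by blast
    next
      case False
      define mid where "mid = butlast (tl ls)"
      have ls: "ls = l # mid @ [k]"
        using ne False by (cases ls) (auto simp: l_k_def mid_def)
      have w: "word ls = pairing l ** word mid ** pairing (- 1 - l)"
        unfolding ls by (simp add: word_append pk matrix_mul_assoc)
      have w2: "pairing (- 1 - l) ** word ls = - (word mid ** pairing (- 1 - l))"
        unfolding w by (simp add: matrix_mul_assoc pairing_inverse' minus_mat2_mult_left)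
      define p' where "p' = moebius (pairing (- 1 - l)) p"
      have "moebius (word mid) p' = moebius (pairing (- 1 - l) ** word ls) p"
        unfolding w2 p'_def by (simp add: moebius_mult moebius_minus)
      also have "\<dots> = p'" using p by (simp flip: moebius_mult add: p'_def)
      finally have fixed: "moebius (word mid) p' = p'" .
      have "parabolic ((- pairing (- 1 - l)) ** word ls ** pairing l)"
        using B by (intro parabolic_conjugate)
          (simp_all add: pairing_inverse pairing_inverse' minus_mat2_mult_left minus_mat2_mult_right)
      moreover have "(- pairing (- 1 - l)) ** word ls ** pairing l = - word mid"
        unfolding minus_mat2_mult_left w2
        by (simp add: minus_mat2_mult_left minus_mat2_mult_right matrix_mul_assoc [symmetric] pairing_inverse')
      ultimately have par: "parabolic (word mid)" by (simp add: parabolic_uminus)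
      have "reduced mid" using B(1) ls reduced_Cons reduced_appendD1 by metis
      moreover have "length mid < length ls" using ls by simp
      moreover have "p' \<in> extended_real_line"
        unfolding p'_def using p moebius_extended_real by blast
      ultimately obtain A j where "A \<in> \<Gamma>" "moebius A p' = vertex_point j"
        using 1(1) par fixed by blast
      then have "A ** pairing (- 1 - l) \<in> \<Gamma>" "moebius (A ** pairing (- 1 - l)) p = vertex_point j"
        using Gamma_mult pairing_in_Gamma by (auto simp: p'_def moebius_mult)
      then show ?thesis by blast
    qed
  qed
qed

abbreviation cusp_set :: "complex option set" where
  "cusp_set \<equiv> cusp_points (Gamma_group n)"

lemma cusp_real: "p \<in> cusp_set \<Longrightarrow> p \<in> extended_real_line"
  by (simp add: cusp_points_def)

lemma cusp_equivalent_vertex: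
  assumes "p \<in> cusp_set"
  shows "\<exists>A\<in>\<Gamma>. \<exists>j. moebius A p = vertex_point j"
proof -
  obtain B where B: "B \<in> \<Gamma>" "parabolic B" "moebius B p = p" and p: "p \<in> extended_real_line"
    using assms by (auto simp: cusp_points_def)
  obtain ls where ls: "reduced ls" "B = word ls \<or> B = - word ls"
    using Gamma_reduced_word B by blast
  then have "parabolic (word ls)" "moebius (word ls) p = p"
    using B by (auto simp: parabolic_uminus moebius_minus)
  then show ?thesis using parabolic_word_fixed_point ls(1) p by blast
qed

lemma vertex_point_cusp: "vertex_point j \<in> cusp_set"
proof -
  have "lam n \<noteq> 0" using lam_sin cos_phi_pos by auto
  then have "parabolic (T_mat n ** T_mat n)"
    by (simp add: T_mat_def mat2_mult parabolic_def trace_def sum_2 mat2_eq_iff)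
  then have "parabolic (parabolic_gen j)"
    unfolding parabolic_gen_eq by (intro parabolic_conjugate) (simp_all add: rot_mult rot_0)
  moreover have "parabolic_gen j \<in> \<Gamma>"
    unfolding parabolic_gen_def by (intro Gamma_mult pairing_in_Gamma)
  moreover have "moebius (parabolic_gen j) (vertex_point j) = vertex_point j"
  proof -
    have "moebius (parabolic_gen j) (vertex_point j)
       = moebius (rot (of_int j * \<phi>) ** (T_mat n ** T_mat n) ** (rot (- of_int j * \<phi>) ** rot (of_int j * \<phi>))) None"
      unfolding parabolic_gen_eq vertex_point_def by (simp add: moebius_mult matrix_mul_assoc)
    also have "\<dots> = moebius (rot (of_int j * \<phi>)) (moebius (T_mat n) (moebius (T_mat n) None))"
      by (simp add: rot_mult rot_0 moebius_mult det_mul matrix_mul_assoc)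
    finally show ?thesis by (simp add: moebius_T_None vertex_point_def)
  qed
  ultimately show ?thesis using vertex_point_real by (auto simp: cusp_points_def)
qed

subsection \<open>The map to the sphere\<close>

text \<open>By \<open>sphere_map_eq\<close> the chosen element does not influence the value: two
  choices differ by a group element carrying a point of the polygon into the polygon.\<close>

definition sphere_map :: "complex option \<Rightarrow> complex \<times> real" where
  "sphere_map q = fold_map (klein (moebius (SOME A. A \<in> \<Gamma> \<and> klein (moebius A q) \<in> polygon) q))"

lemma Gamma_moebius: "B \<in> \<Gamma> \<Longrightarrow> moebius A (moebius B p) = moebius (A ** B) p"
  using Gamma_det moebius_mult by blast

lemma sphere_map_eq:
  assumes A: "A \<in> \<Gamma>" "klein (moebius A q) \<in> polygon"
  shows "sphere_map q = fold_map (klein (moebius A q))"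
proof -
  define B where "B = (SOME A. A \<in> \<Gamma> \<and> klein (moebius A q) \<in> polygon)"
  have B: "B \<in> \<Gamma> \<and> klein (moebius B q) \<in> polygon"
    unfolding B_def by (rule someI [of _ A]) (use A in blast)
  obtain B' where B': "B' \<in> \<Gamma>" "B' ** B = mat 1" using Gamma_inverse B by blast
  have "moebius (A ** B') (moebius B q) = moebius A q"
    using B B' by (simp add: Gamma_moebius matrix_mul_assoc [symmetric])
  then show ?thesis
    using fold_map_Gamma [of "A ** B'" "moebius B q"] Gamma_mult A B B'
    by (simp add: sphere_map_def B_def)
qed

abbreviation extended_plane :: "complex option set" where
  "extended_plane \<equiv> Some ` upper_half_plane \<union> cusp_set"

lemma extended_plane_subset: "extended_plane \<subseteq> extended_half"
  using cusp_real extended_half_eq by blast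

lemma extended_plane_covered:
  assumes "q \<in> extended_plane"
  shows "\<exists>A\<in>\<Gamma>. klein (moebius A q) \<in> polygon"
  using assms
proof
  assume "q \<in> Some ` upper_half_plane"
  then show ?thesis using Gamma_polygon_covers by (auto simp: upper_half_plane_def)
next
  assume "q \<in> cusp_set"
  then show ?thesis using cusp_equivalent_vertex klein_vertex_point vertex_in_polygon by metis
qed

lemma sphere_map_moebius:
  assumes q: "q \<in> extended_plane" and B: "B \<in> \<Gamma>"
  shows "sphere_map (moebius B q) = sphere_map q"
proof -
  obtain A where A: "A \<in> \<Gamma>" "klein (moebius A q) \<in> polygon"
    using extended_plane_covered q by blast
  obtain B' where B': "B' \<in> \<Gamma>" "B' ** B = mat 1" using Gamma_inverse B by blast
  have "moebius (A ** B') (moebius B q) = moebius A q"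
    using B B' by (simp add: Gamma_moebius matrix_mul_assoc [symmetric])
  then show ?thesis
    using sphere_map_eq [of "A ** B'" "moebius B q"] sphere_map_eq [OF A] Gamma_mult [OF A(1) B'(1)] A by simp
qed

section \<open>Fibres of the sphere map are orbits\<close>

abbreviation \<Gamma>_orbit :: "complex option \<Rightarrow> complex option set" where
  "\<Gamma>_orbit \<equiv> orbit (Gamma_group n) moebius"

lemma orbit_moebius:
  assumes "A \<in> \<Gamma>"
  shows "\<Gamma>_orbit (moebius A q) = \<Gamma>_orbit q"
proof -
  obtain A' where A': "A' \<in> \<Gamma>" "A' ** A = mat 1" using Gamma_inverse assms by blast
  have 1: "moebius B (moebius A q) \<in> \<Gamma>_orbit q" if "B \<in> \<Gamma>" for B
    unfolding orbit_def using that assms Gamma_mult Gamma_moebius by blast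
  have 2: "moebius B q \<in> \<Gamma>_orbit (moebius A q)" if "B \<in> \<Gamma>" for B
  proof -
    have "moebius B q = moebius (B ** A') (moebius A q)"
      using assms A' by (simp add: Gamma_moebius matrix_mul_assoc [symmetric])
    then show ?thesis unfolding orbit_def using that A' Gamma_mult by blast
  qed
  show ?thesis using 1 2 unfolding orbit_def by blast
qed

lemma sphere_map_eq_iff:
  assumes p: "p \<in> extended_plane" and q: "q \<in> extended_plane"
  shows "sphere_map p = sphere_map q \<longleftrightarrow> \<Gamma>_orbit p = \<Gamma>_orbit q"
proof
  assume eq: "sphere_map p = sphere_map q"
  obtain A where A: "A \<in> \<Gamma>" "klein (moebius A p) \<in> polygon"
    using extended_plane_covered p by blast
  obtain B where B: "B \<in> \<Gamma>" "klein (moebius B q) \<in> polygon"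
    using extended_plane_covered q by blast
  have "fold_map (klein (moebius A p)) = fold_map (klein (moebius B q))"
    using eq sphere_map_eq A B by metis
  moreover have "moebius A p \<in> extended_half" "moebius B q \<in> extended_half"
    using A B p q Gamma_det moebius_extended_half extended_plane_subset by blast+
  ultimately obtain C where "C \<in> \<Gamma>" "moebius C (moebius A p) = moebius B q"
    using fold_map_eq_imp_Gamma A B by blast
  then show "\<Gamma>_orbit p = \<Gamma>_orbit q" using orbit_moebius A B by metis
next
  assume "\<Gamma>_orbit p = \<Gamma>_orbit q"
  moreover have "moebius (mat 1) q \<in> \<Gamma>_orbit q" unfolding orbit_def using Gamma_one by blast
  ultimately have "q \<in> \<Gamma>_orbit p" by (simp add: moebius_one)
  then obtain A where "A \<in> \<Gamma>" "q = moebius A p" unfolding orbit_def by blast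
  then show "sphere_map p = sphere_map q" using sphere_map_moebius p by simp
qed

subsection \<open>Behaviour near the cusps\<close>

text \<open>Only sides 0 and -1 pass through the vertex 1. The finitely many others stay below 1
  near it by continuity.\<close>

lemma near_one_in_polygon:
  "\<exists>\<epsilon>>0. \<forall>k. norm (k - 1) < \<epsilon> \<and> side 0 k \<le> 1 \<and> side (- 1) k \<le> 1 \<longrightarrow> k \<in> polygon"
proof -
  define r where "r = (- 1) mod int n"
  define M where "M = {0..<int n} - {0, r}"
  have strict: "side m 1 < 1" if "m \<in> M" for m
  proof (rule ccontr)
    assume "\<not> side m 1 < 1"
    then have "side m (rcis 1 0) \<ge> 1" by (simp add: rcis_def)
    then obtain m' where m': "m' mod int n = m mod int n" "2 * of_int m' * \<phi> \<le> 0" "0 \<le> 2 * (of_int m' + 1) * \<phi>"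
      using side_ge_1_arc [of 1 m 0] by auto
    have "of_int m' \<le> (0::real)" "of_int m' + 1 \<ge> (0::real)"
      using m'(2,3) phi_pos by (simp_all add: mult_le_0_iff zero_le_mult_iff)
    then have "m' = 0 \<or> m' = - 1" by linarith
    then show False using that m'(1) by (auto simp: M_def r_def)
  qed
  have "\<forall>\<^sub>F k in nhds 1. \<forall>m\<in>M. side m k < 1"
  proof (intro eventually_ball_finite ballI)
    show "finite M" by (simp add: M_def)
    fix m assume "m \<in> M"
    then have "\<forall>\<^sub>F k in nhds 1. side m k \<in> {..<1}"
      using strict isCont_side by (intro eventually_in_open_if_isCont) auto
    then show "\<forall>\<^sub>F k in nhds 1. side m k < 1" by simp
  qed
  then obtain \<epsilon> where \<epsilon>: "\<epsilon> > 0" "\<And>k m. dist k 1 < \<epsilon> \<Longrightarrow> m \<in> M \<Longrightarrow> side m k < 1"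
    unfolding eventually_nhds_metric by blast
  have "k \<in> polygon" if k: "norm (k - 1) < \<epsilon>" "side 0 k \<le> 1" "side (- 1) k \<le> 1" for k
  proof -
    have "side m k \<le> 1" for m
    proof -
      have "m mod int n \<in> M \<or> m mod int n = 0 \<or> m mod int n = r"
        using mod_in_range [of m] by (cases "m mod int n = 0"; cases "m mod int n = r"; simp add: M_def)
      then have "side (m mod int n) k \<le> 1"
      proof (elim disjE)
        assume "m mod int n \<in> M"
        then show ?thesis using \<epsilon>(2) k(1) by (force simp: dist_norm)
      next
        assume "m mod int n = 0"
        then show ?thesis using k by simp
      next
        assume "m mod int n = r"
        then show ?thesis using k(3) side_mod [of "- 1" k] by (simp add: r_def)
      qed
      then show ?thesis by (simp add: side_mod)
    qed
    then show ?thesis by (simp add: polygon_def)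
  qed
  then show ?thesis using \<epsilon>(1) by blast
qed

section \<open>The polygon near its vertex at infinity\<close>

definition half_width :: real where
  "half_width = cos \<phi> / sin \<phi>"

lemma half_width_pos: "half_width > 0"
  using cos_phi_pos sin_phi_pos by (simp add: half_width_def)

lemma lam_half_width: "lam n = 2 * half_width"
  by (simp add: lam_eq half_width_def)

text \<open>So near infinity the polygon is a vertical strip, whose width is the translation length
  \<open>lam n\<close> of T.\<close>

lemma sides_le_1_iff: "side 0 (klein (Some w)) \<le> 1 \<and> side (- 1) (klein (Some w)) \<le> 1 \<longleftrightarrow> \<bar>Re w\<bar> \<le> half_width"
proof -
  have "side 0 (klein (Some w)) \<le> 1 \<longleftrightarrow> Re w \<le> half_width"
    using side_0_gt_1_iff [of w] sin_phi_pos by (simp add: half_width_def divide_less_eq flip: not_less)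
  moreover have "side (- 1) (klein (Some w)) \<le> 1 \<longleftrightarrow> - Re w \<le> half_width"
    unfolding side_m1_le_1_iff using sin_phi_pos by (simp add: half_width_def le_divide_eq) linarith
  ultimately show ?thesis by (auto simp: abs_le_iff)
qed

text \<open>Within the strip, large height and closeness to 1 in the disc amount to the same. This
  lemma and the next give the two directions.\<close>

lemma klein_near_one_if_high:
  assumes "\<epsilon> > 0"
  shows "\<exists>s>0. \<forall>w. Im w > s \<and> \<bar>Re w\<bar> \<le> half_width \<longrightarrow> norm (klein (Some w) - 1) < \<epsilon>"
proof -
  \<comment> \<open>The distance to 1 is at most (2 + 2 \<open>half_width\<close>) / D, where D =
    |w|^2 + 1 exceeds s; the summand 1 ensures that (Im w)^2 >= Im w.\<close>
  define s where "s = 1 + (2 + 2 * half_width) / \<epsilon>"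
  have s: "s > 1" using assms half_width_pos by (simp add: s_def)
  have "norm (klein (Some w) - 1) < \<epsilon>" if w: "Im w > s" "\<bar>Re w\<bar> \<le> half_width" for w
  proof -
    define D where "D = (cmod w)\<^sup>2 + 1"
    have "(Im w)\<^sup>2 \<ge> Im w * 1" unfolding power2_eq_square using w s by (intro mult_left_mono) auto
    then have D: "D > s" using w unfolding D_def cmod_power2 by (smt (verit) zero_le_power2)
    have D0: "D > 0" using D s by simp
    have "klein (Some w) - 1 = Complex (- 2 / D) (2 * Re w / D)"
      using D0 by (simp add: klein_Some D_def [symmetric] complex_eq_iff) (simp add: D_def field_simps)
    then have "norm (klein (Some w) - 1) \<le> \<bar>- 2 / D\<bar> + \<bar>2 * Re w / D\<bar>"
      using cmod_le [of "Complex (- 2 / D) (2 * Re w / D)"] by simp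
    also have "\<dots> = (2 + 2 * \<bar>Re w\<bar>) / D"
      using D0 by (simp add: abs_mult add_divide_distrib)
    also have "\<dots> \<le> (2 + 2 * half_width) / D" using w D0 by (intro divide_right_mono) auto
    also have "\<dots> < \<epsilon>"
    proof -
      have "(2 + 2 * half_width) / \<epsilon> < D" using D by (simp add: s_def)
      then show ?thesis using assms D0 by (simp add: field_simps)
    qed
    finally show ?thesis .
  qed
  then show ?thesis using s by (intro exI [of _ s]) auto
qed

lemma high_if_klein_near_one:
  "\<exists>\<epsilon>>0. \<forall>w. Im w \<ge> 0 \<and> \<bar>Re w\<bar> \<le> half_width \<and> norm (klein (Some w) - 1) < \<epsilon> \<longrightarrow> Im w > s"
proof -
  \<comment> \<open>The distance to 1 is at least 2 / D, so closeness below 2 / K gives D > K.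
    Subtracting the bound on the real part leaves (Im w)^2 > s^2.\<close>
  define K where "K = half_width\<^sup>2 + s\<^sup>2 + 1"
  have K: "K > 0" by (simp add: K_def add_nonneg_pos)
  have "Im w > s" if w: "Im w \<ge> 0" "\<bar>Re w\<bar> \<le> half_width" "norm (klein (Some w) - 1) < 2 / K" for w
  proof -
    define D where "D = (cmod w)\<^sup>2 + 1"
    have D0: "D > 0" by (simp add: D_def add_nonneg_pos)
    have "Re (klein (Some w) - 1) = - 2 / D"
      using D0 by (simp add: klein_Some D_def [symmetric]) (simp add: D_def field_simps)
    then have "2 / D \<le> norm (klein (Some w) - 1)"
      using abs_Re_le_cmod [of "klein (Some w) - 1"] D0 by simp
    then have "2 / D < 2 / K" using w by simp
    then have "K < D" using K D0 by (simp add: divide_less_cancel field_simps)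
    moreover have "(Re w)\<^sup>2 \<le> half_width\<^sup>2" using w(2) by (metis abs_ge_zero power2_abs power_mono)
    ultimately have "s\<^sup>2 < (Im w)\<^sup>2" unfolding K_def D_def cmod_power2 by linarith
    then show ?thesis using w(1) by (rule power2_less_imp_less)
  qed
  then show ?thesis using K by (intro exI [of _ "2 / K"]) auto
qed

text \<open>These are the powers of \<open>parabolic_gen j\<close>, hence only even powers of the
  conjugate of T.\<close>

lemma conjugate_translation_in_Gamma:
  "rot (of_int j * \<phi>) ** mat2 1 (of_int (2 * u) * lam n) 0 1 ** rot (- of_int j * \<phi>) \<in> \<Gamma>"
proof -
  define E where "E u = rot (of_int j * \<phi>) ** mat2 1 (of_int (2 * u) * lam n) 0 1 ** rot (- of_int j * \<phi>)" for u :: int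
  have mult: "E u ** E v = E (u + v)" for u v
  proof -
    have "E u ** E v = rot (of_int j * \<phi>) ** (mat2 1 (of_int (2 * u) * lam n) 0 1
        ** (rot (- of_int j * \<phi>) ** rot (of_int j * \<phi>)) ** mat2 1 (of_int (2 * v) * lam n) 0 1) ** rot (- of_int j * \<phi>)"
      unfolding E_def by (simp only: matrix_mul_assoc)
    also have "\<dots> = E (u + v)"
      unfolding E_def by (simp add: rot_mult rot_0 mat2_mult algebra_simps)
    finally show ?thesis .
  qed
  have E0: "E 0 = mat 1"
  proof -
    have "mat2 1 0 0 1 = mat 1" by (simp add: mat2_eq_iff)
    then show ?thesis by (simp add: E_def rot_mult rot_0)
  qed
  have "T_mat n ** T_mat n = mat2 1 (of_int (2 * 1) * lam n) 0 1"
    by (simp add: T_mat_def mat2_mult)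
  then have "E 1 = parabolic_gen j" unfolding E_def parabolic_gen_eq by simp
  then have E1: "E 1 \<in> \<Gamma>" unfolding parabolic_gen_def using Gamma_mult pairing_in_Gamma by simp
  then obtain B where B: "B \<in> \<Gamma>" "B ** E 1 = mat 1" using Gamma_inverse by blast
  have "E (- 1) = B ** (E 1 ** E (- 1))" by (simp add: matrix_mul_assoc B)
  then have "E (- 1) = B" by (simp add: mult E0)
  then have Em1: "E (- 1) \<in> \<Gamma>" using B by simp
  have "E u \<in> \<Gamma>"
  proof (induction u rule: int_induct [where k = 0])
    case base
    show ?case using E0 Gamma_one by simp
  next
    case (step1 i)
    then show ?case using Gamma_mult [OF _ E1, of "E i"] by (simp add: mult)
  next
    case (step2 i)
    then show ?case using Gamma_mult [OF _ Em1, of "E i"] by (simp add: mult)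
  qed
  then show ?thesis by (simp add: E_def)
qed

lemma gauge_vertex: "gauge (vertex j) = 1"
  using gauge_ge_norm [of "vertex j"] vertex_in_polygon [of j] gauge_le_1_iff by (simp add: order_antisym)

lemma fold_map_vertex_uminus: "fold_map (vertex (- j)) = fold_map (vertex j)"
  using fold_map_cnj [OF gauge_vertex] by (simp add: vertex_cnj)

lemma rot_cancel:
  "moebius (rot (of_int j * \<phi>)) (moebius (rot (- of_int j * \<phi>)) p) = p"
  "moebius (rot (- of_int j * \<phi>)) (moebius (rot (of_int j * \<phi>)) p) = p"
  by (simp_all add: moebius_mult rot_mult rot_0 moebius_one)

text \<open>In a horoball at a vertex, translate back to the polygon by a power of the parabolic
  generator of the stabiliser in the full triangle group. Odd powers need not be in \<open>\<Gamma>\<close>, but can be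
  corrected by a side pairing, which leads to the conjugate vertex.\<close>

lemma sphere_map_near_vertex:
  assumes U: "open U" "fold_map (vertex j) \<in> U"
  shows "\<exists>r>0. \<forall>z\<in>horoball (vertex_point j) r. sphere_map (Some z) \<in> U"
proof -
  have near: "\<exists>\<epsilon>>0. \<forall>k. norm (k - 1) < \<epsilon> \<longrightarrow> fold_map (vertex i * k) \<in> U"
    if "fold_map (vertex i) \<in> U" for i
  proof -
    have "isCont (\<lambda>k. fold_map (vertex i * k)) 1"
      by (intro isCont_o2 [OF _ isCont_fold_map] continuous_intros)
    then have "\<forall>\<^sub>F k in nhds 1. fold_map (vertex i * k) \<in> U"
      using that U(1) by (intro eventually_in_open_if_isCont) auto
    then show ?thesis unfolding eventually_nhds_metric dist_norm by blast
  qed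
  obtain \<epsilon>1 where \<epsilon>1: "\<epsilon>1 > 0" "\<And>k. norm (k - 1) < \<epsilon>1 \<Longrightarrow> fold_map (vertex j * k) \<in> U"
    using near U(2) by blast
  obtain \<epsilon>2 where \<epsilon>2: "\<epsilon>2 > 0" "\<And>k. norm (k - 1) < \<epsilon>2 \<Longrightarrow> fold_map (vertex (- j) * k) \<in> U"
    using near [of "- j"] U(2) by (auto simp: fold_map_vertex_uminus)
  obtain \<epsilon>3 where \<epsilon>3: "\<epsilon>3 > 0"
    "\<And>k. norm (k - 1) < \<epsilon>3 \<Longrightarrow> side 0 k \<le> 1 \<and> side (- 1) k \<le> 1 \<Longrightarrow> k \<in> polygon"
    using near_one_in_polygon by blast
  have "Min {\<epsilon>1, \<epsilon>2, \<epsilon>3} > 0" using \<epsilon>1 \<epsilon>2 \<epsilon>3 by simp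
  then obtain s where s: "s > 0"
    "\<And>w. Im w > s \<Longrightarrow> \<bar>Re w\<bar> \<le> half_width \<Longrightarrow> norm (klein (Some w) - 1) < Min {\<epsilon>1, \<epsilon>2, \<epsilon>3}"
    using klein_near_one_if_high by blast
  define Rm where "Rm = rot (- of_int j * \<phi>)"
  have detRm: "det Rm = 1" by (simp add: Rm_def)
  have RmN: "moebius Rm (vertex_point j) = None"
    unfolding vertex_point_def Rm_def rot_cancel by (rule refl)
  obtain r where r: "r > 0" "\<And>z. z \<in> horoball (vertex_point j) r \<Longrightarrow> moebius_plane Rm z \<in> horoball None s"
    using horoball_moebius [OF detRm vertex_point_real s(1)] RmN by metis
  have "sphere_map (Some z) \<in> U" if z: "z \<in> horoball (vertex_point j) r" for z
  proof -
    have Imz: "Im z > 0"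
      using horoball_subset_half_plane [OF vertex_point_real r(1)] z by (auto simp: upper_half_plane_def)
    define w where "w = moebius_plane Rm z"
    have w: "moebius Rm (Some z) = Some w" using moebius_Some [OF detRm Imz] by (simp add: w_def)
    have Imw: "Im w > s" using r(2) [OF z] by (simp add: w_def horoball_def)
    \<comment> \<open>The integer nearest to \<open>Re w / lam n\<close>, so that translating by -t
      steps brings w into the strip.\<close>
    define t where "t = \<lfloor>Re w / lam n + 1/2\<rfloor>"
    define w' where "w' = w - of_real (of_int t * lam n)"
    have l: "lam n > 0" using half_width_pos by (simp add: lam_half_width)
    have "of_int t \<le> Re w / lam n + 1/2" "Re w / lam n + 1/2 < of_int t + 1"
      unfolding t_def by linarith+
    then have "of_int t * lam n \<le> Re w + lam n / 2" "Re w + lam n / 2 < of_int t * lam n + lam n"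
      using l by (simp_all add: field_simps)
    then have "\<bar>Re w - of_int t * lam n\<bar> \<le> lam n / 2" by linarith
    then have Rew': "\<bar>Re w'\<bar> \<le> half_width" by (simp add: w'_def lam_half_width)
    have "Im w' > s" using Imw by (simp add: w'_def)
    then have k: "norm (klein (Some w') - 1) < \<epsilon>1" "norm (klein (Some w') - 1) < \<epsilon>2"
      "norm (klein (Some w') - 1) < \<epsilon>3"
      using s(2) Rew' by force+
    have "klein (Some w') \<in> polygon" using \<epsilon>3(2) k(3) Rew' sides_le_1_iff by blast
    then have cell: "vertex i * klein (Some w') \<in> polygon" for i
      by (simp add: vertex_mult_in_polygon_iff)
    \<comment> \<open>C performs the even part of the translation inside \<Gamma>, so a remainder of
      0 or 1 step is left.\<close>
    define u where "u = t div 2"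
    define C where "C = rot (of_int j * \<phi>) ** mat2 1 (of_int (2 * (- u)) * lam n) 0 1 ** Rm"
    have C: "C \<in> \<Gamma>"
      unfolding C_def Rm_def by (rule conjugate_translation_in_Gamma)
    have "moebius C (Some z)
        = moebius (rot (of_int j * \<phi>)) (moebius (mat2 1 (of_int (2 * (- u)) * lam n) 0 1) (moebius Rm (Some z)))"
      by (simp add: C_def moebius_mult detRm det_mul matrix_mul_assoc)
    also have "moebius (mat2 1 (of_int (2 * (- u)) * lam n) 0 1) (moebius Rm (Some z))
        = Some (w' + of_real (of_int (t - 2 * u) * lam n))"
      unfolding w by (simp add: moebius_def w'_def algebra_simps)
    finally have Cz: "moebius C (Some z) = moebius (rot (of_int j * \<phi>)) (Some (w' + of_real (of_int (t - 2 * u) * lam n)))" .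
    show ?thesis
    proof (cases "even t")
      case True
      then have "t - 2 * u = 0" by (simp add: u_def)
      then have "klein (moebius C (Some z)) = vertex j * klein (Some w')"
        unfolding Cz by (simp add: klein_rot_vertex)
      then show ?thesis using sphere_map_eq [OF C] cell \<epsilon>1(2) k(1) by simp
    next
      case False
      then have "t - 2 * u = 1" by (simp add: u_def odd_two_times_div_two_succ mod_2_eq_odd minus_mult_div_eq_mod)
      \<comment> \<open>Inserting a rotation and its inverse exhibits the leftover step, preceded by
        R^-j and followed by R^j, as g_j applied to R^-j w'; the partner of g_j undoes it.\<close>
      then have "Some (w' + of_real (of_int (t - 2 * u) * lam n))
          = moebius (T_mat n) (moebius (rot (of_int j * \<phi>)) (moebius (rot (- of_int j * \<phi>)) (Some w')))"
        unfolding rot_cancel by (simp add: moebius_T_Some)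
      then have Cz': "moebius C (Some z) = moebius (pairing j) (moebius (rot (- of_int j * \<phi>)) (Some w'))"
        unfolding Cz moebius_pairing by simp
      define A where "A = pairing (- 1 - j) ** C"
      have A: "A \<in> \<Gamma>" unfolding A_def using Gamma_mult pairing_in_Gamma C by blast
      have "moebius A (Some z) = moebius (pairing (- 1 - j)) (moebius (pairing j) (moebius (rot (- of_int j * \<phi>)) (Some w')))"
        unfolding A_def using Gamma_moebius [OF C] Cz' by metis
      also have "\<dots> = moebius (rot (of_int (- j) * \<phi>)) (Some w')"
        by (simp add: moebius_mult [of "pairing j"] pairing_inverse' moebius_minus moebius_one)
      finally have "klein (moebius A (Some z)) = vertex (- j) * klein (Some w')"
        by (simp only: klein_rot_vertex)
      then show ?thesis using sphere_map_eq [OF A] cell \<epsilon>2(2) k(2) by simp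
    qed
  qed
  then show ?thesis using r(1) by blast
qed

abbreviation extended_plane_topology :: "complex option topology" where
  "extended_plane_topology \<equiv> extended_half_plane (Gamma_group n)"

text \<open>A point of the half plane is transported into the polygon, a cusp to a vertex. There the
  local statements \<open>eventually_near_polygon\<close> and \<open>sphere_map_near_vertex\<close>
  apply.\<close>

lemma continuous_map_sphere_map: "continuous_map extended_plane_topology euclidean sphere_map"
  unfolding continuous_map topspace_extended_half_plane
proof (intro conjI allI impI)
  fix U :: "(complex \<times> real) set" assume "openin euclidean U"
  then have U: "open U" by simp
  let ?S = "{q \<in> extended_plane. sphere_map q \<in> U}"
  show "openin extended_plane_topology ?S"
    unfolding openin_extended_half_plane_iff
  proof (intro conjI ballI)
    show "?S \<subseteq> extended_plane" by blast
    show "open {z \<in> upper_half_plane. Some z \<in> ?S}"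
    proof (subst open_subopen, intro ballI)
      fix z assume z: "z \<in> {z \<in> upper_half_plane. Some z \<in> ?S}"
      then have Imz: "Im z > 0" and zU: "sphere_map (Some z) \<in> U" by (auto simp: upper_half_plane_def)
      obtain A where A: "A \<in> \<Gamma>" "klein (moebius A (Some z)) \<in> polygon"
        using Gamma_polygon_covers Imz by blast
      have detA: "det A = 1" using A Gamma_det by blast
      have Az: "moebius A (Some z) = Some (moebius_plane A z)" using moebius_Some [OF detA Imz] .
      have "\<forall>\<^sub>F y in nhds (moebius_plane A z). \<exists>B\<in>\<Gamma>. klein (moebius B (Some y)) \<in> polygon \<and>
           fold_map (klein (moebius B (Some y))) \<in> U"
        using A zU sphere_map_eq [OF A] U Az Im_moebius_plane_pos [OF detA Imz]
        by (intro eventually_near_polygon) auto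
      moreover have "filterlim (moebius_plane A) (nhds (moebius_plane A z)) (nhds z)"
        using isCont_moebius_plane [OF detA Imz] unfolding isCont_def tendsto_at_iff_tendsto_nhds .
      ultimately have "\<forall>\<^sub>F x in nhds z. \<exists>B\<in>\<Gamma>. klein (moebius B (Some (moebius_plane A x))) \<in> polygon \<and>
           fold_map (klein (moebius B (Some (moebius_plane A x)))) \<in> U"
        by (rule eventually_compose_filterlim)
      then have "\<forall>\<^sub>F x in nhds z. x \<in> {z \<in> upper_half_plane. Some z \<in> ?S}"
        using eventually_half_plane [OF Imz]
      proof eventually_elim
        case (elim x)
        then obtain B where B: "B \<in> \<Gamma>" "klein (moebius B (Some (moebius_plane A x))) \<in> polygon"
          "fold_map (klein (moebius B (Some (moebius_plane A x)))) \<in> U" by blast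
        have "moebius B (Some (moebius_plane A x)) = moebius (B ** A) (Some x)"
          using moebius_Some [OF detA] elim Gamma_moebius [OF A(1)] by metis
        then have "sphere_map (Some x) \<in> U"
          using sphere_map_eq [of "B ** A" "Some x"] B Gamma_mult [OF B(1) A(1)] by simp
        then show ?case using elim by (simp add: upper_half_plane_def)
      qed
      then show "\<exists>T. open T \<and> z \<in> T \<and> T \<subseteq> {z \<in> upper_half_plane. Some z \<in> ?S}"
        unfolding eventually_nhds by blast
    qed
    fix p assume p: "p \<in> ?S \<inter> cusp_set"
    obtain A j where A: "A \<in> \<Gamma>" "moebius A p = vertex_point j"
      using cusp_equivalent_vertex p by blast
    have "sphere_map p = fold_map (vertex j)"
      using sphere_map_eq [OF A(1), of p] A(2) klein_vertex_point vertex_in_polygon by simp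
    then obtain r where r: "r > 0" "\<And>z. z \<in> horoball (vertex_point j) r \<Longrightarrow> sphere_map (Some z) \<in> U"
      using sphere_map_near_vertex U p by (metis (no_types, lifting) Int_iff mem_Collect_eq)
    have pr: "p \<in> extended_real_line" using p cusp_real by blast
    obtain r' where r': "r' > 0" "\<And>z. z \<in> horoball p r' \<Longrightarrow> moebius_plane A z \<in> horoball (vertex_point j) r"
      using horoball_moebius [OF Gamma_det [OF A(1)] pr r(1)] A(2) by metis
    have "Some z \<in> ?S" if z: "z \<in> horoball p r'" for z
    proof -
      have zH: "z \<in> upper_half_plane" using horoball_subset_half_plane [OF pr r'(1)] z by blast
      then have "moebius A (Some z) = Some (moebius_plane A z)"
        using moebius_Some [OF Gamma_det [OF A(1)]] by (simp add: upper_half_plane_def)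
      then have "sphere_map (Some z) = sphere_map (Some (moebius_plane A z))"
        using sphere_map_moebius [OF _ A(1), of "Some z"] zH by simp
      then show ?thesis using r(2) r'(2) [OF z] zH by simp
    qed
    then show "\<exists>r>0. Some ` horoball p r \<subseteq> ?S" using r'(1) by blast
  qed
qed simp

subsection \<open>Compactness\<close>

lemma klein_inv_vertex: "klein_inv (vertex j) = vertex_point j"
  using klein_inv_klein [of "vertex_point j"] vertex_point_real extended_half_eq klein_vertex_point by auto

lemma klein_inv_polygon:
  assumes "k \<in> polygon"
  shows "klein_inv k \<in> extended_plane"
proof (cases "norm k = 1")
  case True
  then obtain j where "k = vertex j" using polygon_norm_1 assms by blast
  then show ?thesis using klein_inv_vertex vertex_point_cusp by simp
next
  case False
  then have "norm k < 1" using norm_polygon_le [OF assms] by simp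
  then show ?thesis using klein_inv_half_plane by blast
qed

text \<open>No neighbourhood of a vertex in the closed disc lies in a horoball, but its part inside
  the polygon does: moved to infinity, the polygon lies in a strip, where closeness to the vertex
  means height.\<close>

lemma vertex_point_horoball_near:
  assumes r: "r > 0"
  shows "\<exists>\<epsilon>>0. \<forall>k\<in>polygon. dist k (vertex j) < \<epsilon> \<longrightarrow>
     klein_inv k \<in> insert (vertex_point j) (Some ` horoball (vertex_point j) r)"
proof -
  define Rj where "Rj = rot (of_int j * \<phi>)"
  have detRj: "det Rj = 1" by (simp add: Rj_def)
  obtain s where s: "s > 0" "\<And>z. z \<in> horoball None s \<Longrightarrow> moebius_plane Rj z \<in> horoball (vertex_point j) r"
    using horoball_moebius [OF detRj _ r, of None] by (auto simp: extended_real_line_def vertex_point_def Rj_def)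
  obtain \<epsilon> where \<epsilon>: "\<epsilon> > 0"
    "\<And>w. Im w \<ge> 0 \<Longrightarrow> \<bar>Re w\<bar> \<le> half_width \<Longrightarrow> norm (klein (Some w) - 1) < \<epsilon> \<Longrightarrow> Im w > s"
    using high_if_klein_near_one [of s] by blast
  have "klein_inv k \<in> insert (vertex_point j) (Some ` horoball (vertex_point j) r)"
    if k: "k \<in> polygon" "dist k (vertex j) < \<epsilon>" for k
  proof -
    define k' where "k' = vertex (- j) * k"
    have k': "k' \<in> polygon" using k by (simp add: k'_def vertex_mult_in_polygon_iff)
    have kk': "k = vertex j * k'" by (simp add: k'_def mult.assoc [symmetric] vertex_mult)
    have "k' - 1 = vertex (- j) * (k - vertex j)"
      by (simp add: k'_def right_diff_distrib vertex_mult)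
    then have near: "norm (k' - 1) < \<epsilon>" using k by (simp add: norm_mult dist_norm)
    have k'1: "norm k' \<le> 1" using norm_polygon_le k' by blast
    show ?thesis
    proof (cases "klein_inv k'")
      case None
      then have "k' = 1" using klein_klein_inv [OF k'1] by simp
      then show ?thesis by (simp add: kk' klein_inv_vertex)
    next
      case (Some w)
      have kw: "klein (Some w) = k'" using klein_klein_inv [OF k'1] Some by simp
      have Imw: "Im w \<ge> 0" using klein_inv_in_extended_half [OF k'1] Some by (auto simp: extended_half_def)
      have "\<bar>Re w\<bar> \<le> half_width" using k' kw sides_le_1_iff [of w] by (simp add: polygon_def)
      then have high: "Im w > s" using \<epsilon>(2) Imw near kw by simp
      then have Imw': "Im w > 0" using s by simp
      have "klein (moebius Rj (Some w)) = k" by (simp add: Rj_def klein_rot_vertex kw kk')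
      then have "klein_inv k = moebius Rj (Some w)"
        using klein_inv_klein [of "moebius Rj (Some w)"] moebius_extended_half [OF detRj, of "Some w"] Imw
        by (simp add: extended_half_def)
      also have "\<dots> = Some (moebius_plane Rj w)" using moebius_Some [OF detRj Imw'] .
      finally show ?thesis using s(2) [of w] high by (simp add: horoball_def)
    qed
  qed
  then show ?thesis using \<epsilon>(1) by blast
qed

text \<open>This transfers compactness of the Euclidean polygon, vertices included, to the horoball
  topology.\<close>

lemma continuous_map_klein_inv: "continuous_map (top_of_set polygon) extended_plane_topology klein_inv"
  unfolding continuous_map
proof (intro conjI allI impI)
  show "klein_inv ` topspace (top_of_set polygon) \<subseteq> topspace extended_plane_topology"
    using klein_inv_polygon by (auto simp: topspace_extended_half_plane)
  fix U assume U: "openin extended_plane_topology U"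
  then have oU: "open {z \<in> upper_half_plane. Some z \<in> U}"
    and cU: "\<And>p. p \<in> U \<inter> cusp_set \<Longrightarrow> \<exists>r>0. Some ` horoball p r \<subseteq> U"
    unfolding openin_extended_half_plane_iff by blast+
  have "\<exists>e>0. \<forall>k'\<in>polygon. dist k' k < e \<longrightarrow> klein_inv k' \<in> U"
    if k: "k \<in> polygon" "klein_inv k \<in> U" for k
  proof (cases "norm k = 1")
    case True
    then obtain j where j: "k = vertex j" using polygon_norm_1 k by blast
    then obtain r where "r > 0" "Some ` horoball (vertex_point j) r \<subseteq> U"
      using cU [of "vertex_point j"] k klein_inv_vertex vertex_point_cusp by auto
    then show ?thesis
      using vertex_point_horoball_near [of r j] k j klein_inv_vertex by (metis insert_iff subsetD)
  next
    case False
    then have k1: "norm k < 1" using norm_polygon_le [OF k(1)] by simp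
    have "isCont (\<lambda>k. the (klein_inv k)) k" unfolding isCont_def by (rule klein_inv_tendsto [OF k1])
    moreover have "the (klein_inv k) \<in> {z \<in> upper_half_plane. Some z \<in> U}"
      using klein_inv_half_plane [OF k1] k(2) by auto
    ultimately have 1: "\<forall>\<^sub>F k' in nhds k. the (klein_inv k') \<in> {z \<in> upper_half_plane. Some z \<in> U}"
      by (rule eventually_in_open_if_isCont [OF _ oU])
    have "k \<noteq> 1" using k1 by auto
    then have 2: "\<forall>\<^sub>F k' in nhds k. k' \<in> - {1}" by (intro eventually_nhds_in_open) auto
    have "\<forall>\<^sub>F k' in nhds k. klein_inv k' \<in> U"
      using 1 2
    proof eventually_elim
      case (elim k')
      then have "klein_inv k' = Some (the (klein_inv k'))" by (simp add: klein_inv_def)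
      then show ?case using elim by (metis (no_types, lifting) mem_Collect_eq)
    qed
    then show ?thesis unfolding eventually_nhds_metric by blast
  qed
  then show "openin (top_of_set polygon) {k \<in> topspace (top_of_set polygon). klein_inv k \<in> U}"
    unfolding openin_euclidean_subtopology_iff by auto
qed

section \<open>The completed quotient is a sphere\<close>

lemma completed_quotient_sphere:
  "completed_quotient (Gamma_group n) homeomorphic_space top_of_set two_sphere"
proof -
  let ?X = extended_plane_topology and ?Q = "completed_quotient (Gamma_group n)"
  have X: "topspace ?X = extended_plane" by (rule topspace_extended_half_plane)
  have q: "quotient_map ?X ?Q \<Gamma>_orbit"
    unfolding completed_quotient_def by (rule quotient_map_quotient_topology)
  have Q: "topspace ?Q = \<Gamma>_orbit ` extended_plane"
    unfolding completed_quotient_def by (simp add: X)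
  have in_sphere: "sphere_map p \<in> two_sphere" if "p \<in> extended_plane" for p
    using extended_plane_covered [OF that] sphere_map_eq fold_map_polygon by (metis imageI)
  have cont: "continuous_map ?X (top_of_set two_sphere) sphere_map"
    using continuous_map_sphere_map in_sphere by (auto simp: continuous_map_in_subtopology X)
  have "sphere_map p = sphere_map q" if "p \<in> topspace ?X" "q \<in> topspace ?X" "\<Gamma>_orbit p = \<Gamma>_orbit q" for p q
    using that sphere_map_eq_iff unfolding X by blast
  then obtain g where g: "continuous_map ?Q (top_of_set two_sphere) g"
    "g ` topspace ?Q = sphere_map ` topspace ?X"
    "\<And>p. p \<in> topspace ?X \<Longrightarrow> g (\<Gamma>_orbit p) = sphere_map p"
    using quotient_map_lift_exists [OF q cont] by blast
  have "homeomorphic_map ?Q (top_of_set two_sphere) g"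
  proof (rule continuous_imp_homeomorphic_map [OF g(1)])
    show "Hausdorff_space (top_of_set two_sphere)" by (simp add: Hausdorff_space_subtopology)
    \<comment> \<open>Every orbit meets the polygon, so the quotient is a continuous image of a
      compact set. This is what upgrades the bijection g to a homeomorphism.\<close>
    have "topspace ?Q = \<Gamma>_orbit ` klein_inv ` polygon"
    proof
      show "topspace ?Q \<subseteq> \<Gamma>_orbit ` klein_inv ` polygon"
      proof
        fix x assume "x \<in> topspace ?Q"
        then obtain p where p: "p \<in> extended_plane" "x = \<Gamma>_orbit p" using Q by blast
        obtain A where A: "A \<in> \<Gamma>" "klein (moebius A p) \<in> polygon"
          using extended_plane_covered p by blast
        have "moebius A p \<in> extended_half"
          using extended_plane_subset p Gamma_det [OF A(1)] moebius_extended_half by blast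
        then have "klein_inv (klein (moebius A p)) = moebius A p" by (rule klein_inv_klein)
        then have "x = \<Gamma>_orbit (klein_inv (klein (moebius A p)))"
          using orbit_moebius A p by simp
        then show "x \<in> \<Gamma>_orbit ` klein_inv ` polygon" using A by blast
      qed
      show "\<Gamma>_orbit ` klein_inv ` polygon \<subseteq> topspace ?Q"
        unfolding Q using klein_inv_polygon by blast
    qed
    moreover have "compactin (top_of_set polygon) polygon"
      using compact_polygon by (simp add: compactin_subtopology)
    then have "compactin ?Q (\<Gamma>_orbit ` klein_inv ` polygon)"
      using image_compactin continuous_map_klein_inv quotient_imp_continuous_map [OF q] by metis
    ultimately show "compact_space ?Q" by (simp add: compact_space_def)
    show "inj_on g (topspace ?Q)"
      using g(3) sphere_map_eq_iff unfolding Q X by (auto simp: inj_on_def)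
    have "two_sphere \<subseteq> sphere_map ` extended_plane"
    proof
      fix y :: "complex \<times> real" assume "y \<in> two_sphere"
      then obtain k where k: "k \<in> polygon" "y = fold_map k" using fold_map_polygon by blast
      have "klein (klein_inv k) = k" using klein_klein_inv norm_polygon_le k by blast
      then have "sphere_map (klein_inv k) = y"
        using sphere_map_eq [OF Gamma_one, of "klein_inv k"] k by (simp add: moebius_one)
      then show "y \<in> sphere_map ` extended_plane" using klein_inv_polygon k by blast
    qed
    then show "g ` topspace ?Q = topspace (top_of_set two_sphere)"
      unfolding g(2) X using in_sphere by auto
  qed
  then show ?thesis by (rule homeomorphic_map_imp_homeomorphic_space)
qed

subsection \<open>The number of cusps\<close>

lemma vertex_eq_imp_dvd:
  assumes "vertex i = vertex j"
  shows "int n dvd i - j"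
proof -
  have "vertex (i - j) = vertex i * vertex (- j)" by (simp add: vertex_mult)
  also have "\<dots> = 1" using assms by (simp add: vertex_mult)
  finally have "Re (vertex (i - j)) = 1" by simp
  then have "cos (2 * of_int (i - j) * \<phi>) = 1" by (simp add: vertex_def)
  then obtain t :: int where "2 * of_int (i - j) * \<phi> = of_int t * 2 * pi"
    using cos_one_2pi_int by blast
  then have "2 * \<phi> * (of_int (i - j) - of_int (t * int n)) = 0"
    unfolding n_phi [symmetric] by (simp add: algebra_simps)
  then have "real_of_int (i - j) = of_int (t * int n)" using phi_pos by simp
  then have "i - j = t * int n" by (simp only: of_int_eq_iff)
  then show ?thesis by simp
qed

lemma sphere_map_vertex_point: "sphere_map (vertex_point j) = fold_map (vertex j)"
  using sphere_map_eq [OF Gamma_one, of "vertex_point j"] vertex_in_polygon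
  by (simp add: moebius_one klein_vertex_point)

text \<open>Orbits of vertices are distinguished by their folded values, and the vertices with
  labels i and j fold together only if j is i or -i modulo n. Hence the labels 0, ..., n div 2 form
  a system of representatives.\<close>

lemma card_cusps: "card (cusps (Gamma_group n)) = n div 2 + 1"
proof -
  define v where "v j = \<Gamma>_orbit (vertex_point (int j))" for j :: nat
  have ext: "vertex_point j \<in> extended_plane" for j using vertex_point_cusp by blast
  have "inj_on v {..n div 2}"
  proof (rule inj_onI)
    fix i j assume ij: "i \<in> {..n div 2}" "j \<in> {..n div 2}" and "v i = v j"
    then have "fold_map (vertex (int i)) = fold_map (vertex (int j))"
      using sphere_map_eq_iff [OF ext ext] by (simp add: v_def sphere_map_vertex_point)
    then have "vertex (int i) = vertex (int j) \<or> vertex (int j) = vertex (- int i)"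
      using fold_map_eq [OF vertex_in_polygon vertex_in_polygon] by (metis vertex_cnj)
    then have "int n dvd int i - int j \<or> int n dvd int j + int i"
      using vertex_eq_imp_dvd by fastforce
    moreover have "\<bar>int i - int j\<bar> < int n" "int j + int i \<le> int n"
      using ij n_ge_3 by auto
    ultimately show "i = j"
    proof (elim disjE)
      assume "int n dvd int i - int j"
      then show ?thesis using \<open>\<bar>int i - int j\<bar> < int n\<close> zdvd_not_zless [of "\<bar>int i - int j\<bar>" "int n"] by force
    next
      assume d: "int n dvd int j + int i"
      \<comment> \<open>As both labels are at most n div 2, a sum of at least n means that both
        equal n / 2, a vertex that is its own conjugate.\<close>
      then have "j + i = 0 \<or> j + i \<ge> n" using zdvd_imp_le [of "int n" "int j + int i"] by linarith
      then show ?thesis using ij by auto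
    qed
  qed
  moreover have "cusps (Gamma_group n) = v ` {..n div 2}"
  proof
    show "v ` {..n div 2} \<subseteq> cusps (Gamma_group n)"
      unfolding cusps_def orbits_def v_def using vertex_point_cusp by blast
    show "cusps (Gamma_group n) \<subseteq> v ` {..n div 2}"
    proof
      fix x assume "x \<in> cusps (Gamma_group n)"
      then obtain p where p: "p \<in> cusp_set" "x = \<Gamma>_orbit p" unfolding cusps_def orbits_def by blast
      then obtain j where "x = \<Gamma>_orbit (vertex_point j)"
        using cusp_equivalent_vertex orbit_moebius by metis
      moreover define m where "m = nat (j mod int n)"
      have m: "int m = j mod int n" "m < n" using n_ge_3 by (auto simp: m_def nat_less_iff)
      have "\<exists>i\<le>n div 2. fold_map (vertex j) = fold_map (vertex (int i))"
      proof (cases "m \<le> n div 2")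
        case True
        then show ?thesis using m vertex_mod [of j] by metis
      next
        case False
        then have "n - m \<le> n div 2" by linarith
        moreover have "int (n - m) mod int n = (- j) mod int n"
          using m by (simp add: of_nat_diff mod_eq_dvd_iff)
        then have "vertex (int (n - m)) = vertex (- j)" by (metis vertex_mod)
        ultimately show ?thesis using fold_map_vertex_uminus by metis
      qed
      then obtain i where "i \<le> n div 2" "fold_map (vertex j) = fold_map (vertex (int i))" by blast
      ultimately have "x = v i"
        using sphere_map_eq_iff [OF ext ext] by (simp add: v_def sphere_map_vertex_point)
      then show "x \<in> v ` {..n div 2}" using \<open>i \<le> n div 2\<close> by blast
    qed
  qed
  ultimately show ?thesis by (simp add: card_image)
qed

end

theorem mainTheorem3:
  fixes n :: nat
  assumes "n \<ge> 5" and "n \<noteq> 6"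
  shows "quotient_has_genus (Gamma_group n) 0 \<and>
         card (cusps (Gamma_group n)) = (if odd n then (n + 1) div 2 else (n + 2) div 2)"
proof -
  interpret ideal_polygon n using assms by unfold_locales simp
  have "quotient_has_genus (Gamma_group n) 0"
    unfolding quotient_has_genus_def
    using completed_quotient_sphere by (rule closed_surface_of_genus_0_if_sphere)
  moreover have "n div 2 + 1 = (if odd n then (n + 1) div 2 else (n + 2) div 2)"
    by (auto elim: oddE evenE)
  ultimately show ?thesis using card_cusps by simp
qed

end
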